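(* There exists $V_*>0$ such that for all closed oriented hyperbolic 3-manifolds $M$ of volume $V>V_*$, $$\mathrm{sys}(M) < \log(V)-0.8482 ,$$ where $\mathrm{sys}(M)$ is the systole length of $M$.
   Context: A closed oriented hyperbolic 3-manifold is a connected quotient $\Gamma\backslash\mathbb H^3$, with $\mathbb H^3$ hyperbolic 3-space (sectional curvature $-1$) and $\Gamma$ a torsion-free cocompact discrete subgroup of $\mathrm{PSL}_2(\mathbb C)$. The systole length $\mathrm{sys}(M)$ is the length of the shortest closed geodesic of $M$. $\log$ is the natural logarithm. *)

theory Defs
  imports "HOL-Analysis.Analysis" "HOL-Algebra.Group_Action"
begin

section \<open>The quotient topology\<close>

definition quotient_topology :: "'a topology \<Rightarrow> ('a \<Rightarrow> 'b) \<Rightarrow> 'b topology" where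
  "quotient_topology X q =
     topology (\<lambda>U. U \<subseteq> q ` topspace X \<and> openin X {x \<in> topspace X. q x \<in> U})"

lemma openin_quotient_topology:
  "openin (quotient_topology X q) U \<longleftrightarrow>
     U \<subseteq> q ` topspace X \<and> openin X {x \<in> topspace X. q x \<in> U}"
proof -
  have "istopology (\<lambda>U. U \<subseteq> q ` topspace X \<and> openin X {x \<in> topspace X. q x \<in> U})"
  proof (unfold istopology_def, intro conjI allI impI)
    fix S T
    assume S: "S \<subseteq> q ` topspace X \<and> openin X {x \<in> topspace X. q x \<in> S}"
      and T: "T \<subseteq> q ` topspace X \<and> openin X {x \<in> topspace X. q x \<in> T}"
    show "S \<inter> T \<subseteq> q ` topspace X" using S by blast
    have "{x \<in> topspace X. q x \<in> S \<inter> T} =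
        {x \<in> topspace X. q x \<in> S} \<inter> {x \<in> topspace X. q x \<in> T}" by blast
    then show "openin X {x \<in> topspace X. q x \<in> S \<inter> T}" using S T by auto
  next
    fix K
    assume K: "\<forall>S\<in>K. S \<subseteq> q ` topspace X \<and> openin X {x \<in> topspace X. q x \<in> S}"
    show "\<Union> K \<subseteq> q ` topspace X" using K by blast
    have "{x \<in> topspace X. q x \<in> \<Union> K} = (\<Union>S\<in>K. {x \<in> topspace X. q x \<in> S})" by blast
    then show "openin X {x \<in> topspace X. q x \<in> \<Union> K}" using K by auto
  qed
  then show ?thesis by (simp add: quotient_topology_def topology_inverse')
qed

lemma topspace_quotient_topology: "topspace (quotient_topology X q) = q ` topspace X"
proof
  have "{x \<in> topspace X. q x \<in> q ` topspace X} = topspace X" by blast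
  then have "openin (quotient_topology X q) (q ` topspace X)"
    by (simp add: openin_quotient_topology)
  then show "q ` topspace X \<subseteq> topspace (quotient_topology X q)" by (rule openin_subset)
  show "topspace (quotient_topology X q) \<subseteq> q ` topspace X"
    using openin_topspace openin_quotient_topology by metis
qed

lemma quotient_map_quotient_topology: "quotient_map X (quotient_topology X q) q"
  by (auto simp: quotient_map_def topspace_quotient_topology openin_quotient_topology)


section \<open>The group $\mathrm{PSL}_2(\mathbb C)$\<close>

definition SL2C :: "(complex^2^2) monoid" where
  "SL2C = \<lparr>carrier = {A. det A = 1}, monoid.mult = (**), one = mat 1\<rparr>"

definition PSL2C :: "(complex^2^2) set monoid" where
  "PSL2C = SL2C Mod {mat 1, - mat 1}"

definition PSL2C_topology :: "(complex^2^2) set topology" where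
  "PSL2C_topology =
     quotient_topology (top_of_set (carrier SL2C)) (\<lambda>A. {mat 1, - mat 1} #>\<^bsub>SL2C\<^esub> A)"

lemma group_SL2C: "group SL2C"
proof (rule groupI)
  fix A assume "A \<in> carrier SL2C"
  then have d: "det A = 1" by (simp add: SL2C_def)
  then have "invertible A" by (simp add: invertible_det_nz)
  then obtain B where B: "A ** B = mat 1" "B ** A = mat 1" unfolding invertible_def by blast
  then have "det B = 1" using d det_mul[of B A] by simp
  then show "\<exists>B\<in>carrier SL2C. B \<otimes>\<^bsub>SL2C\<^esub> A = \<one>\<^bsub>SL2C\<^esub>"
    using B by (auto simp: SL2C_def)
qed (auto simp: SL2C_def det_mul matrix_mul_assoc)

lemma minus_mat_one_mult:
  fixes A :: "complex^2^2"
  shows "(- mat 1) ** A = - A" "A ** (- mat 1) = - A"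
  by (auto simp: vec_eq_iff matrix_matrix_mult_def sum_2 forall_2 mat_def)

lemma normal_center_SL2C: "normal {mat 1, - mat 1} SL2C"
proof -
  interpret group SL2C by (rule group_SL2C)
  have d: "det (- mat 1 :: complex^2^2) = 1" by (simp add: det_2 mat_def)
  have sub: "subgroup {mat 1, - mat 1} SL2C"
  proof (rule subgroupI)
    fix A assume A: "A \<in> {mat 1, - mat 1 :: complex^2^2}"
    have "A \<otimes>\<^bsub>SL2C\<^esub> A = \<one>\<^bsub>SL2C\<^esub>" "A \<in> carrier SL2C"
      using A d by (auto simp: SL2C_def minus_mat_one_mult)
    then have "inv\<^bsub>SL2C\<^esub> A = A" by (simp add: inv_equality)
    then show "inv\<^bsub>SL2C\<^esub> A \<in> {mat 1, - mat 1}" using A by simp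
  qed (use d in \<open>auto simp: SL2C_def minus_mat_one_mult\<close>)
  show ?thesis
    by (rule normalI[OF sub])
      (auto simp: r_coset_def l_coset_def SL2C_def minus_mat_one_mult)
qed

lemma group_PSL2C: "group PSL2C"
  unfolding PSL2C_def by (rule normal.factorgroup_is_group[OF normal_center_SL2C])


section \<open>Hyperbolic 3-space\<close>

text \<open>
  The upper half-space model with metric $(|dz|^2 + dt^2)/t^2$, of sectional curvature $-1$,
  its distance function and its Riemannian volume measure.
\<close>

definition H3 :: "(complex \<times> real) set" where
  "H3 = {(z, t). t > 0}"

definition hyp_dist :: "complex \<times> real \<Rightarrow> complex \<times> real \<Rightarrow> real" where
  "hyp_dist = (\<lambda>(z, t) (w, s). arcosh (1 + ((cmod (z - w))\<^sup>2 + (t - s)\<^sup>2) / (2 * t * s)))"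

definition hyp_volume :: "(complex \<times> real) measure" where
  "hyp_volume = density lborel (\<lambda>(z, t). if t > 0 then ennreal (1 / t ^ 3) else 0)"

definition geodesic_line :: "(real \<Rightarrow> complex \<times> real) \<Rightarrow> bool" where
  "geodesic_line c \<longleftrightarrow> (\<forall>t. c t \<in> H3) \<and> (\<forall>s t. hyp_dist (c s) (c t) = \<bar>s - t\<bar>)"

text \<open>The Poincare extension of a Moebius transformation to the upper half-space.\<close>

definition poincare_ext :: "complex^2^2 \<Rightarrow> complex \<times> real \<Rightarrow> complex \<times> real" where
  "poincare_ext A = (\<lambda>(z, t).
     let a = A $ 1 $ 1; b = A $ 1 $ 2; c = A $ 2 $ 1; d = A $ 2 $ 2;
         N = (cmod (c * z + d))\<^sup>2 + (cmod c)\<^sup>2 * t\<^sup>2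
     in (((a * z + b) * cnj (c * z + d) + a * cnj c * of_real (t\<^sup>2)) / of_real N, t / N))"

lemma poincare_ext_minus: "poincare_ext (- A) = poincare_ext A"
proof -
  have "cmod (- (c * z) - d) = cmod (c * z + d)" for c z d
    by (metis minus_add_distrib norm_minus_cancel uminus_add_conv_diff add.commute)
  then show ?thesis
    by (auto simp: poincare_ext_def Let_def fun_eq_iff algebra_simps)
qed

definition PSL2C_act :: "(complex^2^2) set \<Rightarrow> complex \<times> real \<Rightarrow> complex \<times> real" where
  "PSL2C_act g p = the_elem ((\<lambda>A. poincare_ext A p) ` g)"

lemma PSL2C_act_coset:
  "PSL2C_act ({mat 1, - mat 1} #>\<^bsub>SL2C\<^esub> A) p = poincare_ext A p"
  by (simp add: PSL2C_act_def r_coset_def SL2C_def minus_mat_one_mult poincare_ext_minus)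


section \<open>Closed oriented hyperbolic 3-manifolds\<close>

text \<open>
  A manifold $\Gamma\backslash\mathbb H^3$ is represented by the group $\Gamma$; its points are
  the $\Gamma$-orbits.
\<close>

definition orbit_proj :: "(complex^2^2) set set \<Rightarrow> complex \<times> real \<Rightarrow> (complex \<times> real) set" where
  "orbit_proj \<Gamma> p = orbit (PSL2C\<lparr>carrier := \<Gamma>\<rparr>) PSL2C_act p"

definition quotient_space :: "(complex^2^2) set set \<Rightarrow> (complex \<times> real) set topology" where
  "quotient_space \<Gamma> = quotient_topology (top_of_set H3) (orbit_proj \<Gamma>)"

definition closed_hyperbolic_3_manifold :: "(complex^2^2) set set \<Rightarrow> bool" where
  "closed_hyperbolic_3_manifold \<Gamma> \<longleftrightarrow>
     subgroup \<Gamma> PSL2C \<and>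
     subtopology PSL2C_topology \<Gamma> = discrete_topology \<Gamma> \<and>
     (\<forall>g\<in>\<Gamma>. \<forall>n::nat. n > 0 \<and> g [^]\<^bsub>PSL2C\<^esub> n = \<one>\<^bsub>PSL2C\<^esub> \<longrightarrow> g = \<one>\<^bsub>PSL2C\<^esub>) \<and>
     compact_space (quotient_space \<Gamma>)"

definition fundamental_set :: "(complex^2^2) set set \<Rightarrow> (complex \<times> real) set \<Rightarrow> bool" where
  "fundamental_set \<Gamma> F \<longleftrightarrow>
     F \<in> sets borel \<and> F \<subseteq> H3 \<and> bij_betw (orbit_proj \<Gamma>) F (topspace (quotient_space \<Gamma>))"

text \<open>
  For discrete torsion-free $\Gamma$ a Borel set containing exactly one point of every orbit
  exists, and since $\Gamma$ is countable and acts by isometries all such sets have the same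
  hyperbolic volume, namely the Riemannian volume of the quotient; so the choice is immaterial.
\<close>

definition manifold_volume :: "(complex^2^2) set set \<Rightarrow> real" where
  "manifold_volume \<Gamma> = measure hyp_volume (SOME F. fundamental_set \<Gamma> F)"

text \<open>
  The complete unit-speed geodesics of the quotient are the projections of the geodesic lines
  of $\mathbb H^3$; a closed geodesic is one that is periodic, with a period as its length.
  Multiple traversals are included, which does not affect the infimum.  For closed manifolds the
  infimum is attained.
\<close>

definition closed_geodesic_of_length ::
    "(complex^2^2) set set \<Rightarrow> (real \<Rightarrow> (complex \<times> real) set) \<Rightarrow> real \<Rightarrow> bool" where
  "closed_geodesic_of_length \<Gamma> \<sigma> l \<longleftrightarrow>
     (\<exists>c. geodesic_line c \<and> \<sigma> = orbit_proj \<Gamma> \<circ> c) \<and> l > 0 \<and> (\<forall>t. \<sigma> (t + l) = \<sigma> t)"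

definition systole :: "(complex^2^2) set set \<Rightarrow> real" where
  "systole \<Gamma> = Inf {l. \<exists>\<sigma>. closed_geodesic_of_length \<Gamma> \<sigma> l}"

end

theory Submission
  imports Defs "HOL-Real_Asymp.Real_Asymp"
begin

text \<open>
  Write $c$ for the hyperbolic cosine of the distance and $h = \max(0, C - c)$.  For a fixed $y$
  the numbers $c(y, p) c(y, q) - c(p, q)$ form a Gram matrix, so summing over an orbit
  $p = gx$, $q = g'x$ with a weight $\kappa > 0$ gives
  $\sum h(y, p) h(y, q) (1 + \kappa\, c(y, p) c(y, q)) \ge
  (\sum h(y, p))^2 + \sum h(y, p) h(y, q)\, \kappa\, c(p, q)$.
  Integrate over a fundamental set and sort the pairs $(g, g')$ by the conjugacy class of
  $g^{-1} g'$.  A nontrivial element is loxodromic with a multiplier of modulus at least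
  $e^{\mathrm{sys}}$, and for $C = \frac54 e^{\mathrm{sys}/2}$ and $\kappa = 17 / (2 C^2)$ a
  computation in coordinates along its axis shows that its class contributes at least as much to
  the right-hand side as to the left.  What remains is
  $V \int h^2 (1 + \kappa c^2) \ge (\int h)^2$, that is $40 \pi (C - 1)^6 \le 81 V C^4$, whence
  $\mathrm{sys} \le \log V - 0.885 + o(1)$.
\<close>

section \<open>Hyperbolic cosine of the distance\<close>

text \<open>An embedded ball of radius sys/2 already gives sys <= log V - log (pi/2) + o(1). A test
  function that improves on this reaches beyond sys/2, and then nontrivial elements contribute. The
  Gram term is what controls them: when y lies between p and q, the two gradients at y point in
  nearly opposite directions, so \<open>hcosh y p * hcosh y q - hcosh p q\<close> is negative and
  can outweigh the summand 1. This is true only on average. At a single ratio \<sigma> of heights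
  along the axis the comparison can fail, and it is recovered by pairing \<sigma> with E / \<sigma>,
  where E is the modulus of the multiplier. For C = l e^(sys/2) and kappa = k / C^2 the class
  comparison needs, to leading order, k >= 9 l^2 / (2 + l - l^2), while the resulting bound is e^sys
  <= 9 (5 + k) V / (60 pi l^2). The choice l = 5/4 is close to optimal and asks for k >= 25/3; the
  value 17/2 leaves a margin for lower-order terms. Since the sums live in \<open>ennreal\<close>,
  the right-hand one has to be finite before it can be cancelled.\<close>

definition hcosh :: "complex \<times> real \<Rightarrow> complex \<times> real \<Rightarrow> real" where
  "hcosh p q = 1 + ((cmod (fst p - fst q))\<^sup>2 + (snd p - snd q)\<^sup>2) / (2 * snd p * snd q)"

text \<open>The components of the gradient at y of \<open>hcosh _ x\<close> in the orthonormal frame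
  obtained by scaling the Euclidean frame by the height of y.\<close>

definition hgrad :: "complex \<times> real \<Rightarrow> complex \<times> real \<Rightarrow> complex \<times> real" where
  "hgrad y x = ((fst y - fst x) /\<^sub>R snd x, snd y / snd x - hcosh y x)"

lemma hyp_dist_eq: "hyp_dist p q = arcosh (hcosh p q)"
  by (simp add: hyp_dist_def hcosh_def case_prod_beta)

lemma H3_iff: "p \<in> H3 \<longleftrightarrow> snd p > 0"
  by (auto simp: H3_def case_prod_beta)

lemma hcosh_mult:
  assumes "p \<in> H3" "q \<in> H3"
  shows "2 * snd p * snd q * hcosh p q = (cmod (fst p - fst q))\<^sup>2 + (snd p)\<^sup>2 + (snd q)\<^sup>2"
  using assms by (simp add: hcosh_def H3_iff field_simps power2_eq_square)

lemma hcosh_eq: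
  assumes "p \<in> H3" "q \<in> H3"
  shows "hcosh p q = ((cmod (fst p - fst q))\<^sup>2 + (snd p)\<^sup>2 + (snd q)\<^sup>2) / (2 * snd p * snd q)"
  using hcosh_mult[OF assms] assms by (simp add: H3_iff field_simps)

lemma hcosh_commute: "hcosh p q = hcosh q p"
  by (simp add: hcosh_def norm_minus_commute power2_commute mult_ac)

lemma hcosh_self [simp]: "hcosh p p = 1"
  by (simp add: hcosh_def)

lemma hcosh_ge_1: "p \<in> H3 \<Longrightarrow> q \<in> H3 \<Longrightarrow> hcosh p q \<ge> 1"
  by (simp add: hcosh_def H3_iff)

lemma hcosh_eq_1_iff: "p \<in> H3 \<Longrightarrow> q \<in> H3 \<Longrightarrow> hcosh p q = 1 \<longleftrightarrow> p = q"
  by (auto simp: hcosh_def H3_iff add_nonneg_eq_0_iff prod_eq_iff)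

text \<open>The gradients of \<open>hcosh _ x\<close> are the projections of the points \<open>x\<close> of the
  hyperboloid to the tangent space at \<open>y\<close>, hence the Gram matrix.\<close>

lemma hcosh_gram:
  assumes y: "y \<in> H3" and x: "x \<in> H3" and x': "x' \<in> H3"
  shows "hcosh y x * hcosh y x' - hcosh x x' = hgrad y x \<bullet> hgrad y x'"
proof -
  let ?a = "fst y - fst x" and ?b = "fst y - fst x'"
  define s t t' c c' c'' where defs: "s = snd y" "t = snd x" "t' = snd x'"
    "c = hcosh y x" "c' = hcosh y x'" "c'' = hcosh x x'"
  have pos: "s > 0" "t > 0" "t' > 0" using assms by (auto simp: H3_iff defs)
  have 1: "2 * s * t * c = ?a \<bullet> ?a + s\<^sup>2 + t\<^sup>2"
    using hcosh_mult[OF y x] by (simp add: defs power2_norm_eq_inner)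
  have 2: "2 * s * t' * c' = ?b \<bullet> ?b + s\<^sup>2 + t'\<^sup>2"
    using hcosh_mult[OF y x'] by (simp add: defs power2_norm_eq_inner)
  have "fst x - fst x' = ?b - ?a" by simp
  then have 3: "2 * t * t' * c'' = ?a \<bullet> ?a + ?b \<bullet> ?b - 2 * (?a \<bullet> ?b) + t\<^sup>2 + t'\<^sup>2"
    using hcosh_mult[OF x x'] unfolding defs[symmetric] power2_norm_eq_inner
    by (simp only: inner_diff_left inner_diff_right) (simp add: inner_commute)
  have "t * t' * (hgrad y x \<bullet> hgrad y x') = ?a \<bullet> ?b + (s - t * c) * (s - t' * c')"
  proof -
    have "hgrad y x \<bullet> hgrad y x' = (?a \<bullet> ?b) / (t * t') + (s / t - c) * (s / t' - c')"
      by (simp only: hgrad_def inner_prod_def fst_conv snd_conv inner_scaleR_left inner_scaleR_right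
          defs inner_real_def inverse_eq_divide) simp
    then show ?thesis using pos by (simp only:) (simp add: field_simps)
  qed
  also have "\<dots> = ?a \<bullet> ?b + s\<^sup>2 + t * t' * (c * c') - (2 * s * t * c + 2 * s * t' * c') / 2"
    by (simp add: algebra_simps power2_eq_square)
  also have "\<dots> = t * t' * (c * c') - (2 * t * t' * c'') / 2"
    unfolding 1 2 3 by (simp only: add_divide_distrib diff_divide_distrib)
  also have "\<dots> = t * t' * (c * c' - c'')"
    by (simp add: algebra_simps)
  finally show ?thesis using pos by (simp add: defs)
qed

lemma hgrad_inner_self:
  assumes "y \<in> H3" "x \<in> H3"
  shows "hgrad y x \<bullet> hgrad y x = (hcosh y x)\<^sup>2 - 1"
  using hcosh_gram[OF assms(1,2,2)] by (simp add: power2_eq_square)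

text \<open>The Gram identity and Cauchy-Schwarz, each gradient having norm at most the
  corresponding \<open>hcosh\<close>. It replaces the triangle inequality in estimates that only
  involve cosines of distances.\<close>

lemma hcosh_le_mult:
  assumes "y \<in> H3" "x \<in> H3" "x' \<in> H3"
  shows "hcosh x x' \<le> 2 * hcosh x y * hcosh y x'"
proof -
  have ge: "hcosh y x \<ge> 1" "hcosh y x' \<ge> 1" using assms by (auto intro: hcosh_ge_1)
  have "norm (hgrad y x) \<le> hcosh y x" "norm (hgrad y x') \<le> hcosh y x'"
    using hgrad_inner_self assms ge
    by (auto simp: norm_eq_sqrt_inner intro!: real_le_lsqrt)
  then have "norm (hgrad y x) * norm (hgrad y x') \<le> hcosh y x * hcosh y x'"
    using ge by (intro mult_mono) auto
  moreover have "\<bar>hgrad y x \<bullet> hgrad y x'\<bar> \<le> norm (hgrad y x) * norm (hgrad y x')"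
    by (rule Cauchy_Schwarz_ineq2)
  ultimately show ?thesis using hcosh_gram[OF assms] by (simp add: hcosh_commute)
qed

section \<open>The action of $\mathrm{SL}_2(\mathbb C)$\<close>

text \<open>A point \<open>(z, t)\<close> corresponds to the Hermitian matrix with entries
  $(|z|^2 + t^2)/t$, $z/t$, $\bar z/t$, $1/t$, on which $A$ acts by $X \mapsto A X A^*$.\<close>

definition herm_d :: "complex \<times> real \<Rightarrow> complex" where
  "herm_d p = of_real (1 / snd p)"

definition herm_b :: "complex \<times> real \<Rightarrow> complex" where
  "herm_b p = fst p / of_real (snd p)"

definition herm_a :: "complex \<times> real \<Rightarrow> complex" where
  "herm_a p = (fst p * cnj (fst p) + of_real ((snd p)\<^sup>2)) / of_real (snd p)"

lemma herm_eqI: "herm_d p = herm_d q \<Longrightarrow> herm_b p = herm_b q \<Longrightarrow> p \<in> H3 \<Longrightarrow> q \<in> H3 \<Longrightarrow> p = q"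
  by (auto simp: herm_d_def herm_b_def H3_iff prod_eq_iff field_simps)

lemma cnj_herm [simp]: "cnj (herm_d p) = herm_d p" "cnj (herm_a p) = herm_a p"
  by (simp_all add: herm_d_def herm_a_def mult.commute)

text \<open>The right-hand side is the polarisation of the determinant of Hermitian matrices. Since
  X -> A X A* multiplies determinants by |det A|^2 = 1, this form makes the invariance of
  \<open>hcosh\<close> an algebraic identity.\<close>

lemma hcosh_herm:
  assumes "p \<in> H3" "q \<in> H3"
  shows "complex_of_real (2 * hcosh p q) =
    herm_a p * herm_d q + herm_d p * herm_a q - herm_b p * cnj (herm_b q) - cnj (herm_b p) * herm_b q"
proof -
  obtain z t w s where pq: "p = (z, t)" "q = (w, s)" by fastforce
  have pos: "t > 0" "s > 0" using assms by (auto simp: pq H3_iff)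
  have "complex_of_real (2 * hcosh p q) =
      ((z - w) * cnj (z - w) + of_real (t\<^sup>2) + of_real (s\<^sup>2)) / (of_real t * of_real s)"
    unfolding hcosh_eq[OF assms] complex_norm_square[symmetric] using pos
    by (simp add: pq complex_norm_square[symmetric] field_simps)
  also have "\<dots> = herm_a p * herm_d q + herm_d p * herm_a q - herm_b p * cnj (herm_b q) - cnj (herm_b p) * herm_b q"
    using pos by (simp add: pq herm_a_def herm_d_def herm_b_def field_simps power2_eq_square)
  finally show ?thesis .
qed

locale sl2 =
  fixes A :: "complex^2^2"
  assumes det: "det A = 1"
begin

abbreviation "a \<equiv> A $ 1 $ 1"
abbreviation "b \<equiv> A $ 1 $ 2"
abbreviation "c \<equiv> A $ 2 $ 1"
abbreviation "d \<equiv> A $ 2 $ 2"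

lemma det': "a * d - b * c = 1"
  using det by (simp add: det_2)

definition "den p = (cmod (c * fst p + d))\<^sup>2 + (cmod c)\<^sup>2 * (snd p)\<^sup>2"

lemma den_pos: "p \<in> H3 \<Longrightarrow> den p > 0"
proof (cases "c = 0")
  case True
  then have "d \<noteq> 0" using det' by auto
  then show ?thesis using True by (simp add: den_def)
next
  case False
  then show "p \<in> H3 \<Longrightarrow> ?thesis" by (simp add: den_def H3_iff add_nonneg_pos)
qed

lemma snd_poincare_ext: "snd (poincare_ext A p) = snd p / den p"
  by (simp add: poincare_ext_def Let_def case_prod_beta den_def)

lemma fst_poincare_ext: "fst (poincare_ext A p) =
   ((a * fst p + b) * cnj (c * fst p + d) + a * cnj c * of_real ((snd p)\<^sup>2)) / of_real (den p)"
  by (simp add: poincare_ext_def Let_def case_prod_beta den_def)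

lemma poincare_ext_H3: "p \<in> H3 \<Longrightarrow> poincare_ext A p \<in> H3"
  using den_pos by (simp add: H3_iff snd_poincare_ext)

lemma den_complex: "of_real (den p) = (c * fst p + d) * cnj (c * fst p + d) + c * cnj c * of_real ((snd p)\<^sup>2)"
  by (simp only: den_def of_real_add of_real_mult complex_norm_square)

lemma herm_d_act:
  assumes "p \<in> H3"
  shows "herm_d (poincare_ext A p) =
    c * cnj c * herm_a p + c * cnj d * herm_b p + d * cnj c * cnj (herm_b p) + d * cnj d * herm_d p"
proof -
  have "snd p > 0" using assms by (simp add: H3_iff)
  have "herm_d (poincare_ext A p) = of_real (den p) / of_real (snd p)"
    by (simp add: herm_d_def snd_poincare_ext)
  also have "\<dots> = c * cnj c * herm_a p + c * cnj d * herm_b p + d * cnj c * cnj (herm_b p) + d * cnj d * herm_d p"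
    using \<open>snd p > 0\<close> unfolding den_complex
    by (simp add: herm_a_def herm_b_def herm_d_def field_simps)
  finally show ?thesis .
qed

lemma herm_b_act:
  assumes "p \<in> H3"
  shows "herm_b (poincare_ext A p) =
    a * cnj c * herm_a p + a * cnj d * herm_b p + b * cnj c * cnj (herm_b p) + b * cnj d * herm_d p"
proof -
  have "snd p > 0" "den p > 0" using assms den_pos by (auto simp: H3_iff)
  then have "herm_b (poincare_ext A p) =
      ((a * fst p + b) * cnj (c * fst p + d) + a * cnj c * of_real ((snd p)\<^sup>2)) / of_real (snd p)"
    by (simp add: herm_b_def snd_poincare_ext fst_poincare_ext)
  also have "\<dots> = a * cnj c * herm_a p + a * cnj d * herm_b p + b * cnj c * cnj (herm_b p) + b * cnj d * herm_d p"
    using \<open>snd p > 0\<close> by (simp add: herm_a_def herm_b_def herm_d_def field_simps)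
  finally show ?thesis .
qed

lemma herm_det: "p \<in> H3 \<Longrightarrow> herm_a p * herm_d p - herm_b p * cnj (herm_b p) = 1"
  by (simp add: herm_a_def herm_b_def herm_d_def H3_iff field_simps power2_eq_square)

text \<open>Obtained without expanding the action: the image point and the matrix A X A* share their
  other entries, both have determinant 1, and the entry \<open>herm_d\<close> is nonzero, so the
  remaining entries agree.\<close>

lemma herm_a_act:
  assumes "p \<in> H3"
  shows "herm_a (poincare_ext A p) =
    a * cnj a * herm_a p + a * cnj b * herm_b p + b * cnj a * cnj (herm_b p) + b * cnj b * herm_d p"
    (is "_ = ?R")
proof -
  let ?d = "herm_d (poincare_ext A p)" and ?b = "herm_b (poincare_ext A p)"
  have "?d \<noteq> 0" using poincare_ext_H3[OF assms] by (simp add: herm_d_def H3_iff)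
  have d1: "a * d = 1 + b * c" using det' by (simp add: algebra_simps)
  have d2: "cnj a * cnj d = 1 + cnj b * cnj c" using arg_cong[OF d1, of cnj] by simp
  have "?R * ?d - ?b * cnj ?b =
    (a * d - b * c) * (cnj a * cnj d - cnj b * cnj c) * (herm_a p * herm_d p - herm_b p * cnj (herm_b p))"
    unfolding herm_d_act[OF assms] herm_b_act[OF assms]
    by (simp add: algebra_simps)
  also have "\<dots> = 1" using herm_det[OF assms] d1 d2 by simp
  finally have "?R * ?d - ?b * cnj ?b = 1" .
  moreover have "herm_a (poincare_ext A p) * ?d - ?b * cnj ?b = 1"
    by (rule herm_det[OF poincare_ext_H3[OF assms]])
  ultimately have "herm_a (poincare_ext A p) * ?d = ?R * ?d" by (simp add: algebra_simps)
  then show ?thesis using \<open>?d \<noteq> 0\<close> by simp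
qed

lemma hcosh_poincare_ext:
  assumes "p \<in> H3" "q \<in> H3"
  shows "hcosh (poincare_ext A p) (poincare_ext A q) = hcosh p q"
proof -
  have d1: "a * d = 1 + b * c" using det' by (simp add: algebra_simps)
  have d2: "cnj a * cnj d = 1 + cnj b * cnj c" using arg_cong[OF d1, of cnj] by simp
  have "complex_of_real (2 * hcosh (poincare_ext A p) (poincare_ext A q)) =
     (a * d - b * c) * (cnj a * cnj d - cnj b * cnj c) * complex_of_real (2 * hcosh p q)"
    unfolding hcosh_herm[OF assms] hcosh_herm[OF poincare_ext_H3[OF assms(1)] poincare_ext_H3[OF assms(2)]]
      herm_a_act[OF assms(1)] herm_b_act[OF assms(1)] herm_d_act[OF assms(1)]
      herm_a_act[OF assms(2)] herm_b_act[OF assms(2)] herm_d_act[OF assms(2)]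
    by (simp add: algebra_simps)
  also have "\<dots> = complex_of_real (2 * hcosh p q)" using d1 d2 by simp
  finally show ?thesis by (simp only: of_real_eq_iff)
qed

end

text \<open>By \<open>herm_eqI\<close> only two entries need comparison, and on these composition is
  that of the maps X -> A X A*.\<close>

lemma poincare_ext_mult:
  assumes A: "det A = 1" and B: "det B = 1" and p: "p \<in> H3"
  shows "poincare_ext (A ** B) p = poincare_ext A (poincare_ext B p)"
proof -
  interpret A: sl2 A by unfold_locales fact
  interpret B: sl2 B by unfold_locales fact
  interpret AB: sl2 "A ** B" by unfold_locales (simp add: det_mul A B)
  note Bp = B.poincare_ext_H3[OF p]
  have m: "(A ** B) $ i $ j = A $ i $ 1 * B $ 1 $ j + A $ i $ 2 * B $ 2 $ j" for i j
    by (simp add: matrix_matrix_mult_def sum_2)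
  show ?thesis
  proof (rule herm_eqI)
    show "herm_d (poincare_ext (A ** B) p) = herm_d (poincare_ext A (poincare_ext B p))"
      unfolding AB.herm_d_act[OF p] A.herm_d_act[OF Bp] B.herm_d_act[OF p] B.herm_b_act[OF p] B.herm_a_act[OF p] m
      by (simp add: algebra_simps)
    show "herm_b (poincare_ext (A ** B) p) = herm_b (poincare_ext A (poincare_ext B p))"
      unfolding AB.herm_b_act[OF p] A.herm_b_act[OF Bp] B.herm_d_act[OF p] B.herm_b_act[OF p] B.herm_a_act[OF p] m
      by (simp add: algebra_simps)
  qed (simp_all add: AB.poincare_ext_H3 A.poincare_ext_H3 Bp p)
qed

lemma poincare_ext_one: "poincare_ext (mat 1) p = p"
  by (simp add: poincare_ext_def Let_def case_prod_beta mat_def)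

lemma poincare_ext_measurable [measurable]: "poincare_ext A \<in> borel_measurable borel"
proof -
  have *: "continuous_on UNIV (\<lambda>p. (A$1$1 * fst p + A$1$2) * cnj (A$2$1 * fst p + A$2$2) + A$1$1 * cnj (A$2$1) * complex_of_real ((snd p)\<^sup>2))"
    "continuous_on UNIV (\<lambda>p. (cmod (A$2$1 * fst p + A$2$2))\<^sup>2 + (cmod (A$2$1))\<^sup>2 * (snd p)\<^sup>2)"
    "continuous_on UNIV (\<lambda>p::complex\<times>real. snd p)"
    by (intro continuous_intros)+
  note [measurable] = *[THEN borel_measurable_continuous_onI]
  have m: "(\<lambda>p. complex_of_real ((cmod (A$2$1 * fst p + A$2$2))\<^sup>2 + (cmod (A$2$1))\<^sup>2 * (snd p)\<^sup>2)) \<in> borel_measurable borel"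
    by (intro borel_measurable_continuous_onI continuous_intros)
  have "(\<lambda>p. (((A$1$1 * fst p + A$1$2) * cnj (A$2$1 * fst p + A$2$2) + A$1$1 * cnj (A$2$1) * complex_of_real ((snd p)\<^sup>2)) /
       complex_of_real ((cmod (A$2$1 * fst p + A$2$2))\<^sup>2 + (cmod (A$2$1))\<^sup>2 * (snd p)\<^sup>2),
       snd p / ((cmod (A$2$1 * fst p + A$2$2))\<^sup>2 + (cmod (A$2$1))\<^sup>2 * (snd p)\<^sup>2))) \<in> borel_measurable borel"
    by (intro borel_measurable_Pair borel_measurable_divide * [THEN borel_measurable_continuous_onI] m)
  then show ?thesis
    by (simp add: poincare_ext_def Let_def case_prod_beta)
qed

lemma hcosh_measurable [measurable]: "(\<lambda>(p, q). hcosh p q) \<in> borel_measurable (borel \<Otimes>\<^sub>M borel)"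
proof -
  have "(\<lambda>pq::(complex\<times>real)\<times>(complex\<times>real). 1 + ((cmod (fst (fst pq) - fst (snd pq)))\<^sup>2 + (snd (fst pq) - snd (snd pq))\<^sup>2) / (2 * snd (fst pq) * snd (snd pq)))
     \<in> borel_measurable borel"
    by (intro borel_measurable_add borel_measurable_const borel_measurable_divide borel_measurable_continuous_onI
        continuous_intros)
  then show ?thesis by (simp add: hcosh_def case_prod_beta borel_prod)
qed

lemma continuous_on_hcosh: "continuous_on (H3 \<times> H3) (\<lambda>(p, q). hcosh p q)"
  unfolding hcosh_def case_prod_beta
  by (intro continuous_intros) (auto simp: H3_iff)

section \<open>Invariance of the hyperbolic volume\<close>

definition hyp_density :: "complex \<times> real \<Rightarrow> ennreal" where
  "hyp_density q = (if snd q > 0 then ennreal (1 / snd q ^ 3) else 0)"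

lemma hyp_volume_eq: "hyp_volume = density lborel hyp_density"
  unfolding hyp_volume_def by (rule arg_cong[where f = "density lborel"]) (auto simp: hyp_density_def fun_eq_iff)

lemma open_H3: "open H3"
proof -
  have "H3 = snd -` {0<..}" by (auto simp: H3_iff)
  moreover have "open (snd -` {0::real<..} :: (complex \<times> real) set)" by (rule open_vimage_snd) simp
  ultimately show ?thesis by metis
qed

lemma H3_borel [measurable, simp]: "H3 \<in> sets borel"
  using open_H3 by simp

lemma hyp_density_measurable [measurable]: "hyp_density \<in> borel_measurable borel"
  unfolding hyp_density_def[abs_def]
proof (rule measurable_If)
  have "{x. snd x > 0} = H3" by (auto simp: H3_iff)
  then show "{x \<in> space borel. snd x > 0} \<in> sets (borel :: (complex \<times> real) measure)" by simp
  have "(\<lambda>x::complex\<times>real. 1 / snd x ^ 3) \<in> borel_measurable borel"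
    by (intro borel_measurable_divide borel_measurable_continuous_onI continuous_intros)
  then show "(\<lambda>x::complex\<times>real. ennreal (1 / snd x ^ 3)) \<in> borel_measurable borel" by simp
qed simp

lemma sets_hyp_volume [measurable_cong, simp]: "sets hyp_volume = sets borel"
  by (simp add: hyp_volume_eq)

lemma space_hyp_volume [simp]: "space hyp_volume = UNIV"
  by (simp add: hyp_volume_eq)

lemma nn_integral_hyp_volume:
  assumes [measurable]: "f \<in> borel_measurable borel"
  shows "(\<integral>\<^sup>+ x. f x \<partial>hyp_volume) = (\<integral>\<^sup>+ x. hyp_density x * f x \<partial>lborel)"
  unfolding hyp_volume_eq by (subst nn_integral_density) auto

lemma AE_hyp_volume_H3: "AE x in hyp_volume. x \<in> H3"
proof -
  have "AE x in lborel. 0 < hyp_density x \<longrightarrow> x \<in> H3"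
    by (rule AE_I2) (auto simp: hyp_density_def H3_iff)
  then show ?thesis unfolding hyp_volume_eq by (subst AE_density) auto
qed

interpretation hyp: sigma_finite_measure hyp_volume
  unfolding hyp_volume_eq
  by (subst sigma_finite_measure.sigma_finite_iff_density_finite[OF sigma_finite_lborel]) (auto simp: hyp_density_def)

interpretation hyp_pair: pair_sigma_finite hyp_volume hyp_volume ..

lemma emeasure_hyp_volume_Int_H3:
  assumes "S \<in> sets borel"
  shows "emeasure hyp_volume (S \<inter> H3) = emeasure hyp_volume S"
  by (rule emeasure_eq_AE) (use AE_hyp_volume_H3 assms in auto)

text \<open>The Jacobian k^3 cancels against the cube in the density. Such similarities are
  transitive on \<open>H3\<close>, which makes all balls of equal radius equal in volume before any
  other isometry is known to preserve it.\<close>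

lemma nn_integral_similarity:
  assumes k: "k > 0" and [measurable]: "f \<in> borel_measurable borel"
  shows "(\<integral>\<^sup>+ q. f (w + k *\<^sub>R fst q, k * snd q) \<partial>hyp_volume) = (\<integral>\<^sup>+ q. f q \<partial>hyp_volume)"
proof -
  define T where "T q = (w, 0) + k *\<^sub>R q" for q :: "complex \<times> real"
  have T: "T q = (w + k *\<^sub>R fst q, k * snd q)" for q
    by (simp add: T_def prod_eq_iff)
  have [measurable]: "T \<in> borel_measurable borel"
    unfolding T_def[abs_def] by measurable
  have dT: "ennreal (k ^ 3) * hyp_density (T q) = hyp_density q" for q
  proof (cases "snd q > 0")
    case True
    then have "ennreal (k ^ 3) * ennreal (1 / (k * snd q) ^ 3) = ennreal (1 / snd q ^ 3)"
      using k by (subst ennreal_mult[symmetric]) (auto simp: field_simps)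
    then show ?thesis using True k by (simp add: T hyp_density_def)
  next
    case False
    then show ?thesis using k by (simp add: T hyp_density_def zero_less_mult_iff)
  qed
  have "(\<integral>\<^sup>+ q. f q \<partial>hyp_volume) = (\<integral>\<^sup>+ q. hyp_density q * f q \<partial>density (distr lborel borel T) (\<lambda>_. \<bar>k\<bar> ^ DIM(complex \<times> real)))"
    unfolding T_def using k by (subst lborel_affine[symmetric]) (auto simp: nn_integral_hyp_volume)
  also have "\<dots> = (\<integral>\<^sup>+ q. ennreal (k ^ 3) * (hyp_density (T q) * f (T q)) \<partial>lborel)"
    using k by (subst nn_integral_density, simp, simp, subst nn_integral_distr) (auto simp: DIM_complex)
  also have "\<dots> = (\<integral>\<^sup>+ q. hyp_density q * f (T q) \<partial>lborel)"
    by (simp add: dT mult.assoc[symmetric])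
  also have "\<dots> = (\<integral>\<^sup>+ q. f (T q) \<partial>hyp_volume)"
    by (subst nn_integral_hyp_volume) auto
  finally show ?thesis by (simp add: T)
qed

section \<open>Hyperbolic balls: volume and topology\<close>

text \<open>The parameter r is the hyperbolic cosine of the radius.\<close>

definition hball :: "complex \<times> real \<Rightarrow> real \<Rightarrow> (complex \<times> real) set" where
  "hball p r = {q \<in> H3. hcosh p q < r}"

lemma hball_borel [measurable, simp]: "hball p r \<in> sets borel"
proof -
  have "hball p r = H3 \<inter> {q \<in> space borel. hcosh p q < r}" by (auto simp: hball_def)
  also have "\<dots> \<in> sets borel" by measurable
  finally show ?thesis .
qed

lemma open_hball:
  assumes "p \<in> H3" shows "open (hball p r)"
proof -
  have "continuous_on H3 (hcosh p)"
  proof -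
    have "continuous_on H3 (\<lambda>q. (\<lambda>(p, q). hcosh p q) (p, q))"
      by (rule continuous_on_compose2[OF continuous_on_hcosh]) (use assms in \<open>auto intro!: continuous_intros\<close>)
    then show ?thesis by simp
  qed
  then have "open ((hcosh p) -` {..<r} \<inter> H3)"
    using open_H3 by (simp add: continuous_on_open_vimage)
  moreover have "hball p r = (hcosh p) -` {..<r} \<inter> H3" by (auto simp: hball_def)
  ultimately show ?thesis by simp
qed

definition jpt :: "complex \<times> real" where "jpt = (0, 1)"

lemma jpt_H3 [simp]: "jpt \<in> H3" by (simp add: jpt_def H3_iff)

lemma emeasure_hball:
  assumes p: "p \<in> H3"
  shows "emeasure hyp_volume (hball p r) = emeasure hyp_volume (hball jpt r)"
proof -
  have t: "snd p > 0" using p by (simp add: H3_iff)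
  have "emeasure hyp_volume (hball p r) = (\<integral>\<^sup>+ q. indicator (hball p r) q \<partial>hyp_volume)"
    by simp
  also have "\<dots> = (\<integral>\<^sup>+ q. indicator (hball p r) (fst p + snd p *\<^sub>R fst q, snd p * snd q) \<partial>hyp_volume)"
    by (rule nn_integral_similarity[OF t, symmetric]) measurable
  also have "\<dots> = (\<integral>\<^sup>+ q. indicator (hball jpt r) q \<partial>hyp_volume)"
  proof (intro nn_integral_cong)
    fix q :: "complex \<times> real"
    have "hcosh p (fst p + snd p *\<^sub>R fst q, snd p * snd q) = hcosh jpt q"
    proof -
      have "snd p - snd p * snd q = snd p * (1 - snd q)" by (simp add: algebra_simps)
      then have "(cmod (fst p - (fst p + snd p *\<^sub>R fst q)))\<^sup>2 + (snd p - snd p * snd q)\<^sup>2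
          = (snd p)\<^sup>2 * ((cmod (0 - fst q))\<^sup>2 + (1 - snd q)\<^sup>2)"
        by (simp add: power_mult_distrib distrib_left)
      moreover have "2 * snd p * (snd p * snd q) = (snd p)\<^sup>2 * (2 * 1 * snd q)"
        by (simp add: power2_eq_square)
      ultimately show ?thesis using t
        by (simp only: hcosh_def jpt_def fst_conv snd_conv) simp
    qed
    then show "indicator (hball p r) (fst p + snd p *\<^sub>R fst q, snd p * snd q) = (indicator (hball jpt r) q :: ennreal)"
      using t by (auto simp: indicator_def hball_def H3_iff zero_less_mult_iff)
  qed
  finally show ?thesis by simp
qed

lemma emeasure_hball_finite: "emeasure hyp_volume (hball jpt r) < \<infinity>"
proof -
  \<comment> \<open>\<open>hcosh jpt q < r\<close> means |w|^2 + 1 + s^2 < 2 s r. This bounds |w|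
    and s by 2 r and keeps s above 1 / (2 r), so the density is bounded on the ball.\<close>
  have sub: "q \<in> cball 0 (6 * r)" "hyp_density q \<le> ennreal (8 * r ^ 3)" if q: "q \<in> hball jpt r" for q
  proof -
    obtain w s where ws: "q = (w, s)" by fastforce
    have s: "s > 0" and lt: "hcosh jpt q < r" using q by (auto simp: hball_def ws H3_iff)
    have "hcosh jpt q \<ge> 1" using q by (auto simp: hball_def intro: hcosh_ge_1)
    then have r: "r > 1" using lt by simp
    have "2 * s * hcosh jpt q = (cmod w)\<^sup>2 + 1 + s\<^sup>2"
      using hcosh_mult[of jpt q] s by (simp add: ws jpt_def H3_iff)
    moreover have "2 * s * hcosh jpt q < 2 * s * r" using s lt by simp
    ultimately have *: "(cmod w)\<^sup>2 + 1 + s\<^sup>2 < 2 * s * r" by simp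
    then have "cmod w * cmod w + 1 + s * s < s * (2 * r)" by (simp add: power2_eq_square mult_ac)
    then have "s * s < s * (2 * r)" "1 < s * (2 * r)" using zero_le_square[of s] zero_le_square[of "cmod w"]
      by linarith+
    then have s2: "s < 2 * r" and s1: "1 / s < 2 * r" using s by (auto simp: field_simps)
    have "(cmod w)\<^sup>2 < 2 * s * r" using * zero_le_power2[of s] by linarith
    also have "\<dots> \<le> (2 * r)\<^sup>2" using s2 r s by (simp add: power2_eq_square)
    finally have "cmod w < 2 * r" by (rule power_less_imp_less_base) (use r in simp)
    then have "norm q \<le> 6 * r" using norm_Pair_le[of w s] s2 s by (simp add: ws)
    then show "q \<in> cball 0 (6 * r)" by simp
    have "(1 / s) ^ 3 \<le> (2 * r) ^ 3" using s1 s by (intro power_mono) auto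
    then show "hyp_density q \<le> ennreal (8 * r ^ 3)"
      using s by (simp add: hyp_density_def ws power_divide ennreal_leI power_mult_distrib)
  qed
  have "emeasure hyp_volume (hball jpt r) = (\<integral>\<^sup>+ q. hyp_density q * indicator (hball jpt r) q \<partial>lborel)"
    unfolding hyp_volume_eq by (subst emeasure_density) auto
  also have "\<dots> \<le> (\<integral>\<^sup>+ q. ennreal (8 * r ^ 3) * indicator (cball (0::complex\<times>real) (6 * r)) q \<partial>lborel)"
    using sub by (intro nn_integral_mono) (auto simp: indicator_def)
  also have "\<dots> = ennreal (8 * r ^ 3) * emeasure lborel (cball (0::complex\<times>real) (6 * r))"
    by (subst nn_integral_cmult_indicator) auto
  also have "\<dots> < \<infinity>"
    using emeasure_lborel_cball_finite[of "0::complex\<times>real" "6 * r"] by (simp add: ennreal_mult_less_top)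
  finally show ?thesis .
qed

lemma emeasure_hball_pos:
  assumes r: "r > 1"
  shows "emeasure hyp_volume (hball jpt r) > 0"
proof (rule ccontr)
  assume "\<not> ?thesis"
  then have "hball jpt r \<in> null_sets hyp_volume" by (auto intro: null_setsI)
  then have "AE q in lborel. q \<in> hball jpt r \<longrightarrow> hyp_density q = 0"
    unfolding hyp_volume_eq by (subst (asm) null_sets_density_iff) auto
  then have "AE q in lborel. q \<notin> hball jpt r"
    by eventually_elim (auto simp: hball_def hyp_density_def H3_iff)
  then have "hball jpt r \<in> null_sets lborel"
    by (simp add: AE_iff_null_sets)
  then have "negligible (hball jpt r)"
    by (simp add: negligible_iff_null_sets null_sets_completionI)
  moreover have "jpt \<in> hball jpt r" using r by (simp add: hball_def)
  ultimately show False using open_not_negligible[OF open_hball[OF jpt_H3]] by blast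
qed

lemma hball_subset:
  assumes p: "p \<in> H3" and U: "open U" "p \<in> U"
  shows "\<exists>\<epsilon>>0. hball p (1 + \<epsilon>) \<subseteq> U"
proof -
  obtain e where e: "e > 0" "ball p e \<subseteq> U" using U by (meson open_contains_ball)
  obtain z t where zt: "p = (z, t)" by fastforce
  have t: "t > 0" using p by (simp add: zt H3_iff)
  \<comment> \<open>The bound 1 forces \<open>s < 4 * t\<close>; the other bound then makes the
    squared Euclidean distance, which is less than 2 \<epsilon> t s, smaller than e^2.\<close>
  define \<epsilon> where "\<epsilon> = min 1 (e\<^sup>2 / (8 * t\<^sup>2))"
  have "\<epsilon> > 0" using e t by (simp add: \<epsilon>_def)
  moreover have "hball p (1 + \<epsilon>) \<subseteq> ball p e"
  proof
    fix q assume q: "q \<in> hball p (1 + \<epsilon>)"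
    obtain w s where ws: "q = (w, s)" by fastforce
    have s: "s > 0" using q by (simp add: ws hball_def H3_iff)
    have "((cmod (z - w))\<^sup>2 + (t - s)\<^sup>2) / (2 * t * s) < \<epsilon>"
      using q by (simp add: hball_def hcosh_def zt ws)
    then have *: "(cmod (z - w))\<^sup>2 + (t - s)\<^sup>2 < \<epsilon> * (2 * t * s)"
      using t s by (simp add: divide_less_eq)
    also have "\<dots> \<le> 1 * (2 * t * s)" using t s by (intro mult_right_mono) (auto simp: \<epsilon>_def)
    finally have "(cmod (z - w))\<^sup>2 + (t - s)\<^sup>2 < 1 * (2 * t * s)" .
    moreover have "(t - s)\<^sup>2 = t * t - 2 * t * s + s * s" by (simp add: power2_eq_square algebra_simps)
    moreover have "s * (4 * t) = 4 * t * s" by simp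
    ultimately have "s * s < s * (4 * t)" using zero_le_power2[of "cmod (z - w)"] zero_le_square[of t] by linarith
    then have "s < 4 * t" using s by simp
    have "dist p q ^ 2 = (cmod (z - w))\<^sup>2 + (t - s)\<^sup>2"
      by (simp add: dist_prod_def zt ws dist_norm)
    also note *
    also have "\<epsilon> * (2 * t * s) \<le> e\<^sup>2 / (8 * t\<^sup>2) * (2 * t * (4 * t))"
      using t s \<open>s < 4 * t\<close> \<open>\<epsilon> > 0\<close> by (intro mult_mono) (auto simp: \<epsilon>_def)
    also have "\<dots> = e\<^sup>2" using t by (simp add: power2_eq_square)
    finally have "dist p q < e" by (rule power_less_imp_less_base) (use e in simp)
    then show "q \<in> ball p e" by simp
  qed
  ultimately show ?thesis using e by blast
qed

text \<open>Two Borel measures giving equal mass to all balls of equal radius agree on open sets, by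
  Fatou's lemma and Tonelli's theorem; here the second one is the image of the volume.\<close>

locale hyp_isometry =
  fixes g g' :: "complex \<times> real \<Rightarrow> complex \<times> real"
  assumes g_meas [measurable]: "g \<in> borel_measurable borel" and g'_meas [measurable]: "g' \<in> borel_measurable borel"
    and g_H3: "\<And>p. p \<in> H3 \<Longrightarrow> g p \<in> H3" and g'_H3: "\<And>p. p \<in> H3 \<Longrightarrow> g' p \<in> H3"
    and g_g': "\<And>p. p \<in> H3 \<Longrightarrow> g (g' p) = p" and g'_g: "\<And>p. p \<in> H3 \<Longrightarrow> g' (g p) = p"
    and g_iso: "\<And>p q. p \<in> H3 \<Longrightarrow> q \<in> H3 \<Longrightarrow> hcosh (g p) (g q) = hcosh p q"
begin

lemma hyp_isometry_inv: "hyp_isometry g' g"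
proof
  fix p q assume "p \<in> H3" "q \<in> H3"
  then show "hcosh (g' p) (g' q) = hcosh p q"
    using g_iso[of "g' p" "g' q"] by (simp add: g'_H3 g_g')
qed (simp_all add: g_H3 g'_H3 g_g' g'_g)

lemma emeasure_vimage_hball:
  assumes x: "x \<in> H3"
  shows "emeasure hyp_volume (g -` hball x r) = emeasure hyp_volume (hball jpt r)"
proof -
  have "emeasure hyp_volume (g -` hball x r) = emeasure hyp_volume (g -` hball x r \<inter> H3)"
    using measurable_sets_borel[OF g_meas hball_borel] by (intro emeasure_hyp_volume_Int_H3[symmetric]) simp
  also have "g -` hball x r \<inter> H3 = hball (g' x) r"
    using g_iso[of "g' x"] x by (auto simp: hball_def g_H3 g'_H3 g_g')
  finally show ?thesis using emeasure_hball[OF g'_H3[OF x]] by simp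
qed

lemma emeasure_open_le:
  assumes U: "open U" "U \<subseteq> H3"
  shows "emeasure hyp_volume U \<le> emeasure hyp_volume (g -` U)"
proof -
  define r where "r n = 1 + 1 / real (Suc n)" for n
  define v where "v n = emeasure hyp_volume (hball jpt (r n))" for n
  have v: "0 < v n" "v n < \<infinity>" for n
    using emeasure_hball_pos[of "r n"] emeasure_hball_finite[of "r n"] by (auto simp: v_def r_def)
  have [measurable]: "U \<in> sets borel" using U by simp
  have gU: "g -` U \<in> sets borel" using measurable_sets_borel[OF g_meas, of U] by simp
  \<comment> \<open>The kernel selects the pairs with x and g y in U and close to each other. Its
    y-integral at a fixed x in U is eventually the full ball volume \<open>v n\<close>, while its
    x-integral at a fixed y is at most \<open>v n\<close>. After division by \<open>v n\<close> the
    two orders of integration give the two sides of the claim.\<close>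
  define k where "k n x y = (indicator U x * indicator U (g y) * indicator {..<r n} (hcosh x (g y)) :: ennreal)" for n x y
  have [measurable]: "(\<lambda>(x, y). k n x y) \<in> borel_measurable (hyp_volume \<Otimes>\<^sub>M hyp_volume)" for n
    unfolding k_def by measurable
  define u where "u n x = (\<integral>\<^sup>+ y. k n x y \<partial>hyp_volume) / v n" for n x
  have [measurable]: "u n \<in> borel_measurable hyp_volume" for n
    unfolding u_def[abs_def] by measurable
  have lim: "indicator U x \<le> liminf (\<lambda>n. u n x)" for x
  proof (cases "x \<in> U")
    case True
    then have x: "x \<in> H3" using U by blast
    obtain \<epsilon> where \<epsilon>: "\<epsilon> > 0" "hball x (1 + \<epsilon>) \<subseteq> U" using hball_subset[OF x U(1) True] by blast
    have "(\<lambda>n. 1 / real (Suc n)) \<longlonglongrightarrow> 0" using LIMSEQ_inverse_real_of_nat by (simp add: inverse_eq_divide)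
    then have "eventually (\<lambda>n. 1 / real (Suc n) < \<epsilon>) sequentially" using \<epsilon>(1) by (rule order_tendstoD)
    then have "eventually (\<lambda>n. 1 \<le> u n x) sequentially"
    proof eventually_elim
      case (elim n)
      have "v n = (\<integral>\<^sup>+ y. indicator (g -` hball x (r n)) y \<partial>hyp_volume)"
        using emeasure_vimage_hball[OF x] measurable_sets_borel[OF g_meas hball_borel[of x "r n"]] by (simp add: v_def)
      also have "\<dots> \<le> (\<integral>\<^sup>+ y. k n x y \<partial>hyp_volume)"
      proof (intro nn_integral_mono)
        fix y
        have "hball x (r n) \<subseteq> U" using \<epsilon>(2) elim by (force simp: hball_def r_def)
        then show "indicator (g -` hball x (r n)) y \<le> k n x y"
          using True by (auto simp: k_def indicator_def hball_def)
      qed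
      finally show ?case using v[of n] unfolding u_def
        by (metis divide_right_mono_ennreal ennreal_divide_self infinity_ennreal_def less_irrefl)
    qed
    then have "1 \<le> liminf (\<lambda>n. u n x)" by (intro Liminf_bounded)
    then show ?thesis by (simp add: indicator_def)
  qed auto
  have int: "(\<integral>\<^sup>+ x. u n x \<partial>hyp_volume) \<le> emeasure hyp_volume (g -` U)" for n
  proof -
    have "(\<integral>\<^sup>+ x. \<integral>\<^sup>+ y. k n x y \<partial>hyp_volume \<partial>hyp_volume) = (\<integral>\<^sup>+ y. \<integral>\<^sup>+ x. k n x y \<partial>hyp_volume \<partial>hyp_volume)"
      by (rule hyp_pair.Fubini') measurable
    also have "\<dots> \<le> (\<integral>\<^sup>+ y. v n * indicator (g -` U) y \<partial>hyp_volume)"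
    proof (intro nn_integral_mono)
      fix y
      show "(\<integral>\<^sup>+ x. k n x y \<partial>hyp_volume) \<le> v n * indicator (g -` U) y"
      proof (cases "g y \<in> U")
        case True
        then have gy: "g y \<in> H3" using U by blast
        have "(\<integral>\<^sup>+ x. k n x y \<partial>hyp_volume) \<le> (\<integral>\<^sup>+ x. indicator (hball (g y) (r n)) x \<partial>hyp_volume)"
          using U(2) by (intro nn_integral_mono) (auto simp: k_def indicator_def hball_def hcosh_commute)
        also have "\<dots> = v n" using emeasure_hball[OF gy] by (simp add: v_def)
        finally show ?thesis using True by simp
      next
        case False
        then show ?thesis by (simp add: k_def)
      qed
    qed
    also have "\<dots> = v n * emeasure hyp_volume (g -` U)"
      using gU by (subst nn_integral_cmult_indicator) auto
    finally have "(\<integral>\<^sup>+ x. \<integral>\<^sup>+ y. k n x y \<partial>hyp_volume \<partial>hyp_volume) / v n \<le> v n * emeasure hyp_volume (g -` U) / v n"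
      by (rule divide_right_mono_ennreal)
    also have "\<dots> = emeasure hyp_volume (g -` U)"
      using v[of n] by (subst mult.commute) (simp add: mult_divide_eq_ennreal)
    finally show ?thesis unfolding u_def by (subst nn_integral_divide) measurable
  qed
  have "emeasure hyp_volume U = (\<integral>\<^sup>+ x. indicator U x \<partial>hyp_volume)" by simp
  also have "\<dots> \<le> (\<integral>\<^sup>+ x. liminf (\<lambda>n. u n x) \<partial>hyp_volume)"
    by (intro nn_integral_mono lim)
  also have "\<dots> \<le> liminf (\<lambda>n. \<integral>\<^sup>+ x. u n x \<partial>hyp_volume)"
    by (rule nn_integral_liminf) measurable
  also have "\<dots> \<le> emeasure hyp_volume (g -` U)"
    using int by (intro Liminf_le) (auto intro: always_eventually)
  finally show ?thesis .
qed

lemma open_vimage_Int: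
  assumes U: "open U" "U \<subseteq> H3"
  shows "open (g -` U \<inter> H3)"
proof (subst open_subopen, intro ballI)
  fix p assume p: "p \<in> g -` U \<inter> H3"
  then obtain \<epsilon> where \<epsilon>: "\<epsilon> > 0" "hball (g p) (1 + \<epsilon>) \<subseteq> U"
    using hball_subset[of "g p" U] U by (auto simp: g_H3)
  have "hball p (1 + \<epsilon>) \<subseteq> g -` U \<inter> H3"
  proof
    fix q assume q: "q \<in> hball p (1 + \<epsilon>)"
    then have "g q \<in> hball (g p) (1 + \<epsilon>)" using p g_iso[of p q] by (simp add: hball_def g_H3)
    then show "q \<in> g -` U \<inter> H3" using \<epsilon>(2) q by (auto simp: hball_def)
  qed
  moreover have "p \<in> hball p (1 + \<epsilon>)" using p \<epsilon> by (simp add: hball_def)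
  ultimately show "\<exists>T. open T \<and> p \<in> T \<and> T \<subseteq> g -` U \<inter> H3"
    using open_hball p by blast
qed

lemma emeasure_vimage_open:
  assumes U: "open U" "U \<subseteq> H3"
  shows "emeasure hyp_volume (g -` U) = emeasure hyp_volume U"
proof (rule antisym)
  interpret inv: hyp_isometry g' g by (rule hyp_isometry_inv)
  let ?W = "g -` U \<inter> H3"
  have "emeasure hyp_volume (g -` U) = emeasure hyp_volume ?W"
    using measurable_sets_borel[OF g_meas, of U] U by (simp add: emeasure_hyp_volume_Int_H3)
  also have "\<dots> \<le> emeasure hyp_volume (g' -` ?W)"
    using open_vimage_Int[OF U] by (rule inv.emeasure_open_le) simp
  also have "\<dots> = emeasure hyp_volume (g' -` ?W \<inter> H3)"
    using measurable_sets_borel[OF g'_meas, of ?W] open_vimage_Int[OF U] by (simp add: emeasure_hyp_volume_Int_H3)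
  also have "g' -` ?W \<inter> H3 = U"
  proof -
    have "q \<in> U \<longleftrightarrow> q \<in> H3 \<and> g' q \<in> H3 \<and> g (g' q) \<in> U" for q
      using U(2) g_g'[of q] g'_H3[of q] by (metis subsetD)
    then show ?thesis by blast
  qed
  finally show "emeasure hyp_volume (g -` U) \<le> emeasure hyp_volume U" .
qed (rule emeasure_open_le[OF U])

lemma distr_hyp_volume: "distr hyp_volume borel g = hyp_volume"
proof (rule measure_eqI_generator_eq[symmetric])
  \<comment> \<open>The complement of \<open>H3\<close> is null, but nothing is known of
    \<open>g\<close> there. Hence the generator consists of the Borel sets whose trace on
    \<open>H3\<close> is open, and the exhausting sets contain the whole complement.\<close>
  let ?E = "{S \<in> sets borel. open (S \<inter> H3)}"
  let ?A = "\<lambda>n::nat. hball jpt (real n) \<union> - H3"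
  show "Int_stable ?E"
  proof (rule Int_stableI)
    fix S T assume "S \<in> ?E" "T \<in> ?E"
    moreover have "(S \<inter> T) \<inter> H3 = (S \<inter> H3) \<inter> (T \<inter> H3)" by blast
    ultimately show "S \<inter> T \<in> ?E" by (auto intro: open_Int)
  qed
  show "?E \<subseteq> Pow UNIV" by simp
  have eq: "sets borel = sigma_sets UNIV ?E"
  proof
    have "sigma_sets UNIV {S :: (complex \<times> real) set. open S} \<subseteq> sigma_sets UNIV ?E"
      by (rule sigma_sets_subseteq) (auto simp: open_Int open_H3)
    then show "sets borel \<subseteq> sigma_sets UNIV ?E" by (simp add: sets_borel)
    show "sigma_sets UNIV ?E \<subseteq> sets borel"
      using sets.sigma_sets_subset[of ?E borel] by auto
  qed
  show "sets hyp_volume = sigma_sets UNIV ?E" "sets (distr hyp_volume borel g) = sigma_sets UNIV ?E"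
    using eq by simp_all
  show "emeasure hyp_volume X = emeasure (distr hyp_volume borel g) X" if "X \<in> ?E" for X
  proof -
    have X: "X \<in> sets borel" "open (X \<inter> H3)" using that by auto
    have gX: "g -` S \<in> sets borel" if "S \<in> sets borel" for S
      using measurable_sets_borel[OF g_meas that] by simp
    have "emeasure hyp_volume X = emeasure hyp_volume (g -` (X \<inter> H3))"
      using emeasure_vimage_open[OF X(2)] X by (simp add: emeasure_hyp_volume_Int_H3)
    also have "\<dots> = emeasure hyp_volume (g -` (X \<inter> H3) \<inter> H3)"
      using X by (intro emeasure_hyp_volume_Int_H3[symmetric] gX) simp
    also have "g -` (X \<inter> H3) \<inter> H3 = g -` X \<inter> H3" using g_H3 by blast
    also have "emeasure hyp_volume \<dots> = emeasure hyp_volume (g -` X)"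
      using X by (intro emeasure_hyp_volume_Int_H3 gX)
    finally show ?thesis using X by (subst emeasure_distr) auto
  qed
  show "range ?A \<subseteq> ?E"
  proof -
    have "(hball jpt (real n) \<union> - H3) \<inter> H3 = hball jpt (real n)" for n by (auto simp: hball_def)
    moreover have "hball jpt (real n) \<union> - H3 \<in> sets borel" for n
      using sets.compl_sets[OF H3_borel] by (intro sets.Un) (auto simp: Compl_eq_Diff_UNIV)
    ultimately show ?thesis using open_hball[OF jpt_H3] by auto
  qed
  show "(\<Union>n. ?A n) = UNIV"
  proof -
    have "\<exists>n. p \<in> hball jpt (real n)" if "p \<in> H3" for p
      using that reals_Archimedean2[of "hcosh jpt p"] by (auto simp: hball_def)
    then show ?thesis by blast
  qed
  show "emeasure hyp_volume (?A n) \<noteq> \<infinity>" for n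
  proof -
    have m: "- H3 \<in> sets borel" using sets.compl_sets[OF H3_borel] by (simp add: Compl_eq_Diff_UNIV)
    have "(hball jpt (real n) \<union> - H3) \<inter> H3 = hball jpt (real n)" by (auto simp: hball_def)
    then have "emeasure hyp_volume (?A n) = emeasure hyp_volume (hball jpt (real n))"
      using emeasure_hyp_volume_Int_H3[of "?A n"] m by simp
    then show ?thesis using emeasure_hball_finite[of "real n"] by simp
  qed
qed

lemma nn_integral_isometry:
  assumes "f \<in> borel_measurable borel"
  shows "(\<integral>\<^sup>+ x. f (g x) \<partial>hyp_volume) = (\<integral>\<^sup>+ x. f x \<partial>hyp_volume)"
  using assms by (subst (2) distr_hyp_volume[symmetric]) (simp add: nn_integral_distr)

end

lemma hyp_isometry_poincare_ext:
  assumes "det A = 1" "det B = 1" "A ** B = mat 1" "B ** A = mat 1"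
  shows "hyp_isometry (poincare_ext A) (poincare_ext B)"
proof -
  interpret A: sl2 A by unfold_locales fact
  interpret B: sl2 B by unfold_locales fact
  show ?thesis
    by unfold_locales
      (use assms in \<open>simp_all add: A.poincare_ext_H3 B.poincare_ext_H3 A.hcosh_poincare_ext
        poincare_ext_mult[symmetric] poincare_ext_one\<close>)
qed

lemma sl2_inverse:
  fixes A :: "complex^2^2"
  assumes "det A = 1"
  obtains B where "det B = 1" "A ** B = mat 1" "B ** A = mat 1"
proof -
  have "invertible A" using assms by (simp add: invertible_det_nz)
  then obtain B where B: "A ** B = mat 1" "B ** A = mat 1" unfolding invertible_def by blast
  moreover have "det B = 1" using assms det_mul[of B A] B by simp
  ultimately show ?thesis using that by blast
qed

lemma nn_integral_poincare_ext:
  assumes "det A = 1" "f \<in> borel_measurable borel"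
  shows "(\<integral>\<^sup>+ x. f (poincare_ext A x) \<partial>hyp_volume) = (\<integral>\<^sup>+ x. f x \<partial>hyp_volume)"
  using sl2_inverse[OF assms(1)] hyp_isometry.nn_integral_isometry[OF hyp_isometry_poincare_ext assms(2)] assms(1)
  by metis

section \<open>Summation over a lattice\<close>

lemma borel_measurable_nn_integral_count_space:
  assumes A: "countable A" and f: "\<And>a. a \<in> A \<Longrightarrow> (\<lambda>x. f a x) \<in> borel_measurable M"
  shows "(\<lambda>x. \<integral>\<^sup>+ a. f a x \<partial>count_space A) \<in> borel_measurable M"
proof -
  interpret sigma_finite_measure "count_space A"
    using A by (rule sigma_finite_measure_count_space_countable)
  have "(\<lambda>(a, x). f a x) \<in> borel_measurable (count_space A \<Otimes>\<^sub>M M)"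
    using f by (intro measurable_pair_measure_countable1[OF A]) simp
  then have "(\<lambda>(x, a). f a x) \<in> borel_measurable (M \<Otimes>\<^sub>M count_space A)"
    by (subst (asm) measurable_pair_swap_iff) simp
  from borel_measurable_nn_integral_fst[OF this] show ?thesis by simp
qed

text \<open>Kept abstract so that unfolding and counting use the group law and isometry only, not
  matrices. Discreteness and cocompactness are expressed through distances, absence of torsion as
  freeness.\<close>

locale hyp_lattice = group G for G :: "('g, 'm) monoid_scheme" (structure) +
  fixes act :: "'g \<Rightarrow> complex \<times> real \<Rightarrow> complex \<times> real"
  assumes act_mult: "\<And>g h x. g \<in> carrier G \<Longrightarrow> h \<in> carrier G \<Longrightarrow> x \<in> H3 \<Longrightarrow> act (g \<otimes> h) x = act g (act h x)"
    and act_one: "\<And>x. x \<in> H3 \<Longrightarrow> act \<one> x = x"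
    and act_H3: "\<And>g x. g \<in> carrier G \<Longrightarrow> x \<in> H3 \<Longrightarrow> act g x \<in> H3"
    and act_meas: "\<And>g. g \<in> carrier G \<Longrightarrow> act g \<in> borel_measurable borel"
    and act_hcosh: "\<And>g x y. g \<in> carrier G \<Longrightarrow> x \<in> H3 \<Longrightarrow> y \<in> H3 \<Longrightarrow> hcosh (act g x) (act g y) = hcosh x y"
    and act_volume: "\<And>g f. g \<in> carrier G \<Longrightarrow> f \<in> borel_measurable borel \<Longrightarrow>
      (\<integral>\<^sup>+ x. f (act g x) \<partial>hyp_volume) = (\<integral>\<^sup>+ x. f x \<partial>hyp_volume)"
    and locally_finite: "\<And>p q r. p \<in> H3 \<Longrightarrow> q \<in> H3 \<Longrightarrow> finite {g \<in> carrier G. hcosh p (act g q) \<le> r}"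
    and free: "\<And>g p. g \<in> carrier G \<Longrightarrow> p \<in> H3 \<Longrightarrow> act g p = p \<Longrightarrow> g = \<one>"
    and cocompact: "\<exists>r. \<forall>p\<in>H3. \<exists>g\<in>carrier G. hcosh jpt (act g p) \<le> r"
begin

lemma act_inv: "g \<in> carrier G \<Longrightarrow> x \<in> H3 \<Longrightarrow> act (inv g) (act g x) = x"
  using act_mult[of "inv g" g x] by (simp add: act_one)

lemma act_inv': "g \<in> carrier G \<Longrightarrow> x \<in> H3 \<Longrightarrow> act g (act (inv g) x) = x"
  using act_mult[of g "inv g" x] by (simp add: act_one)

lemma act_hcosh_left: "g \<in> carrier G \<Longrightarrow> x \<in> H3 \<Longrightarrow> y \<in> H3 \<Longrightarrow> hcosh (act g x) y = hcosh x (act (inv g) y)"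
  using act_hcosh[of g x "act (inv g) y"] by (simp add: act_inv' act_H3)

lemma countable_carrier: "countable (carrier G)"
proof -
  have "carrier G = (\<Union>n::nat. {g \<in> carrier G. hcosh jpt (act g jpt) \<le> real n})"
    using real_arch_simple by auto
  then show ?thesis
    using countable_UN[of UNIV "\<lambda>n::nat. {g \<in> carrier G. hcosh jpt (act g jpt) \<le> real n}"]
      locally_finite[OF jpt_H3 jpt_H3] by (simp add: countable_finite)
qed

lemma sum_translate_left:
  assumes "h \<in> carrier G"
  shows "(\<integral>\<^sup>+ g. f (h \<otimes> g) \<partial>count_space (carrier G)) = (\<integral>\<^sup>+ g. f g \<partial>count_space (carrier G))"
proof (rule nn_integral_bij_count_space)
  show "bij_betw (\<lambda>g. h \<otimes> g) (carrier G) (carrier G)"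
    using assms by (intro bij_betw_byWitness[where f' = "\<lambda>g. inv h \<otimes> g"]) (auto simp: m_assoc[symmetric])
qed

lemma sum_translate_right:
  assumes "h \<in> carrier G"
  shows "(\<integral>\<^sup>+ g. f (g \<otimes> h) \<partial>count_space (carrier G)) = (\<integral>\<^sup>+ g. f g \<partial>count_space (carrier G))"
proof (rule nn_integral_bij_count_space)
  show "bij_betw (\<lambda>g. g \<otimes> h) (carrier G) (carrier G)"
    using assms by (intro bij_betw_byWitness[where f' = "\<lambda>g. g \<otimes> inv h"]) (auto simp: m_assoc)
qed

lemma sum_inverse:
  "(\<integral>\<^sup>+ g. f (inv g) \<partial>count_space (carrier G)) = (\<integral>\<^sup>+ g. f g \<partial>count_space (carrier G))"
proof (rule nn_integral_bij_count_space)
  show "bij_betw (\<lambda>g. inv g) (carrier G) (carrier G)"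
    by (intro bij_betw_byWitness[where f' = "\<lambda>g. inv g"]) auto
qed

lemma sum_integral_swap:
  assumes "\<And>g. g \<in> carrier G \<Longrightarrow> f g \<in> borel_measurable M"
  shows "(\<integral>\<^sup>+ x. \<integral>\<^sup>+ g. f g x \<partial>count_space (carrier G) \<partial>M) = (\<integral>\<^sup>+ g. \<integral>\<^sup>+ x. f g x \<partial>M \<partial>count_space (carrier G))"
  using countable_carrier assms by (rule nn_integral_count_space_nn_integral)

lemma measurable_sum:
  assumes "\<And>g. g \<in> carrier G \<Longrightarrow> (\<lambda>x. f g x) \<in> borel_measurable M"
  shows "(\<lambda>x. \<integral>\<^sup>+ g. f g x \<partial>count_space (carrier G)) \<in> borel_measurable M"
  using countable_carrier assms by (rule borel_measurable_nn_integral_count_space)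

section \<open>Fundamental sets, unfolding and conjugacy classes\<close>

definition is_fund :: "(complex \<times> real) set \<Rightarrow> bool" where
  "is_fund F \<longleftrightarrow> F \<in> sets borel \<and> F \<subseteq> H3 \<and> (\<forall>x\<in>H3. \<exists>!g. g \<in> carrier G \<and> act g x \<in> F)"

text \<open>Almost every point is carried into F by exactly one group element, and invariance of the
  volume moves each translate of F back to F.\<close>

lemma tiling:
  assumes F: "is_fund F" and f: "f \<in> borel_measurable borel"
  shows "(\<integral>\<^sup>+ x. f x \<partial>hyp_volume) =
    (\<integral>\<^sup>+ g. (\<integral>\<^sup>+ x. f (act g x) * indicator F x \<partial>hyp_volume) \<partial>count_space (carrier G))"
proof -
  note f[measurable]
  have [measurable]: "F \<in> sets borel" using F by (simp add: is_fund_def)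
  have "(\<integral>\<^sup>+ x. f (act g x) * indicator F x \<partial>hyp_volume) = (\<integral>\<^sup>+ x. f x * indicator F (act (inv g) x) \<partial>hyp_volume)"
    if g: "g \<in> carrier G" for g
  proof -
    note [measurable] = act_meas[of "inv g"]
    have "(\<integral>\<^sup>+ x. f x * indicator F (act (inv g) x) \<partial>hyp_volume) =
        (\<integral>\<^sup>+ x. f (act g x) * indicator F (act (inv g) (act g x)) \<partial>hyp_volume)"
      using g by (intro act_volume[symmetric]) measurable
    also have "\<dots> = (\<integral>\<^sup>+ x. f (act g x) * indicator F x \<partial>hyp_volume)"
      by (rule nn_integral_cong_AE, use AE_hyp_volume_H3 in eventually_elim) (simp add: act_inv g)
    finally show ?thesis ..
  qed
  then have "(\<integral>\<^sup>+ g. (\<integral>\<^sup>+ x. f (act g x) * indicator F x \<partial>hyp_volume) \<partial>count_space (carrier G)) =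
      (\<integral>\<^sup>+ g. (\<integral>\<^sup>+ x. f x * indicator F (act (inv g) x) \<partial>hyp_volume) \<partial>count_space (carrier G))"
    by (rule nn_integral_cong) simp
  also have "\<dots> = (\<integral>\<^sup>+ x. (\<integral>\<^sup>+ g. f x * indicator F (act (inv g) x) \<partial>count_space (carrier G)) \<partial>hyp_volume)"
  proof (rule sum_integral_swap[symmetric])
    fix g assume "g \<in> carrier G"
    then have [measurable]: "act (inv g) \<in> borel_measurable borel" by (simp add: act_meas)
    show "(\<lambda>x. f x * indicator F (act (inv g) x)) \<in> borel_measurable hyp_volume" by measurable
  qed
  also have "\<dots> = (\<integral>\<^sup>+ x. f x \<partial>hyp_volume)"
  proof (rule nn_integral_cong_AE)
    show "AE x in hyp_volume. (\<integral>\<^sup>+ g. f x * indicator F (act (inv g) x) \<partial>count_space (carrier G)) = f x"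
      using AE_hyp_volume_H3
    proof eventually_elim
      case (elim x)
      then have "\<exists>!g. g \<in> carrier G \<and> act g x \<in> F" using F by (simp add: is_fund_def)
      then obtain g0 where g0: "g0 \<in> carrier G" "act g0 x \<in> F" "\<And>g. g \<in> carrier G \<Longrightarrow> act g x \<in> F \<Longrightarrow> g = g0"
        by metis
      have "(\<integral>\<^sup>+ g. f x * indicator F (act (inv g) x) \<partial>count_space (carrier G)) =
          (\<integral>\<^sup>+ g. f x * indicator F (act g x) \<partial>count_space (carrier G))"
        by (rule sum_inverse)
      also have "\<dots> = (\<Sum>g\<in>{g0}. f x * indicator F (act g x))"
      proof (rule nn_integral_count_space')
        fix g assume "g \<in> carrier G" "g \<notin> {g0}"
        then have "act g x \<notin> F" using g0(3) by blast
        then show "f x * indicator F (act g x) = 0" by simp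
      qed (use g0(1) in simp_all)
      finally show ?case using g0(2) by simp
    qed
  qed
  finally show ?thesis ..
qed

text \<open>Invariance under the diagonal action. The middle clause is the joint measurability that
  lets pairs of points of one orbit be integrated by Tonelli's theorem.\<close>

definition inv_kernel :: "(complex \<times> real \<Rightarrow> complex \<times> real \<Rightarrow> complex \<times> real \<Rightarrow> ennreal) \<Rightarrow> bool" where
  "inv_kernel K \<longleftrightarrow> (\<forall>p q. (\<lambda>y. K y p q) \<in> borel_measurable borel) \<and>
     (\<forall>d\<in>carrier G. (\<lambda>(x, y). K y x (act d x)) \<in> borel_measurable (borel \<Otimes>\<^sub>M borel)) \<and>
     (\<forall>g\<in>carrier G. \<forall>y\<in>H3. \<forall>p\<in>H3. \<forall>q\<in>H3. K (act g y) (act g p) (act g q) = K y p q)"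

text \<open>What the pairs g, g' with g^-1 g' = d contribute to the double orbit sum once y has been
  unfolded from F to the whole space.\<close>

definition orb :: "(complex \<times> real \<Rightarrow> complex \<times> real \<Rightarrow> complex \<times> real \<Rightarrow> ennreal) \<Rightarrow> 'g \<Rightarrow> complex \<times> real \<Rightarrow> ennreal" where
  "orb K d x = (\<integral>\<^sup>+ y. K y x (act d x) \<partial>hyp_volume)"

definition orb_int :: "(complex \<times> real \<Rightarrow> complex \<times> real \<Rightarrow> complex \<times> real \<Rightarrow> ennreal) \<Rightarrow> (complex \<times> real) set \<Rightarrow> 'g \<Rightarrow> ennreal" where
  "orb_int K F d = (\<integral>\<^sup>+ x. orb K d x * indicator F x \<partial>hyp_volume)"

lemma orb_measurable:
  assumes "inv_kernel K" "d \<in> carrier G"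
  shows "orb K d \<in> borel_measurable borel"
proof -
  have "(\<lambda>(x, y). K y x (act d x)) \<in> borel_measurable (borel \<Otimes>\<^sub>M hyp_volume)"
    using assms by (simp add: inv_kernel_def cong: measurable_cong_sets)
  from hyp.borel_measurable_nn_integral_fst[OF this] show ?thesis
    by (simp add: orb_def[abs_def])
qed

text \<open>With d = g^-1 g' invariance turns the kernel at (y, g x, g' x) into the one at (g^-1 y,
  x, d x); the sum over g then unfolds the integral over F.\<close>

lemma sum_orb:
  assumes F: "is_fund F" and K: "inv_kernel K" and xH: "x \<in> H3"
  shows "(\<integral>\<^sup>+ y. (\<integral>\<^sup>+ g. \<integral>\<^sup>+ g'. K y (act g x) (act g' x) \<partial>count_space (carrier G) \<partial>count_space (carrier G))
      * indicator F y \<partial>hyp_volume) = (\<integral>\<^sup>+ d. orb K d x \<partial>count_space (carrier G))"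
proof -
  have [measurable]: "F \<in> sets borel" and FH: "F \<subseteq> H3" using F by (auto simp: is_fund_def)
  have Ky [measurable]: "(\<lambda>y. K y p q) \<in> borel_measurable borel" for p q using K unfolding inv_kernel_def by blast
  have Kinv: "K (act g y) (act g p) (act g q) = K y p q" if "g \<in> carrier G" "y \<in> H3" "p \<in> H3" "q \<in> H3" for g y p q
    using K that by (simp add: inv_kernel_def)
  let ?N = "count_space (carrier G)"
  have sums: "(\<integral>\<^sup>+ g. \<integral>\<^sup>+ g'. K y (act g x) (act g' x) \<partial>?N \<partial>?N) = (\<integral>\<^sup>+ d. \<integral>\<^sup>+ g. K (act g y) x (act d x) \<partial>?N \<partial>?N)"
    if y: "y \<in> H3" for y
  proof -
    have "(\<integral>\<^sup>+ g. \<integral>\<^sup>+ g'. K y (act g x) (act g' x) \<partial>?N \<partial>?N) = (\<integral>\<^sup>+ g. \<integral>\<^sup>+ d. K y (act g x) (act (g \<otimes> d) x) \<partial>?N \<partial>?N)"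
      by (rule nn_integral_cong, rule sum_translate_left[symmetric]) simp
    also have "\<dots> = (\<integral>\<^sup>+ g. \<integral>\<^sup>+ d. K (act (inv g) y) x (act d x) \<partial>?N \<partial>?N)"
    proof (intro nn_integral_cong)
      fix g d assume "g \<in> space ?N" "d \<in> space ?N"
      then have gd: "g \<in> carrier G" "d \<in> carrier G" by auto
      then show "K y (act g x) (act (g \<otimes> d) x) = K (act (inv g) y) x (act d x)"
        using Kinv[of g "act (inv g) y" x "act d x"] y xH by (simp add: act_inv' act_H3 act_mult)
    qed
    also have "\<dots> = (\<integral>\<^sup>+ g. \<integral>\<^sup>+ d. K (act g y) x (act d x) \<partial>?N \<partial>?N)"
      by (rule sum_inverse)
    also have "\<dots> = (\<integral>\<^sup>+ d. \<integral>\<^sup>+ g. K (act g y) x (act d x) \<partial>?N \<partial>?N)"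
      by (rule sum_integral_swap) simp
    finally show ?thesis .
  qed
  have m: "(\<lambda>y. K (act g y) x (act d x) * indicator F y) \<in> borel_measurable hyp_volume" if "g \<in> carrier G" for g d
  proof -
    note [measurable] = act_meas[OF that]
    show ?thesis by measurable
  qed
  have "(\<integral>\<^sup>+ y. (\<integral>\<^sup>+ g. \<integral>\<^sup>+ g'. K y (act g x) (act g' x) \<partial>?N \<partial>?N) * indicator F y \<partial>hyp_volume)
    = (\<integral>\<^sup>+ y. (\<integral>\<^sup>+ d. \<integral>\<^sup>+ g. K (act g y) x (act d x) * indicator F y \<partial>?N \<partial>?N) \<partial>hyp_volume)"
  proof (rule nn_integral_cong)
    fix y :: "complex \<times> real"
    show "(\<integral>\<^sup>+ g. \<integral>\<^sup>+ g'. K y (act g x) (act g' x) \<partial>?N \<partial>?N) * indicator F y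
      = (\<integral>\<^sup>+ d. \<integral>\<^sup>+ g. K (act g y) x (act d x) * indicator F y \<partial>?N \<partial>?N)"
      using sums[of y] FH by (cases "y \<in> F") auto
  qed
  also have "\<dots> = (\<integral>\<^sup>+ d. (\<integral>\<^sup>+ y. \<integral>\<^sup>+ g. K (act g y) x (act d x) * indicator F y \<partial>?N \<partial>hyp_volume) \<partial>?N)"
    by (intro sum_integral_swap measurable_sum m)
  also have "\<dots> = (\<integral>\<^sup>+ d. (\<integral>\<^sup>+ g. \<integral>\<^sup>+ y. K (act g y) x (act d x) * indicator F y \<partial>hyp_volume \<partial>?N) \<partial>?N)"
    by (rule nn_integral_cong, rule sum_integral_swap, rule m)
  also have "\<dots> = (\<integral>\<^sup>+ d. orb K d x \<partial>?N)"
    unfolding orb_def by (rule nn_integral_cong, rule tiling[OF F, symmetric]) measurable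
  finally show ?thesis .
qed

lemma sum_orb_int:
  assumes F: "is_fund F" and K: "inv_kernel K"
  shows "(\<integral>\<^sup>+ x. (\<integral>\<^sup>+ d. orb K d x \<partial>count_space (carrier G)) * indicator F x \<partial>hyp_volume)
    = (\<integral>\<^sup>+ d. orb_int K F d \<partial>count_space (carrier G))"
proof -
  have [measurable]: "F \<in> sets borel" using F by (auto simp: is_fund_def)
  have "(\<integral>\<^sup>+ x. (\<integral>\<^sup>+ d. orb K d x \<partial>count_space (carrier G)) * indicator F x \<partial>hyp_volume)
    = (\<integral>\<^sup>+ x. (\<integral>\<^sup>+ d. orb K d x * indicator F x \<partial>count_space (carrier G)) \<partial>hyp_volume)"
    by (rule nn_integral_cong, rule nn_integral_multc[symmetric]) simp
  also have "\<dots> = (\<integral>\<^sup>+ d. orb_int K F d \<partial>count_space (carrier G))"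
    unfolding orb_int_def
  proof (rule sum_integral_swap)
    fix d assume "d \<in> carrier G"
    then have [measurable]: "orb K d \<in> borel_measurable borel" by (rule orb_measurable[OF K])
    show "(\<lambda>x. orb K d x * indicator F x) \<in> borel_measurable hyp_volume" by measurable
  qed
  finally show ?thesis .
qed

lemma orb_conj:
  assumes K: "inv_kernel K" and g: "g \<in> carrier G" and d: "d \<in> carrier G" and x: "x \<in> H3"
  shows "orb K d (act g x) = orb K (inv g \<otimes> d \<otimes> g) x"
proof -
  have [measurable]: "(\<lambda>y. K y p q) \<in> borel_measurable borel" for p q using K unfolding inv_kernel_def by blast
  have "orb K d (act g x) = (\<integral>\<^sup>+ y. K (act g y) (act g x) (act d (act g x)) \<partial>hyp_volume)"
    unfolding orb_def by (rule act_volume[symmetric, OF g]) measurable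
  also have "\<dots> = (\<integral>\<^sup>+ y. K y x (act (inv g \<otimes> d \<otimes> g) x) \<partial>hyp_volume)"
  proof (rule nn_integral_cong_AE)
    have eq: "act d (act g x) = act g (act (inv g \<otimes> d \<otimes> g) x)"
      using g d x by (simp add: act_mult[symmetric] m_assoc[symmetric])
    show "AE y in hyp_volume. K (act g y) (act g x) (act d (act g x)) = K y x (act (inv g \<otimes> d \<otimes> g) x)"
      using AE_hyp_volume_H3
    proof eventually_elim
      case (elim y)
      have "act (inv g \<otimes> d \<otimes> g) x \<in> H3" using g d x by (intro act_H3) auto
      then show ?case using K elim g x eq by (simp add: inv_kernel_def)
    qed
  qed
  finally show ?thesis by (simp add: orb_def)
qed

text \<open>The factor \<open>n\<close> is the index of the group generated by
  \<open>d0\<close> in its centralizer.\<close>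

lemma conj_class_sum:
  assumes F: "is_fund F" and d0: "d0 \<in> carrier G"
    and X [measurable]: "X \<in> sets borel" and XH: "X \<subseteq> H3"
    and strip: "\<And>x. x \<in> H3 \<Longrightarrow> \<exists>!k::int. act (d0 [^] k) x \<in> X"
    and proper: "\<And>\<rho>. \<exists>r. \<forall>x\<in>X. hcosh x (act d0 x) \<le> \<rho> \<longrightarrow> hcosh jpt x \<le> r"
  shows "\<exists>n. 0 < n \<and> n < \<infinity> \<and> (\<forall>K. inv_kernel K \<longrightarrow>
    (\<integral>\<^sup>+ x. orb K d0 x * indicator X x \<partial>hyp_volume) =
    n * (\<integral>\<^sup>+ d. orb_int K F d * indicator ((\<lambda>g. inv g \<otimes> d0 \<otimes> g) ` carrier G) d \<partial>count_space (carrier G)))"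
proof -
  let ?N = "count_space (carrier G)"
  define Z where "Z = {z \<in> carrier G. d0 \<otimes> z = z \<otimes> d0}"
  \<comment> \<open>The number of elements of the centralizer that carry x into X. As X is a
    fundamental domain for the powers of d0, this is the index of the group they generate, whatever
    the point x.\<close>
  define N where "N x = (\<integral>\<^sup>+ z. indicator Z z * indicator X (act z x) \<partial>?N)" for x
  define n where "n = N jpt"
  have Fm [measurable]: "F \<in> sets borel" and FH: "F \<subseteq> H3" using F by (auto simp: is_fund_def)
  have pow_Z: "d0 [^] (k::int) \<in> Z" for k
  proof -
    have "d0 \<otimes> d0 [^] k = d0 [^] (1 + k)" using d0 by (subst int_pow_mult) simp_all
    moreover have "d0 [^] k \<otimes> d0 = d0 [^] (k + 1)" using d0 by (subst int_pow_mult) simp_all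
    ultimately show ?thesis using d0 by (simp add: Z_def add.commute)
  qed
  have Z_mult: "z \<otimes> w \<in> Z \<longleftrightarrow> w \<in> Z" if z: "z \<in> Z" and w: "w \<in> carrier G" for z w
  proof -
    have zc: "z \<in> carrier G" "d0 \<otimes> z = z \<otimes> d0" using z by (auto simp: Z_def)
    have "d0 \<otimes> (z \<otimes> w) = z \<otimes> (d0 \<otimes> w)"
      using zc w d0 by (metis m_assoc)
    moreover have "z \<otimes> w \<otimes> d0 = z \<otimes> (w \<otimes> d0)" using zc w d0 by (simp add: m_assoc)
    ultimately show ?thesis using zc w d0 by (simp add: Z_def)
  qed
  have one_strip: "(\<integral>\<^sup>+ k. indicator X (act (d0 [^] (k::int)) x) \<partial>count_space UNIV) = (1::ennreal)" if "x \<in> H3" for x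
  proof -
    obtain k0 where k0: "act (d0 [^] (k0::int)) x \<in> X" "\<And>k::int. act (d0 [^] k) x \<in> X \<Longrightarrow> k = k0"
      using strip[OF \<open>x \<in> H3\<close>] by metis
    have "(\<integral>\<^sup>+ k. indicator X (act (d0 [^] (k::int)) x) \<partial>count_space UNIV) = (\<Sum>k\<in>{k0}. indicator X (act (d0 [^] (k::int)) x) :: ennreal)"
    proof (rule nn_integral_count_space')
      fix k :: int assume "k \<notin> {k0}"
      then show "indicator X (act (d0 [^] k) x) = (0::ennreal)" using k0(2) by (auto simp: indicator_def)
    qed simp_all
    then show ?thesis using k0(1) by simp
  qed
  \<comment> \<open>Double counting of pairs of a centralizing z and a power of d0 for which z x and
    the moved z y lie in X. Each z admits exactly one power, and translating z by a power of d0
    exchanges the roles of x and y.\<close>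
  have N_const: "N x = N y" if x: "x \<in> H3" and y: "y \<in> H3" for x y
  proof -
    have "N x = (\<integral>\<^sup>+ z. (\<integral>\<^sup>+ k. indicator Z z * indicator X (act z x) * indicator X (act (d0 [^] (k::int)) (act z y)) \<partial>count_space UNIV) \<partial>?N)"
      unfolding N_def
    proof (rule nn_integral_cong)
      fix z assume "z \<in> space ?N"
      then have "act z y \<in> H3" using y by (simp add: act_H3)
      from one_strip[OF this]
      show "indicator Z z * indicator X (act z x) = (\<integral>\<^sup>+ k. indicator Z z * indicator X (act z x) * indicator X (act (d0 [^] (k::int)) (act z y)) \<partial>count_space UNIV)"
        by (subst nn_integral_cmult) simp_all
    qed
    also have "\<dots> = (\<integral>\<^sup>+ k. (\<integral>\<^sup>+ z. indicator Z z * indicator X (act z x) * indicator X (act (d0 [^] (k::int)) (act z y)) \<partial>?N) \<partial>count_space UNIV)"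
      by (rule nn_integral_count_space_nn_integral) simp_all
    also have "\<dots> = (\<integral>\<^sup>+ k. (\<integral>\<^sup>+ z. indicator Z z * indicator X (act z y) * indicator X (act (d0 [^] (- k::int)) (act z x)) \<partial>?N) \<partial>count_space UNIV)"
    proof (rule nn_integral_cong)
      fix k :: int
      let ?h = "d0 [^] (- k)"
      have h: "?h \<in> carrier G" "inv ?h = d0 [^] k" using d0 int_pow_neg[of d0 "-k"] by auto
      have "(\<integral>\<^sup>+ z. indicator Z z * indicator X (act z x) * indicator X (act (d0 [^] k) (act z y)) \<partial>?N) =
        (\<integral>\<^sup>+ z. indicator Z (?h \<otimes> z) * indicator X (act (?h \<otimes> z) x) * indicator X (act (d0 [^] k) (act (?h \<otimes> z) y)) \<partial>?N)"
        by (rule sum_translate_left[OF h(1), symmetric])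
      also have "\<dots> = (\<integral>\<^sup>+ z. indicator Z z * indicator X (act z y) * indicator X (act ?h (act z x)) \<partial>?N)"
      proof (rule nn_integral_cong)
        fix z assume "z \<in> space ?N"
        then have z: "z \<in> carrier G" by simp
        have "act (d0 [^] k) (act (?h \<otimes> z) y) = act z y"
          using act_inv[of ?h "act z y"] h z y by (simp add: act_mult act_H3)
        then show "indicator Z (?h \<otimes> z) * indicator X (act (?h \<otimes> z) x) * indicator X (act (d0 [^] k) (act (?h \<otimes> z) y))
          = (indicator Z z * indicator X (act z y) * indicator X (act ?h (act z x)) :: ennreal)"
          using Z_mult[OF pow_Z z, of "-k"] x h z by (auto simp: indicator_def act_mult)
      qed
      finally show "(\<integral>\<^sup>+ z. indicator Z z * indicator X (act z x) * indicator X (act (d0 [^] k) (act z y)) \<partial>?N) =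
        (\<integral>\<^sup>+ z. indicator Z z * indicator X (act z y) * indicator X (act ?h (act z x)) \<partial>?N :: ennreal)" .
    qed
    also have "\<dots> = (\<integral>\<^sup>+ k. (\<integral>\<^sup>+ z. indicator Z z * indicator X (act z y) * indicator X (act (d0 [^] (k::int)) (act z x)) \<partial>?N) \<partial>count_space UNIV)"
      by (rule nn_integral_bij_count_space[where g = "uminus"]) (rule bij_uminus)
    also have "\<dots> = (\<integral>\<^sup>+ z. (\<integral>\<^sup>+ k. indicator Z z * indicator X (act z y) * indicator X (act (d0 [^] (k::int)) (act z x)) \<partial>count_space UNIV) \<partial>?N)"
      by (rule nn_integral_count_space_nn_integral[symmetric]) simp_all
    also have "\<dots> = N y"
      unfolding N_def
    proof (rule nn_integral_cong)
      fix z assume "z \<in> space ?N"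
      then have "act z x \<in> H3" using x by (simp add: act_H3)
      from one_strip[OF this]
      show "(\<integral>\<^sup>+ k. indicator Z z * indicator X (act z y) * indicator X (act (d0 [^] (k::int)) (act z x)) \<partial>count_space UNIV)
         = indicator Z z * indicator X (act z y)"
        by (subst nn_integral_cmult) simp_all
    qed
    finally show ?thesis .
  qed
  have n_pos: "0 < n"
  proof -
    obtain k :: int where k: "act (d0 [^] k) jpt \<in> X" using strip[OF jpt_H3] by blast
    have "(1::ennreal) = (\<Sum>z\<in>{d0 [^] k}. indicator Z z * indicator X (act z jpt))"
      using k pow_Z[of k] by simp
    also have "\<dots> = (\<integral>\<^sup>+ z. indicator Z z * indicator X (act z jpt) \<partial>count_space {d0 [^] k})"
      by (subst nn_integral_count_space_finite) simp_all
    also have "\<dots> \<le> n"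
      unfolding n_def N_def using d0
      by (subst (1 2) nn_integral_count_space_indicator) (auto intro!: nn_integral_mono simp: indicator_def)
    finally show ?thesis by (metis not_one_le_zero not_gr_zero)
  qed
  \<comment> \<open>An element commuting with d0 preserves the displacement under d0. If it brings
    \<open>jpt\<close> into X, then \<open>proper\<close> bounds where \<open>jpt\<close> lands, and
    local finiteness leaves finitely many such elements.\<close>
  have n_fin: "n < \<infinity>"
  proof -
    obtain r where r: "\<And>x. x \<in> X \<Longrightarrow> hcosh x (act d0 x) \<le> hcosh jpt (act d0 jpt) \<Longrightarrow> hcosh jpt x \<le> r"
      using proper[of "hcosh jpt (act d0 jpt)"] by blast
    let ?A = "{z \<in> carrier G. hcosh jpt (act z jpt) \<le> r}"
    have "n = (\<Sum>z\<in>?A. indicator Z z * indicator X (act z jpt))"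
      unfolding n_def N_def
    proof (rule nn_integral_count_space'[OF locally_finite[OF jpt_H3 jpt_H3]])
      fix z assume z: "z \<in> carrier G" "z \<notin> ?A"
      have "z \<notin> Z \<or> act z jpt \<notin> X"
      proof (rule ccontr)
        assume "\<not> ?thesis"
        then have zZ: "d0 \<otimes> z = z \<otimes> d0" and zX: "act z jpt \<in> X" by (auto simp: Z_def)
        have "act d0 (act z jpt) = act z (act d0 jpt)"
          using act_mult[of d0 z jpt] act_mult[of z d0 jpt] zZ z d0 by simp
        then have "hcosh (act z jpt) (act d0 (act z jpt)) = hcosh jpt (act d0 jpt)"
          using z d0 by (simp add: act_hcosh act_H3)
        then show False using r[OF zX] z by simp
      qed
      then show "indicator Z z * indicator X (act z jpt) = (0::ennreal)" by auto
    qed auto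
    also have "\<dots> \<le> (\<Sum>z\<in>?A. 1)" by (intro sum_mono) (auto simp: indicator_def)
    also have "\<dots> < \<infinity>" by (simp add: of_nat_less_top)
    finally show ?thesis .
  qed
  let ?C = "(\<lambda>g. inv g \<otimes> d0 \<otimes> g) ` carrier G"
  \<comment> \<open>The g that conjugate d0 to d form one coset of the centralizer, so the number of
    those bringing x into X is the constant n.\<close>
  have fiber: "(\<integral>\<^sup>+ g. indicator X (act g x) * indicator {inv g \<otimes> d0 \<otimes> g} d \<partial>?N) = n * indicator ?C d"
    if x: "x \<in> H3" for x d
  proof (cases "d \<in> ?C")
    case True
    then obtain g0 where g0: "g0 \<in> carrier G" "d = inv g0 \<otimes> d0 \<otimes> g0" by blast
    have "(\<integral>\<^sup>+ g. indicator X (act g x) * indicator {inv g \<otimes> d0 \<otimes> g} d \<partial>?N) =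
       (\<integral>\<^sup>+ z. indicator X (act (z \<otimes> g0) x) * indicator {inv (z \<otimes> g0) \<otimes> d0 \<otimes> (z \<otimes> g0)} d \<partial>?N)"
      by (rule sum_translate_right[OF g0(1), symmetric])
    also have "\<dots> = N (act g0 x)"
      unfolding N_def
    proof (rule nn_integral_cong)
      fix z assume "z \<in> space ?N"
      then have z: "z \<in> carrier G" by simp
      have "inv (z \<otimes> g0) \<otimes> d0 \<otimes> (z \<otimes> g0) = inv g0 \<otimes> (inv z \<otimes> d0 \<otimes> z) \<otimes> g0"
        using z g0 d0 by (simp add: inv_mult_group m_assoc)
      then have "d = inv (z \<otimes> g0) \<otimes> d0 \<otimes> (z \<otimes> g0) \<longleftrightarrow> d0 = inv z \<otimes> d0 \<otimes> z"
        using z g0 d0 by simp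
      also have "\<dots> \<longleftrightarrow> z \<in> Z"
        using z d0 inv_solve_left[of d0 z "d0 \<otimes> z"] by (auto simp: Z_def m_assoc)
      finally show "indicator X (act (z \<otimes> g0) x) * indicator {inv (z \<otimes> g0) \<otimes> d0 \<otimes> (z \<otimes> g0)} d
          = (indicator Z z * indicator X (act z (act g0 x)) :: ennreal)"
        using z g0(1) x by (auto simp: indicator_def act_mult)
    qed
    also have "\<dots> = n" unfolding n_def using x g0(1) by (intro N_const) (auto simp: act_H3)
    finally show ?thesis using True by simp
  next
    case False
    then have "indicator X (act g x) * indicator {inv g \<otimes> d0 \<otimes> g} d = (0::ennreal)" if "g \<in> carrier G" for g
      using that by (auto simp: indicator_def)
    then have "(\<integral>\<^sup>+ g. indicator X (act g x) * indicator {inv g \<otimes> d0 \<otimes> g} d \<partial>?N) = (\<integral>\<^sup>+ g. 0 \<partial>?N)"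
      by (intro nn_integral_cong) auto
    then show ?thesis using False by simp
  qed
  have main: "(\<integral>\<^sup>+ x. orb K d0 x * indicator X x \<partial>hyp_volume) = n * (\<integral>\<^sup>+ d. orb_int K F d * indicator ?C d \<partial>?N)"
    if K: "inv_kernel K" for K
  proof -
    have orbm: "orb K d \<in> borel_measurable borel" if "d \<in> carrier G" for d
      using K that by (rule orb_measurable)
    note [measurable] = orbm[OF d0]
    have Cc: "inv g \<otimes> d0 \<otimes> g \<in> carrier G" if "g \<in> carrier G" for g using that d0 by simp
    have actm: "(\<lambda>x. indicator X (act g x)) \<in> borel_measurable borel" if "g \<in> carrier G" for g
    proof -
      note [measurable] = act_meas[OF that]
      show ?thesis by measurable
    qed
    have "(\<integral>\<^sup>+ x. orb K d0 x * indicator X x \<partial>hyp_volume) =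
      (\<integral>\<^sup>+ g. (\<integral>\<^sup>+ x. orb K d0 (act g x) * indicator X (act g x) * indicator F x \<partial>hyp_volume) \<partial>?N)"
      by (rule tiling[OF F]) measurable
    also have "\<dots> = (\<integral>\<^sup>+ g. (\<integral>\<^sup>+ d. (\<integral>\<^sup>+ x. orb K d x * indicator F x * (indicator X (act g x) * indicator {inv g \<otimes> d0 \<otimes> g} d) \<partial>hyp_volume) \<partial>?N) \<partial>?N)"
    proof (rule nn_integral_cong)
      fix g assume "g \<in> space ?N"
      then have g: "g \<in> carrier G" by simp
      let ?d = "inv g \<otimes> d0 \<otimes> g"
      have "(\<integral>\<^sup>+ d. (\<integral>\<^sup>+ x. orb K d x * indicator F x * (indicator X (act g x) * indicator {?d} d) \<partial>hyp_volume) \<partial>?N)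
        = (\<Sum>d\<in>{?d}. (\<integral>\<^sup>+ x. orb K d x * indicator F x * (indicator X (act g x) * indicator {?d} d) \<partial>hyp_volume))"
        using Cc[OF g] by (intro nn_integral_count_space') auto
      also have "\<dots> = (\<integral>\<^sup>+ x. orb K d0 (act g x) * indicator X (act g x) * indicator F x \<partial>hyp_volume)"
        using orb_conj[OF K g d0] FH by (auto intro!: nn_integral_cong simp: indicator_def)
      finally show "(\<integral>\<^sup>+ x. orb K d0 (act g x) * indicator X (act g x) * indicator F x \<partial>hyp_volume) =
        (\<integral>\<^sup>+ d. (\<integral>\<^sup>+ x. orb K d x * indicator F x * (indicator X (act g x) * indicator {?d} d) \<partial>hyp_volume) \<partial>?N)" ..
    qed
    also have "\<dots> = (\<integral>\<^sup>+ d. (\<integral>\<^sup>+ g. (\<integral>\<^sup>+ x. orb K d x * indicator F x * (indicator X (act g x) * indicator {inv g \<otimes> d0 \<otimes> g} d) \<partial>hyp_volume) \<partial>?N) \<partial>?N)"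
      by (rule sum_integral_swap) simp
    also have "\<dots> = (\<integral>\<^sup>+ d. orb_int K F d * (n * indicator ?C d) \<partial>?N)"
    proof (rule nn_integral_cong)
      fix d assume "d \<in> space ?N"
      then have d: "d \<in> carrier G" by simp
      note [measurable] = orbm[OF d]
      have "(\<integral>\<^sup>+ g. (\<integral>\<^sup>+ x. orb K d x * indicator F x * (indicator X (act g x) * indicator {inv g \<otimes> d0 \<otimes> g} d) \<partial>hyp_volume) \<partial>?N)
        = (\<integral>\<^sup>+ x. (\<integral>\<^sup>+ g. orb K d x * indicator F x * (indicator X (act g x) * indicator {inv g \<otimes> d0 \<otimes> g} d) \<partial>?N) \<partial>hyp_volume)"
      proof (rule sum_integral_swap[symmetric])
        fix g assume "g \<in> carrier G"
        note [measurable] = actm[OF this]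
        show "(\<lambda>x. orb K d x * indicator F x * (indicator X (act g x) * indicator {inv g \<otimes> d0 \<otimes> g} d)) \<in> borel_measurable hyp_volume"
          by measurable
      qed
      also have "\<dots> = (\<integral>\<^sup>+ x. orb K d x * indicator F x * (n * indicator ?C d) \<partial>hyp_volume)"
      proof (rule nn_integral_cong)
        fix x :: "complex \<times> real"
        show "(\<integral>\<^sup>+ g. orb K d x * indicator F x * (indicator X (act g x) * indicator {inv g \<otimes> d0 \<otimes> g} d) \<partial>?N) =
          orb K d x * indicator F x * (n * indicator ?C d)"
          using fiber[of x d] FH by (cases "x \<in> F") (auto simp: nn_integral_cmult)
      qed
      also have "\<dots> = orb_int K F d * (n * indicator ?C d)"
        unfolding orb_int_def by (subst nn_integral_multc) simp_all
      finally show "(\<integral>\<^sup>+ g. (\<integral>\<^sup>+ x. orb K d x * indicator F x * (indicator X (act g x) * indicator {inv g \<otimes> d0 \<otimes> g} d) \<partial>hyp_volume) \<partial>?N)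
        = orb_int K F d * (n * indicator ?C d)" .
    qed
    also have "\<dots> = n * (\<integral>\<^sup>+ d. orb_int K F d * indicator ?C d \<partial>?N)"
      by (subst nn_integral_cmult[symmetric]) (simp_all add: mult_ac)
    finally show ?thesis .
  qed
  show ?thesis using n_pos n_fin main by blast
qed

end

section \<open>The trace inequality\<close>

text \<open>Linear in the cosine of the distance, so that integrals against the volume become
  moments of polynomials.\<close>

definition hk :: "real \<Rightarrow> complex \<times> real \<Rightarrow> complex \<times> real \<Rightarrow> real" where
  "hk C y x = max 0 (C - hcosh y x)"

definition kerP :: "real \<Rightarrow> real \<Rightarrow> complex \<times> real \<Rightarrow> complex \<times> real \<Rightarrow> complex \<times> real \<Rightarrow> ennreal" where
  "kerP \<kappa> C y p q = ennreal (hk C y p * hk C y q * (1 + \<kappa> * (hcosh y p * hcosh y q)))"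

definition kerQ :: "real \<Rightarrow> real \<Rightarrow> complex \<times> real \<Rightarrow> complex \<times> real \<Rightarrow> complex \<times> real \<Rightarrow> ennreal" where
  "kerQ \<kappa> C y p q = ennreal (hk C y p * hk C y q * (\<kappa> * hcosh p q))"

lemma hcosh_nonneg: "p \<in> H3 \<Longrightarrow> q \<in> H3 \<Longrightarrow> 0 \<le> hcosh p q"
  using hcosh_ge_1[of p q] by simp

lemma hk_nonneg [simp]: "hk C y x \<ge> 0"
  by (simp add: hk_def)

lemma hk_measurable [measurable (raw)]:
  assumes "f \<in> borel_measurable M" "g \<in> borel_measurable M"
  shows "(\<lambda>x. hk C (f x) (g x)) \<in> borel_measurable M"
  unfolding hk_def using assms by measurable

text \<open>By the Gram identity the right-hand side exceeds the left-hand side by \<kappa> times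
  the squared norm of the weighted sum of the gradients at y.\<close>

lemma kernel_positivity:
  assumes y: "y \<in> H3" and p: "\<And>i. i \<in> S \<Longrightarrow> p i \<in> H3" and \<kappa>: "\<kappa> \<ge> 0"
  shows "(\<Sum>i\<in>S. hk C y (p i))\<^sup>2 + (\<Sum>i\<in>S. \<Sum>j\<in>S. hk C y (p i) * hk C y (p j) * (\<kappa> * hcosh (p i) (p j)))
     \<le> (\<Sum>i\<in>S. \<Sum>j\<in>S. hk C y (p i) * hk C y (p j) * (1 + \<kappa> * (hcosh y (p i) * hcosh y (p j))))"
proof -
  let ?h = "\<lambda>i. hk C y (p i)" and ?u = "\<lambda>i. hgrad y (p i)"
  have "(\<Sum>i\<in>S. \<Sum>j\<in>S. ?h i * ?h j * (1 + \<kappa> * (hcosh y (p i) * hcosh y (p j))))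
    = (\<Sum>i\<in>S. \<Sum>j\<in>S. ?h i * ?h j + ?h i * ?h j * (\<kappa> * hcosh (p i) (p j)) + \<kappa> * ((?h i *\<^sub>R ?u i) \<bullet> (?h j *\<^sub>R ?u j)))"
  proof (intro sum.cong refl)
    fix i j assume "i \<in> S" "j \<in> S"
    then have "hcosh y (p i) * hcosh y (p j) = hcosh (p i) (p j) + ?u i \<bullet> ?u j"
      using hcosh_gram[OF y p p, of i j] by simp
    then show "?h i * ?h j * (1 + \<kappa> * (hcosh y (p i) * hcosh y (p j))) =
      ?h i * ?h j + ?h i * ?h j * (\<kappa> * hcosh (p i) (p j)) + \<kappa> * ((?h i *\<^sub>R ?u i) \<bullet> (?h j *\<^sub>R ?u j))"
      by (simp add: algebra_simps)
  qed
  also have "\<dots> = (\<Sum>i\<in>S. ?h i)\<^sup>2 + (\<Sum>i\<in>S. \<Sum>j\<in>S. ?h i * ?h j * (\<kappa> * hcosh (p i) (p j)))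
      + \<kappa> * ((\<Sum>i\<in>S. ?h i *\<^sub>R ?u i) \<bullet> (\<Sum>j\<in>S. ?h j *\<^sub>R ?u j))"
  proof -
    have "(\<Sum>i\<in>S. ?h i)\<^sup>2 = (\<Sum>i\<in>S. \<Sum>j\<in>S. ?h i * ?h j)"
      by (simp add: power2_eq_square sum_product)
    moreover have "(\<Sum>i\<in>S. ?h i *\<^sub>R ?u i) \<bullet> (\<Sum>j\<in>S. ?h j *\<^sub>R ?u j) =
        (\<Sum>i\<in>S. \<Sum>j\<in>S. (?h i *\<^sub>R ?u i) \<bullet> (?h j *\<^sub>R ?u j))"
      by (simp only: inner_sum_left inner_sum_right) (rule sum.swap)
    ultimately show ?thesis by (simp only: sum.distrib sum_distrib_left)
  qed
  finally show ?thesis using \<kappa> by simp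
qed

context hyp_lattice
begin

lemma inv_kernel_kerP: "inv_kernel (kerP \<kappa> C)"
  unfolding inv_kernel_def
proof (intro conjI allI ballI)
  show "(\<lambda>y. kerP \<kappa> C y p q) \<in> borel_measurable borel" for p q
    unfolding kerP_def by measurable
  fix d assume d: "d \<in> carrier G"
  note [measurable] = act_meas[OF d]
  show "(\<lambda>(x, y). kerP \<kappa> C y x (act d x)) \<in> borel_measurable (borel \<Otimes>\<^sub>M borel)"
    unfolding kerP_def by measurable
qed (simp add: kerP_def hk_def act_hcosh)

lemma inv_kernel_kerQ: "inv_kernel (kerQ \<kappa> C)"
  unfolding inv_kernel_def
proof (intro conjI allI ballI)
  show "(\<lambda>y. kerQ \<kappa> C y p q) \<in> borel_measurable borel" for p q
    unfolding kerQ_def by measurable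
  fix d assume d: "d \<in> carrier G"
  note [measurable] = act_meas[OF d]
  show "(\<lambda>(x, y). kerQ \<kappa> C y x (act d x)) \<in> borel_measurable (borel \<Otimes>\<^sub>M borel)"
    unfolding kerQ_def by measurable
qed (simp add: kerQ_def hk_def act_hcosh)

text \<open>Cocompactness provides a and b that move x and y near \<open>jpt\<close>, and g -> b g
  a^-1 maps the set injectively into one finite set. The uniformity later makes the total of the
  \<open>kerQ\<close> terms finite.\<close>

lemma uniformly_finite:
  "\<exists>M. \<forall>x\<in>H3. \<forall>y\<in>H3. card {g \<in> carrier G. hcosh y (act g x) \<le> C} \<le> M"
proof -
  obtain r where r: "\<And>p. p \<in> H3 \<Longrightarrow> \<exists>g\<in>carrier G. hcosh jpt (act g p) \<le> r"
    using cocompact by blast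
  define R where "R = 2 * r * (2 * \<bar>C\<bar> * r)"
  let ?B = "{g \<in> carrier G. hcosh jpt (act g jpt) \<le> R}"
  have fin: "finite ?B" by (rule locally_finite) simp_all
  have "card {g \<in> carrier G. hcosh y (act g x) \<le> C} \<le> card ?B" if x: "x \<in> H3" and y: "y \<in> H3" for x y
  proof -
    obtain a b where a: "a \<in> carrier G" "hcosh jpt (act a x) \<le> r" and b: "b \<in> carrier G" "hcosh jpt (act b y) \<le> r"
      using r[OF x] r[OF y] by blast
    have "r \<ge> 1" using hcosh_ge_1[of jpt "act a x"] a x by (simp add: act_H3)
    show ?thesis
    proof (rule card_inj_on_le[OF _ _ fin])
      show "inj_on (\<lambda>g. b \<otimes> g \<otimes> inv a) {g \<in> carrier G. hcosh y (act g x) \<le> C}"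
        using a(1) b(1) by (auto intro!: inj_onI)
      show "(\<lambda>g. b \<otimes> g \<otimes> inv a) ` {g \<in> carrier G. hcosh y (act g x) \<le> C} \<subseteq> ?B"
      proof (rule image_subsetI)
        fix g assume "g \<in> {g \<in> carrier G. hcosh y (act g x) \<le> C}"
        then have g: "g \<in> carrier G" "hcosh y (act g x) \<le> C" by auto
        let ?x = "act a x" and ?y = "act b y" and ?k = "b \<otimes> g \<otimes> inv a"
        have k: "?k \<in> carrier G" using a b g by simp
        have xy: "?x \<in> H3" "?y \<in> H3" using a b x y by (simp_all add: act_H3)
        have kx: "act ?k ?x = act b (act g x)"
          using a b g x by (simp add: act_mult act_inv act_H3)
        have "C \<ge> 1" using g hcosh_ge_1[of y "act g x"] x y by (simp add: act_H3)
        have "hcosh ?y (act ?k ?x) = hcosh y (act g x)"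
          unfolding kx using b g x y by (simp add: act_hcosh act_H3)
        moreover have "hcosh (act ?k ?x) (act ?k jpt) = hcosh ?x jpt"
          using k xy by (simp add: act_hcosh)
        moreover have "hcosh ?y (act ?k jpt) \<le> 2 * hcosh ?y (act ?k ?x) * hcosh (act ?k ?x) (act ?k jpt)"
          using k xy by (intro hcosh_le_mult) (simp_all add: act_H3)
        ultimately have "hcosh ?y (act ?k jpt) \<le> 2 * hcosh y (act g x) * hcosh ?x jpt" by simp
        also have "\<dots> \<le> 2 * C * r"
          using g a(2) \<open>C \<ge> 1\<close> hcosh_ge_1[of ?x jpt] hcosh_ge_1[of y "act g x"] x y xy by (intro mult_mono) (auto simp: hcosh_commute act_H3)
        finally have 1: "hcosh ?y (act ?k jpt) \<le> 2 * C * r" .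
        have "hcosh jpt (act ?k jpt) \<le> 2 * hcosh jpt ?y * hcosh ?y (act ?k jpt)"
          using k xy by (intro hcosh_le_mult) (simp_all add: act_H3)
        also have "\<dots> \<le> 2 * r * (2 * C * r)"
          using 1 b(2) \<open>r \<ge> 1\<close> \<open>C \<ge> 1\<close> hcosh_ge_1[of ?y "act ?k jpt"] hcosh_ge_1[of jpt ?y] xy k by (intro mult_mono) (auto simp: act_H3)
        finally show "?k \<in> ?B" using \<open>C \<ge> 1\<close> k by (simp add: R_def)
      qed
    qed
  qed
  then show ?thesis by blast
qed

lemma sum_support:
  assumes x: "x \<in> H3" and y: "y \<in> H3" and f: "\<And>g. g \<in> carrier G \<Longrightarrow> C < hcosh y (act g x) \<Longrightarrow> f g = 0"
  shows "(\<integral>\<^sup>+ g. f g \<partial>count_space (carrier G)) = (\<Sum>g\<in>{g \<in> carrier G. hcosh y (act g x) \<le> C}. f g)"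
  by (rule nn_integral_count_space') (use locally_finite[OF y x] f in \<open>auto simp: not_le\<close>)

lemma sum_kernel:
  fixes k :: "complex \<times> real \<Rightarrow> complex \<times> real \<Rightarrow> real"
  assumes x: "x \<in> H3" and y: "y \<in> H3" and k: "\<And>p q. p \<in> H3 \<Longrightarrow> q \<in> H3 \<Longrightarrow> k p q \<ge> 0"
    and S: "S = {g \<in> carrier G. hcosh y (act g x) \<le> C}"
  shows "(\<integral>\<^sup>+ g. \<integral>\<^sup>+ g'. ennreal (hk C y (act g x) * hk C y (act g' x) * k (act g x) (act g' x)) \<partial>count_space (carrier G) \<partial>count_space (carrier G))
    = ennreal (\<Sum>g\<in>S. \<Sum>g'\<in>S. hk C y (act g x) * hk C y (act g' x) * k (act g x) (act g' x))"
proof -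
  let ?f = "\<lambda>g g'. hk C y (act g x) * hk C y (act g' x) * k (act g x) (act g' x)"
  have "(\<integral>\<^sup>+ g. \<integral>\<^sup>+ g'. ennreal (?f g g') \<partial>count_space (carrier G) \<partial>count_space (carrier G)) =
     (\<integral>\<^sup>+ g. (\<Sum>g'\<in>S. ennreal (?f g g')) \<partial>count_space (carrier G))"
    unfolding S by (rule nn_integral_cong, rule sum_support[OF x y]) (simp add: hk_def)
  also have "\<dots> = (\<Sum>g\<in>S. \<Sum>g'\<in>S. ennreal (?f g g'))"
    unfolding S by (rule sum_support[OF x y]) (simp add: hk_def)
  also have "\<dots> = ennreal (\<Sum>g\<in>S. \<Sum>g'\<in>S. ?f g g')"
    using k x by (subst sum_ennreal[symmetric], (intro sum_nonneg mult_nonneg_nonneg; simp add: S act_H3),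
        intro sum.cong refl sum_ennreal, (intro mult_nonneg_nonneg; simp add: S act_H3))
  finally show ?thesis .
qed

lemma pointwise_trace:
  assumes x: "x \<in> H3" and y: "y \<in> H3" and \<kappa>: "\<kappa> \<ge> 0"
  shows "(\<integral>\<^sup>+ g. ennreal (hk C y (act g x)) \<partial>count_space (carrier G))\<^sup>2
      + (\<integral>\<^sup>+ g. \<integral>\<^sup>+ g'. kerQ \<kappa> C y (act g x) (act g' x) \<partial>count_space (carrier G) \<partial>count_space (carrier G))
    \<le> (\<integral>\<^sup>+ g. \<integral>\<^sup>+ g'. kerP \<kappa> C y (act g x) (act g' x) \<partial>count_space (carrier G) \<partial>count_space (carrier G))"
proof -
  define S where "S = {g \<in> carrier G. hcosh y (act g x) \<le> C}"
  have SH: "act g x \<in> H3" if "g \<in> S" for g using that x by (simp add: S_def act_H3)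
  have ge: "hcosh p q \<ge> 0" if "p \<in> H3" "q \<in> H3" for p q using hcosh_ge_1[OF that] by simp
  have 1: "(\<integral>\<^sup>+ g. ennreal (hk C y (act g x)) \<partial>count_space (carrier G)) = ennreal (\<Sum>g\<in>S. hk C y (act g x))"
    unfolding S_def by (subst sum_support[OF x y, where C = C]) (simp add: hk_def, simp add: sum_ennreal)
  have 2: "(\<integral>\<^sup>+ g. \<integral>\<^sup>+ g'. kerQ \<kappa> C y (act g x) (act g' x) \<partial>count_space (carrier G) \<partial>count_space (carrier G))
    = ennreal (\<Sum>g\<in>S. \<Sum>g'\<in>S. hk C y (act g x) * hk C y (act g' x) * (\<kappa> * hcosh (act g x) (act g' x)))"
    unfolding kerQ_def by (rule sum_kernel[OF x y _ S_def]) (simp add: \<kappa> ge)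
  have 3: "(\<integral>\<^sup>+ g. \<integral>\<^sup>+ g'. kerP \<kappa> C y (act g x) (act g' x) \<partial>count_space (carrier G) \<partial>count_space (carrier G))
    = ennreal (\<Sum>g\<in>S. \<Sum>g'\<in>S. hk C y (act g x) * hk C y (act g' x) * (1 + \<kappa> * (hcosh y (act g x) * hcosh y (act g' x))))"
    unfolding kerP_def
    by (rule sum_kernel[OF x y _ S_def, where k = "\<lambda>p q. 1 + \<kappa> * (hcosh y p * hcosh y q)"]) (simp add: \<kappa> ge y)
  have "ennreal ((\<Sum>g\<in>S. hk C y (act g x))\<^sup>2 + (\<Sum>g\<in>S. \<Sum>g'\<in>S. hk C y (act g x) * hk C y (act g' x) * (\<kappa> * hcosh (act g x) (act g' x))))
    \<le> ennreal (\<Sum>g\<in>S. \<Sum>g'\<in>S. hk C y (act g x) * hk C y (act g' x) * (1 + \<kappa> * (hcosh y (act g x) * hcosh y (act g' x))))"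
    by (rule ennreal_leI, rule kernel_positivity[OF y SH \<kappa>])
  moreover have "0 \<le> (\<Sum>g\<in>S. \<Sum>g'\<in>S. hk C y (act g x) * hk C y (act g' x) * (\<kappa> * hcosh (act g x) (act g' x)))"
    by (intro sum_nonneg mult_nonneg_nonneg) (simp_all add: \<kappa> ge SH)
  ultimately show ?thesis
    unfolding 1 2 3 by (simp add: ennreal_power sum_nonneg)
qed

text \<open>Unfolding makes D a lower bound for the integral over F of the orbit sum f; the rest is
  the Cauchy-Schwarz inequality, in the form 2 l f <= f^2 + l^2, which also makes sense where f is
  infinite.\<close>

lemma second_moment:
  assumes F: "is_fund F" and V: "emeasure hyp_volume F = ennreal V" "V > 0"
    and x: "x \<in> H3" and D: "ennreal D \<le> (\<integral>\<^sup>+ y. ennreal (hk C y x) \<partial>hyp_volume)" "D \<ge> 0"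
  shows "ennreal (D\<^sup>2 / V) \<le> (\<integral>\<^sup>+ y. (\<integral>\<^sup>+ g. ennreal (hk C y (act g x)) \<partial>count_space (carrier G))\<^sup>2 * indicator F y \<partial>hyp_volume)"
proof -
  have [measurable]: "F \<in> sets borel" and FH: "F \<subseteq> H3" using F by (auto simp: is_fund_def)
  let ?N = "count_space (carrier G)"
  define f where "f y = (\<integral>\<^sup>+ g. ennreal (hk C y (act g x)) \<partial>?N)" for y
  have [measurable]: "f \<in> borel_measurable hyp_volume"
    unfolding f_def[abs_def] by (rule measurable_sum) measurable
  have "(\<integral>\<^sup>+ y. ennreal (hk C y x) \<partial>hyp_volume) =
      (\<integral>\<^sup>+ g. (\<integral>\<^sup>+ y. ennreal (hk C (act g y) x) * indicator F y \<partial>hyp_volume) \<partial>?N)"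
    by (rule tiling[OF F]) measurable
  also have "\<dots> = (\<integral>\<^sup>+ g. (\<integral>\<^sup>+ y. ennreal (hk C (act (inv g) y) x) * indicator F y \<partial>hyp_volume) \<partial>?N)"
    by (rule sum_inverse[symmetric])
  also have "\<dots> = (\<integral>\<^sup>+ g. (\<integral>\<^sup>+ y. ennreal (hk C y (act g x)) * indicator F y \<partial>hyp_volume) \<partial>?N)"
  proof (intro nn_integral_cong)
    fix g y assume "g \<in> space ?N"
    then show "ennreal (hk C (act (inv g) y) x) * indicator F y = ennreal (hk C y (act g x)) * indicator F y"
      using act_hcosh_left[of "inv g" y x] FH x by (auto simp: indicator_def hk_def)
  qed
  also have "\<dots> = (\<integral>\<^sup>+ y. (\<integral>\<^sup>+ g. ennreal (hk C y (act g x)) * indicator F y \<partial>?N) \<partial>hyp_volume)"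
    by (rule sum_integral_swap[symmetric]) measurable
  also have "\<dots> = (\<integral>\<^sup>+ y. f y * indicator F y \<partial>hyp_volume)"
    unfolding f_def by (rule nn_integral_cong, rule nn_integral_multc) simp
  finally have Df: "ennreal D \<le> (\<integral>\<^sup>+ y. f y * indicator F y \<partial>hyp_volume)" using D by simp
  \<comment> \<open>The value of l that maximises the resulting lower bound 2 l D - l^2 V.\<close>
  define l where "l = ennreal (D / V)"
  have "ennreal (2 * D\<^sup>2 / V) = 2 * l * ennreal D"
    using D V by (simp add: l_def ennreal_mult[symmetric] power2_eq_square ennreal_numeral[symmetric] del: ennreal_numeral)
  also have "\<dots> \<le> 2 * l * (\<integral>\<^sup>+ y. f y * indicator F y \<partial>hyp_volume)"
    using Df by (rule mult_left_mono) simp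
  also have "\<dots> = (\<integral>\<^sup>+ y. 2 * l * (f y * indicator F y) \<partial>hyp_volume)"
    by (rule nn_integral_cmult[symmetric]) measurable
  also have "\<dots> \<le> (\<integral>\<^sup>+ y. (f y)\<^sup>2 * indicator F y + l\<^sup>2 * indicator F y \<partial>hyp_volume)"
  proof (rule nn_integral_mono)
    fix y :: "complex \<times> real"
    have "2 * l * f y \<le> (f y)\<^sup>2 + l\<^sup>2"
    proof (cases "f y")
      case (real r)
      have "2 * (D / V) * r \<le> r\<^sup>2 + (D / V)\<^sup>2"
        using sum_squares_bound[of "D / V" r] by simp
      then have "ennreal (2 * (D / V) * r) \<le> ennreal (r\<^sup>2 + (D / V)\<^sup>2)" by (rule ennreal_leI)
      moreover have "ennreal (2 * (D / V) * r) = 2 * l * f y"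
        using real D V by (simp only: l_def real ennreal_mult'' ennreal_mult' mult_nonneg_nonneg divide_nonneg_pos) simp
      ultimately show ?thesis using real D V
        by (simp add: l_def ennreal_power)
    next
      case top
      then show ?thesis by (simp add: power2_eq_square)
    qed
    then show "2 * l * (f y * indicator F y) \<le> (f y)\<^sup>2 * indicator F y + l\<^sup>2 * indicator F y"
      by (simp add: indicator_def)
  qed
  also have "\<dots> = (\<integral>\<^sup>+ y. (f y)\<^sup>2 * indicator F y \<partial>hyp_volume) + (\<integral>\<^sup>+ y. l\<^sup>2 * indicator F y \<partial>hyp_volume)"
    by (rule nn_integral_add) measurable
  also have "(\<integral>\<^sup>+ y. l\<^sup>2 * indicator F y \<partial>hyp_volume) = l\<^sup>2 * ennreal V"
    by (subst nn_integral_cmult_indicator) (simp_all add: V)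
  also have "\<dots> = ennreal (D\<^sup>2 / V)"
    using D V by (simp add: l_def ennreal_power ennreal_mult[symmetric] power2_eq_square)
  finally have "ennreal (2 * D\<^sup>2 / V) \<le> (\<integral>\<^sup>+ y. (f y)\<^sup>2 * indicator F y \<partial>hyp_volume) + ennreal (D\<^sup>2 / V)" .
  moreover have "ennreal (2 * D\<^sup>2 / V) = ennreal (D\<^sup>2 / V) + ennreal (D\<^sup>2 / V)"
    using V by (subst ennreal_plus[symmetric]) auto
  ultimately have "ennreal (D\<^sup>2 / V) + ennreal (D\<^sup>2 / V) \<le> ennreal (D\<^sup>2 / V) + (\<integral>\<^sup>+ y. (f y)\<^sup>2 * indicator F y \<partial>hyp_volume)"
    by (simp add: add.commute)
  then show ?thesis unfolding f_def by (simp add: ennreal_add_left_cancel_le)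
qed

section \<open>Conjugacy classes and the trace inequality\<close>

text \<open>A fundamental domain for the powers of d on which bounded displacement confines points
  to a bounded region; the latter makes the centralizer index in \<open>conj_class_sum\<close>
  finite.\<close>

definition slab :: "'g \<Rightarrow> (complex \<times> real) set \<Rightarrow> bool" where
  "slab d X \<longleftrightarrow> X \<in> sets borel \<and> X \<subseteq> H3 \<and> (\<forall>x\<in>H3. \<exists>!k::int. act (d [^] k) x \<in> X) \<and>
     (\<forall>\<rho>. \<exists>r. \<forall>x\<in>X. hcosh x (act d x) \<le> \<rho> \<longrightarrow> hcosh jpt x \<le> r)"

definition conj_class :: "'g \<Rightarrow> 'g set" where
  "conj_class d = (\<lambda>g. inv g \<otimes> d \<otimes> g) ` carrier G"

lemma conj_class_eq:
  assumes d: "d \<in> carrier G" and e: "e \<in> conj_class d"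
  shows "conj_class e = conj_class d"
proof -
  obtain h where h: "h \<in> carrier G" "e = inv h \<otimes> d \<otimes> h" using e by (auto simp: conj_class_def)
  have 1: "inv g \<otimes> e \<otimes> g = inv (h \<otimes> g) \<otimes> d \<otimes> (h \<otimes> g)" if "g \<in> carrier G" for g
    using that h d by (simp add: inv_mult_group m_assoc)
  have 2: "inv g \<otimes> d \<otimes> g = inv (inv h \<otimes> g) \<otimes> e \<otimes> (inv h \<otimes> g)" if "g \<in> carrier G" for g
  proof -
    have "h \<otimes> (inv h \<otimes> g) = g" using that h by (simp add: m_assoc[symmetric])
    then show ?thesis using 1[of "inv h \<otimes> g"] that h by simp
  qed
  show ?thesis
  proof
    show "conj_class e \<subseteq> conj_class d" unfolding conj_class_def
      by (rule image_subsetI, rule_tac x = "h \<otimes> x" in image_eqI, rule 1) (simp_all add: h(1))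
    show "conj_class d \<subseteq> conj_class e" unfolding conj_class_def
      by (rule image_subsetI, rule_tac x = "inv h \<otimes> x" in image_eqI, rule 2) (simp_all add: h(1))
  qed
qed

lemma conj_class_self: "d \<in> carrier G \<Longrightarrow> d \<in> conj_class d"
  by (auto simp: conj_class_def intro!: image_eqI[where x = \<one>])

lemma one_notin_conj_class:
  assumes "d \<in> carrier G" "d \<noteq> \<one>" shows "\<one> \<notin> conj_class d"
proof
  assume "\<one> \<in> conj_class d"
  then have "d \<in> conj_class \<one>" using conj_class_eq[of d \<one>] conj_class_self assms by simp
  then show False using assms by (auto simp: conj_class_def)
qed

lemma sum_over_classes:
  fixes f :: "'g \<Rightarrow> ennreal"
  shows "(\<integral>\<^sup>+ d. f d * indicator (- {\<one>}) d \<partial>count_space (carrier G)) =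
    (\<integral>\<^sup>+ c. (\<integral>\<^sup>+ d. f d * indicator c d \<partial>count_space (carrier G)) \<partial>count_space (conj_class ` (carrier G - {\<one>})))"
proof -
  let ?Cl = "conj_class ` (carrier G - {\<one>})"
  have "(\<integral>\<^sup>+ c. (\<integral>\<^sup>+ d. f d * indicator c d \<partial>count_space (carrier G)) \<partial>count_space ?Cl) =
     (\<integral>\<^sup>+ d. (\<integral>\<^sup>+ c. f d * indicator c d \<partial>count_space ?Cl) \<partial>count_space (carrier G))"
    by (rule sum_integral_swap) simp
  also have "\<dots> = (\<integral>\<^sup>+ d. f d * indicator (- {\<one>}) d \<partial>count_space (carrier G))"
  proof (rule nn_integral_cong)
    fix d assume "d \<in> space (count_space (carrier G))"
    then have d: "d \<in> carrier G" by simp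
    show "(\<integral>\<^sup>+ c. f d * indicator c d \<partial>count_space ?Cl) = f d * indicator (- {\<one>}) d"
    proof (cases "d = \<one>")
      case True
      then have "(\<integral>\<^sup>+ c. f d * indicator c d \<partial>count_space ?Cl) = (\<integral>\<^sup>+ c. 0 \<partial>count_space ?Cl)"
        using one_notin_conj_class by (intro nn_integral_cong) auto
      then show ?thesis using True by simp
    next
      case False
      have "(\<integral>\<^sup>+ c. f d * indicator c d \<partial>count_space ?Cl) = (\<Sum>c\<in>{conj_class d}. f d * indicator c d)"
      proof (rule nn_integral_count_space')
        fix c assume c: "c \<in> ?Cl" "c \<notin> {conj_class d}"
        then obtain e where e: "e \<in> carrier G" "c = conj_class e" by blast
        then have "d \<notin> c" using conj_class_eq[of e d] c(2) by blast
        then show "f d * indicator c d = 0" by simp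
      qed (use d False in auto)
      then show ?thesis using False conj_class_self[OF d] by simp
    qed
  qed
  finally show ?thesis ..
qed

text \<open>The sums of \<open>kerP\<close> and \<open>kerQ\<close> are compared one conjugacy class
  at a time. The unknown index from \<open>conj_class_sum\<close> is the same for both kernels and
  cancels, so an inequality on any slab of d suffices. The identity class contributes at most V
  n.\<close>

theorem trace_inequality:
  assumes F: "is_fund F" and V: "emeasure hyp_volume F = ennreal V" "V > 0" and \<kappa>: "\<kappa> \<ge> 0" and C: "C \<ge> 0"
    and slab: "\<And>d. d \<in> carrier G \<Longrightarrow> d \<noteq> \<one> \<Longrightarrow> \<exists>X. slab d X \<and>
      (\<integral>\<^sup>+ x. orb (kerP \<kappa> C) d x * indicator X x \<partial>hyp_volume) \<le> (\<integral>\<^sup>+ x. orb (kerQ \<kappa> C) d x * indicator X x \<partial>hyp_volume)"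
    and n: "\<And>x. x \<in> H3 \<Longrightarrow> (\<integral>\<^sup>+ y. kerP \<kappa> C y x x \<partial>hyp_volume) \<le> ennreal n" "n \<ge> 0"
    and D: "\<And>x. x \<in> H3 \<Longrightarrow> ennreal D \<le> (\<integral>\<^sup>+ y. ennreal (hk C y x) \<partial>hyp_volume)" "D \<ge> 0"
  shows "D\<^sup>2 \<le> V * n"
proof -
  let ?N = "count_space (carrier G)"
  let ?P = "orb_int (kerP \<kappa> C) F" and ?Q = "orb_int (kerQ \<kappa> C) F"
  have [measurable]: "F \<in> sets borel" and FH: "F \<subseteq> H3" using F by (auto simp: is_fund_def)
  have class_le: "(\<integral>\<^sup>+ d. ?P d * indicator c d \<partial>?N) \<le> (\<integral>\<^sup>+ d. ?Q d * indicator c d \<partial>?N)"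
    if "c \<in> conj_class ` (carrier G - {\<one>})" for c
  proof -
    obtain d where d: "d \<in> carrier G" "d \<noteq> \<one>" and c: "c = conj_class d" using \<open>c \<in> _\<close> by blast
    obtain X where X: "slab d X"
      "(\<integral>\<^sup>+ x. orb (kerP \<kappa> C) d x * indicator X x \<partial>hyp_volume) \<le> (\<integral>\<^sup>+ x. orb (kerQ \<kappa> C) d x * indicator X x \<partial>hyp_volume)"
      using slab[OF d] by blast
    obtain k where k: "0 < k" "k < \<infinity>" "\<And>K. inv_kernel K \<Longrightarrow> (\<integral>\<^sup>+ x. orb K d x * indicator X x \<partial>hyp_volume) =
        k * (\<integral>\<^sup>+ d. orb_int K F d * indicator c d \<partial>?N)"
      using conj_class_sum[OF F d(1), of X] X(1) unfolding slab_def c conj_class_def by blast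
    have "k * (\<integral>\<^sup>+ d. ?P d * indicator c d \<partial>?N) \<le> k * (\<integral>\<^sup>+ d. ?Q d * indicator c d \<partial>?N)"
      using X(2) k(3)[OF inv_kernel_kerP] k(3)[OF inv_kernel_kerQ] by simp
    then show ?thesis using k(1,2) by (simp add: ennreal_mult_le_mult_iff)
  qed
  have nontrivial: "(\<integral>\<^sup>+ d. ?P d * indicator (- {\<one>}) d \<partial>?N) \<le> (\<integral>\<^sup>+ d. ?Q d * indicator (- {\<one>}) d \<partial>?N)"
    unfolding sum_over_classes by (rule nn_integral_mono) (simp add: class_le)
  have trivial: "(\<integral>\<^sup>+ d. ?P d * indicator {\<one>} d \<partial>?N) \<le> ennreal (V * n)"
  proof -
    have "(\<integral>\<^sup>+ d. ?P d * indicator {\<one>} d \<partial>?N) = (\<Sum>d\<in>{\<one>}. ?P d * indicator {\<one>} d)"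
      by (rule nn_integral_count_space') auto
    also have "\<dots> = ?P \<one>" by simp
    also have "\<dots> \<le> (\<integral>\<^sup>+ x. ennreal n * indicator F x \<partial>hyp_volume)"
      unfolding orb_int_def orb_def using FH n(1)
      by (intro nn_integral_mono) (auto simp: indicator_def act_one)
    also have "\<dots> = ennreal (V * n)"
      by (subst nn_integral_cmult_indicator) (use V n(2) in \<open>simp_all add: ennreal_mult[symmetric] mult.commute\<close>)
    finally show ?thesis .
  qed
  have P_le: "(\<integral>\<^sup>+ d. ?P d \<partial>?N) \<le> ennreal (V * n) + (\<integral>\<^sup>+ d. ?Q d \<partial>?N)"
  proof -
    have "(\<integral>\<^sup>+ d. ?P d \<partial>?N) = (\<integral>\<^sup>+ d. ?P d * indicator {\<one>} d + ?P d * indicator (- {\<one>}) d \<partial>?N)"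
      by (rule nn_integral_cong) (simp add: indicator_def)
    also have "\<dots> = (\<integral>\<^sup>+ d. ?P d * indicator {\<one>} d \<partial>?N) + (\<integral>\<^sup>+ d. ?P d * indicator (- {\<one>}) d \<partial>?N)"
      by (rule nn_integral_add) simp_all
    also have "\<dots> \<le> ennreal (V * n) + (\<integral>\<^sup>+ d. ?Q d * indicator (- {\<one>}) d \<partial>?N)"
      using trivial nontrivial by (rule add_mono)
    also have "\<dots> \<le> ennreal (V * n) + (\<integral>\<^sup>+ d. ?Q d \<partial>?N)"
      by (intro add_left_mono nn_integral_mono) (simp add: indicator_def)
    finally show ?thesis .
  qed
  \<comment> \<open>For fixed x the integral over y in F yields D^2 / V; integrating over x in F as
    well restores the factor V.\<close>
  have lower: "ennreal (D\<^sup>2) + (\<integral>\<^sup>+ d. ?Q d \<partial>?N) \<le> (\<integral>\<^sup>+ d. ?P d \<partial>?N)"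
  proof -
    have *: "ennreal (D\<^sup>2 / V) + (\<integral>\<^sup>+ d. orb (kerQ \<kappa> C) d x \<partial>?N) \<le> (\<integral>\<^sup>+ d. orb (kerP \<kappa> C) d x \<partial>?N)" if x: "x \<in> H3" for x
    proof -
      have m1: "(\<lambda>y. \<integral>\<^sup>+ g. ennreal (hk C y (act g x)) \<partial>?N) \<in> borel_measurable hyp_volume"
        by (rule measurable_sum) measurable
      have m2: "(\<lambda>y. \<integral>\<^sup>+ g. \<integral>\<^sup>+ g'. kerQ \<kappa> C y (act g x) (act g' x) \<partial>?N \<partial>?N) \<in> borel_measurable hyp_volume"
        unfolding kerQ_def by (rule measurable_sum, rule measurable_sum) measurable
      note [measurable] = m1 m2
      have "ennreal (D\<^sup>2 / V) + (\<integral>\<^sup>+ d. orb (kerQ \<kappa> C) d x \<partial>?N) \<le>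
        (\<integral>\<^sup>+ y. (\<integral>\<^sup>+ g. ennreal (hk C y (act g x)) \<partial>?N)\<^sup>2 * indicator F y \<partial>hyp_volume) +
        (\<integral>\<^sup>+ y. (\<integral>\<^sup>+ g. \<integral>\<^sup>+ g'. kerQ \<kappa> C y (act g x) (act g' x) \<partial>?N \<partial>?N) * indicator F y \<partial>hyp_volume)"
        unfolding sum_orb[OF F inv_kernel_kerQ x]
        by (rule add_right_mono, rule second_moment[OF F V x D(1)[OF x] D(2)])
      also have "\<dots> = (\<integral>\<^sup>+ y. (\<integral>\<^sup>+ g. ennreal (hk C y (act g x)) \<partial>?N)\<^sup>2 * indicator F y +
         (\<integral>\<^sup>+ g. \<integral>\<^sup>+ g'. kerQ \<kappa> C y (act g x) (act g' x) \<partial>?N \<partial>?N) * indicator F y \<partial>hyp_volume)"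
        by (rule nn_integral_add[symmetric]) measurable
      also have "\<dots> \<le> (\<integral>\<^sup>+ y. (\<integral>\<^sup>+ g. \<integral>\<^sup>+ g'. kerP \<kappa> C y (act g x) (act g' x) \<partial>?N \<partial>?N) * indicator F y \<partial>hyp_volume)"
      proof (rule nn_integral_mono)
        fix y :: "complex \<times> real"
        show "(\<integral>\<^sup>+ g. ennreal (hk C y (act g x)) \<partial>?N)\<^sup>2 * indicator F y +
         (\<integral>\<^sup>+ g. \<integral>\<^sup>+ g'. kerQ \<kappa> C y (act g x) (act g' x) \<partial>?N \<partial>?N) * indicator F y \<le>
         (\<integral>\<^sup>+ g. \<integral>\<^sup>+ g'. kerP \<kappa> C y (act g x) (act g' x) \<partial>?N \<partial>?N) * indicator F y"
          using pointwise_trace[OF x _ \<kappa>, of y C] FH by (cases "y \<in> F") auto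
      qed
      also have "\<dots> = (\<integral>\<^sup>+ d. orb (kerP \<kappa> C) d x \<partial>?N)" by (rule sum_orb[OF F inv_kernel_kerP x])
      finally show ?thesis .
    qed
    have orbm: "orb (kerQ \<kappa> C) d \<in> borel_measurable hyp_volume" if "d \<in> carrier G" for d
      using orb_measurable[OF inv_kernel_kerQ that] by simp
    have [measurable]: "(\<lambda>x. \<integral>\<^sup>+ d. orb (kerQ \<kappa> C) d x \<partial>?N) \<in> borel_measurable hyp_volume"
      by (rule measurable_sum) (rule orbm)
    have "ennreal (D\<^sup>2) = (\<integral>\<^sup>+ x. ennreal (D\<^sup>2 / V) * indicator F x \<partial>hyp_volume)"
      by (subst nn_integral_cmult_indicator) (use V D(2) in \<open>simp_all add: ennreal_mult[symmetric]\<close>)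
    then have "ennreal (D\<^sup>2) + (\<integral>\<^sup>+ d. ?Q d \<partial>?N) =
      (\<integral>\<^sup>+ x. ennreal (D\<^sup>2 / V) * indicator F x + (\<integral>\<^sup>+ d. orb (kerQ \<kappa> C) d x \<partial>?N) * indicator F x \<partial>hyp_volume)"
      unfolding sum_orb_int[OF F inv_kernel_kerQ, symmetric] by (subst nn_integral_add) simp_all
    also have "\<dots> \<le> (\<integral>\<^sup>+ x. (\<integral>\<^sup>+ d. orb (kerP \<kappa> C) d x \<partial>?N) * indicator F x \<partial>hyp_volume)"
    proof (rule nn_integral_mono)
      fix x :: "complex \<times> real"
      show "ennreal (D\<^sup>2 / V) * indicator F x + (\<integral>\<^sup>+ d. orb (kerQ \<kappa> C) d x \<partial>?N) * indicator F x \<le>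
        (\<integral>\<^sup>+ d. orb (kerP \<kappa> C) d x \<partial>?N) * indicator F x"
        using *[of x] FH by (cases "x \<in> F") auto
    qed
    also have "\<dots> = (\<integral>\<^sup>+ d. ?P d \<partial>?N)" by (rule sum_orb_int[OF F inv_kernel_kerP])
    finally show ?thesis .
  qed
  \<comment> \<open>At most M group elements bring the orbit of x within reach of y, every pair of
    them contributes at most B, and F has finite volume.\<close>
  have finQ: "(\<integral>\<^sup>+ d. ?Q d \<partial>?N) < \<infinity>"
  proof -
    obtain M where M: "\<And>x y. x \<in> H3 \<Longrightarrow> y \<in> H3 \<Longrightarrow> card {g \<in> carrier G. hcosh y (act g x) \<le> C} \<le> M"
      using uniformly_finite by blast
    define B where "B = C * C * (\<kappa> * (2 * C * C))"
    have Q_le: "hk C y p * hk C y q * (\<kappa> * hcosh p q) \<le> B"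
      if "y \<in> H3" "p \<in> H3" "q \<in> H3" "hcosh y p \<le> C" "hcosh y q \<le> C" for y p q
    proof -
      have "hcosh y p \<ge> 1" "hcosh y q \<ge> 1" "hcosh p q \<ge> 1" using that by (auto intro: hcosh_ge_1)
      moreover have "hcosh p q \<le> 2 * hcosh p y * hcosh y q" using that by (intro hcosh_le_mult) auto
      moreover have "2 * hcosh p y * hcosh y q \<le> 2 * C * C"
        using that calculation C by (intro mult_mono) (auto simp: hcosh_commute)
      ultimately show ?thesis unfolding B_def using C \<kappa>
        by (intro mult_mono) (auto simp: hk_def)
    qed
    have "B \<ge> 0" using C \<kappa> by (simp add: B_def)
    have bound: "(\<integral>\<^sup>+ g. \<integral>\<^sup>+ g'. kerQ \<kappa> C y (act g x) (act g' x) \<partial>?N \<partial>?N) \<le> ennreal (real M * (real M * B))"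
      if x: "x \<in> H3" and y: "y \<in> H3" for x y
    proof -
      define S where "S = {g \<in> carrier G. hcosh y (act g x) \<le> C}"
      have cS: "real (card S) \<le> real M" using M[OF x y] by (simp add: S_def)
      have "(\<integral>\<^sup>+ g. \<integral>\<^sup>+ g'. kerQ \<kappa> C y (act g x) (act g' x) \<partial>?N \<partial>?N) =
         ennreal (\<Sum>g\<in>S. \<Sum>g'\<in>S. hk C y (act g x) * hk C y (act g' x) * (\<kappa> * hcosh (act g x) (act g' x)))"
        unfolding kerQ_def
        by (rule sum_kernel[OF x y _ S_def]) (simp add: \<kappa> hcosh_nonneg)
      also have "\<dots> \<le> ennreal (\<Sum>g\<in>S. \<Sum>g'\<in>S. B)"
        using x y by (intro ennreal_leI sum_mono Q_le) (auto simp: S_def act_H3)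
      also have "\<dots> \<le> ennreal (real M * (real M * B))"
        using cS \<open>B \<ge> 0\<close> by (intro ennreal_leI) (auto intro!: mult_mono)
      finally show ?thesis .
    qed
    have "(\<integral>\<^sup>+ d. ?Q d \<partial>?N) = (\<integral>\<^sup>+ x. (\<integral>\<^sup>+ d. orb (kerQ \<kappa> C) d x \<partial>?N) * indicator F x \<partial>hyp_volume)"
      by (rule sum_orb_int[OF F inv_kernel_kerQ, symmetric])
    also have "\<dots> \<le> (\<integral>\<^sup>+ x. ennreal (real M * (real M * B)) * ennreal V * indicator F x \<partial>hyp_volume)"
    proof (rule nn_integral_mono)
      fix x :: "complex \<times> real"
      have "(\<integral>\<^sup>+ d. orb (kerQ \<kappa> C) d x \<partial>?N) \<le> ennreal (real M * (real M * B)) * ennreal V" if x: "x \<in> H3"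
      proof -
        have "(\<integral>\<^sup>+ d. orb (kerQ \<kappa> C) d x \<partial>?N) \<le> (\<integral>\<^sup>+ y. ennreal (real M * (real M * B)) * indicator F y \<partial>hyp_volume)"
          unfolding sum_orb[OF F inv_kernel_kerQ x, symmetric]
        proof (rule nn_integral_mono)
          fix y :: "complex \<times> real"
          show "(\<integral>\<^sup>+ g. \<integral>\<^sup>+ g'. kerQ \<kappa> C y (act g x) (act g' x) \<partial>?N \<partial>?N) * indicator F y
             \<le> ennreal (real M * (real M * B)) * indicator F y"
            using bound[OF x, of y] FH by (cases "y \<in> F") auto
        qed
        also have "\<dots> = ennreal (real M * (real M * B)) * ennreal V"
          by (subst nn_integral_cmult_indicator) (simp_all add: V)
        finally show ?thesis .
      qed
      then show "(\<integral>\<^sup>+ d. orb (kerQ \<kappa> C) d x \<partial>?N) * indicator F x \<le> ennreal (real M * (real M * B)) * ennreal V * indicator F x"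
        using FH by (cases "x \<in> F") auto
    qed
    also have "\<dots> = ennreal (real M * (real M * B)) * ennreal V * ennreal V"
      by (subst nn_integral_cmult_indicator) (simp_all add: V)
    also have "\<dots> < \<infinity>" by (simp add: ennreal_mult_less_top)
    finally show ?thesis .
  qed
  have "ennreal (D\<^sup>2) + (\<integral>\<^sup>+ d. ?Q d \<partial>?N) \<le> ennreal (V * n) + (\<integral>\<^sup>+ d. ?Q d \<partial>?N)"
    using lower P_le by (rule order_trans)
  then have "(\<integral>\<^sup>+ d. ?Q d \<partial>?N) + ennreal (D\<^sup>2) \<le> (\<integral>\<^sup>+ d. ?Q d \<partial>?N) + ennreal (V * n)"
    by (simp add: add.commute)
  then have "ennreal (D\<^sup>2) \<le> ennreal (V * n)"
    using finQ by (auto simp: ennreal_add_left_cancel_le)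
  then show ?thesis using V n(2) by (simp add: ennreal_le_iff)
qed

end

section \<open>Integration in horospherical coordinates\<close>

lemma borel_measurable_fst_pair [measurable]: "fst \<in> borel_measurable (borel :: (complex \<times> real) measure)"
  and borel_measurable_snd_pair [measurable]: "snd \<in> borel_measurable (borel :: (complex \<times> real) measure)"
  by (intro borel_measurable_continuous_onI continuous_intros)+

lemma nn_integral_affine_reflect:
  fixes f :: "'a::euclidean_space \<Rightarrow> ennreal"
  assumes [measurable]: "f \<in> borel_measurable borel" and c: "\<bar>c\<bar> = 1"
  shows "(\<integral>\<^sup>+ x. f (t + c *\<^sub>R x) \<partial>lborel) = (\<integral>\<^sup>+ x. f x \<partial>lborel)"
proof -
  have "c \<noteq> 0" using c by auto
  then show ?thesis using c
    by (subst (2) lborel_affine[of c t]) (simp_all add: nn_integral_density nn_integral_distr)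
qed

lemma nn_integral_hyp_iterated:
  assumes [measurable]: "f \<in> borel_measurable borel"
  shows "(\<integral>\<^sup>+ x. f x \<partial>hyp_volume) = (\<integral>\<^sup>+ t. ennreal (1 / t ^ 3) * indicator {0<..} t * (\<integral>\<^sup>+ z. f (z, t) \<partial>lborel) \<partial>lborel)"
proof -
  have "(\<integral>\<^sup>+ x. f x \<partial>hyp_volume) = (\<integral>\<^sup>+ x. hyp_density x * f x \<partial>(lborel \<Otimes>\<^sub>M lborel))"
    by (simp add: nn_integral_hyp_volume lborel_prod)
  also have "\<dots> = (\<integral>\<^sup>+ t. \<integral>\<^sup>+ z. hyp_density (z, t) * f (z, t) \<partial>lborel \<partial>lborel)"
    by (rule lborel_pair.nn_integral_snd[symmetric]) (unfold lborel_prod, measurable)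
  also have "\<dots> = (\<integral>\<^sup>+ t. ennreal (1 / t ^ 3) * indicator {0<..} t * (\<integral>\<^sup>+ z. f (z, t) \<partial>lborel) \<partial>lborel)"
  proof (rule nn_integral_cong)
    fix t :: real
    have "hyp_density (z, t) = ennreal (1 / t ^ 3) * indicator {0<..} t" for z
      by (simp add: hyp_density_def indicator_def)
    then show "(\<integral>\<^sup>+ z. hyp_density (z, t) * f (z, t) \<partial>lborel) =
        ennreal (1 / t ^ 3) * indicator {0<..} t * (\<integral>\<^sup>+ z. f (z, t) \<partial>lborel)"
      by (simp add: nn_integral_cmult)
  qed
  finally show ?thesis .
qed

definition diag2 :: "complex \<Rightarrow> complex^2^2" where
  "diag2 \<mu> = (\<chi> i j. if i = j then if i = 1 then \<mu> else 1 / \<mu> else 0)"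

lemma diag2_entries [simp]:
  "diag2 \<mu> $ 1 $ 1 = \<mu>" "diag2 \<mu> $ 1 $ 2 = 0" "diag2 \<mu> $ 2 $ 1 = 0" "diag2 \<mu> $ 2 $ 2 = 1 / \<mu>"
  by (simp_all add: diag2_def)

lemma det_diag2: "\<mu> \<noteq> 0 \<Longrightarrow> det (diag2 \<mu>) = 1"
  by (simp add: det_2)

lemma poincare_ext_diag2:
  assumes "\<mu> \<noteq> 0"
  shows "poincare_ext (diag2 \<mu>) p = (\<mu>\<^sup>2 * fst p, (cmod \<mu>)\<^sup>2 * snd p)"
proof -
  have "\<mu> * fst p * cnj (1 / \<mu>) / complex_of_real ((cmod (1 / \<mu>))\<^sup>2) = \<mu>\<^sup>2 * fst p"
    using assms unfolding complex_norm_square by (simp add: field_simps power2_eq_square)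
  moreover have "snd p / (cmod (1 / \<mu>))\<^sup>2 = (cmod \<mu>)\<^sup>2 * snd p"
    using assms by (simp add: norm_divide power_divide)
  ultimately show ?thesis by (simp add: poincare_ext_def Let_def case_prod_beta)
qed

text \<open>The complex Jacobian is read off from the invariance of the hyperbolic volume.\<close>

lemma nn_integral_complex_mult:
  assumes \<nu>: "\<nu> \<noteq> 0" and [measurable]: "F \<in> borel_measurable borel"
  shows "ennreal ((cmod \<nu>)\<^sup>2) * (\<integral>\<^sup>+ z. F (\<nu> * z) \<partial>lborel) = (\<integral>\<^sup>+ z. F z \<partial>lborel)"
proof -
  \<comment> \<open>\<open>diag2 \<mu>\<close> multiplies horizontal coordinates by the square of
    \<mu>, hence the square root.\<close>
  define \<mu> where "\<mu> = csqrt \<nu>"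
  have \<mu>: "\<mu>\<^sup>2 = \<nu>" "\<mu> \<noteq> 0" using \<nu> by (auto simp: \<mu>_def)
  define E where "E = cmod \<nu>"
  have E: "E = (cmod \<mu>)\<^sup>2" "E > 0" using \<nu> \<mu> by (auto simp: E_def norm_power[symmetric])
  \<comment> \<open>A band of heights on which the density has positive finite integral, so that
    this factor can be cancelled from the invariance identity.\<close>
  define c where "c = (\<integral>\<^sup>+ t. ennreal (1 / t ^ 3) * indicator {1..2} t \<partial>lborel)"
  have "c = ennreal (- 1 / (2 * 2\<^sup>2) - (- 1 / (2 * 1\<^sup>2)))"
    unfolding c_def
    by (rule nn_integral_FTC_Icc) (auto intro!: derivative_eq_intros simp: power2_eq_square power3_eq_cube field_simps)
  then have c: "c \<noteq> 0" "c \<noteq> \<infinity>" by (auto simp: ennreal_eq_0_iff)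
  have w: "ennreal (1 / t ^ 3) * indicator {0<..} t * indicator {1..2} t = ennreal (1 / t ^ 3) * indicator {1..2} t" for t :: real
    by (auto simp: indicator_def)
  have 1: "(\<integral>\<^sup>+ x. F (fst x) * indicator {1..2} (snd x) \<partial>hyp_volume) = c * (\<integral>\<^sup>+ z. F z \<partial>lborel)"
  proof -
    have "(\<integral>\<^sup>+ x. F (fst x) * indicator {1..2} (snd x) \<partial>hyp_volume) =
      (\<integral>\<^sup>+ t. ennreal (1 / t ^ 3) * indicator {0<..} t * (\<integral>\<^sup>+ z. F z * indicator {1..2} t \<partial>lborel) \<partial>lborel)"
      by (subst nn_integral_hyp_iterated) simp_all
    also have "\<dots> = (\<integral>\<^sup>+ t. ennreal (1 / t ^ 3) * indicator {1..2} t * (\<integral>\<^sup>+ z. F z \<partial>lborel) \<partial>lborel)"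
      by (rule nn_integral_cong) (subst w[symmetric], simp add: nn_integral_multc mult_ac)
    also have "\<dots> = c * (\<integral>\<^sup>+ z. F z \<partial>lborel)"
      unfolding c_def by (rule nn_integral_multc) simp
    finally show ?thesis .
  qed
  \<comment> \<open>Rescaling the band of heights produces E^2, which is the Jacobian
    sought.\<close>
  have 2: "(\<integral>\<^sup>+ x. F (\<nu> * fst x) * indicator {1..2} (E * snd x) \<partial>hyp_volume) = ennreal (E\<^sup>2) * c * (\<integral>\<^sup>+ z. F (\<nu> * z) \<partial>lborel)"
  proof -
    have "(\<integral>\<^sup>+ x. F (\<nu> * fst x) * indicator {1..2} (E * snd x) \<partial>hyp_volume) =
      (\<integral>\<^sup>+ t. ennreal (1 / t ^ 3) * indicator {0<..} t * (\<integral>\<^sup>+ z. F (\<nu> * z) * indicator {1..2} (E * t) \<partial>lborel) \<partial>lborel)"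
      by (subst nn_integral_hyp_iterated) simp_all
    also have "\<dots> = (\<integral>\<^sup>+ t. ennreal (1 / t ^ 3) * indicator {1..2} (E * t) * (\<integral>\<^sup>+ z. F (\<nu> * z) \<partial>lborel) \<partial>lborel)"
    proof (rule nn_integral_cong)
      fix t :: real
      have "ennreal (1 / t ^ 3) * indicator {0<..} t * indicator {1..2} (E * t) = ennreal (1 / t ^ 3) * indicator {1..2} (E * t)"
        using E(2) by (auto simp: indicator_def not_less mult_nonneg_nonpos dest: order_trans[of 1])
          (smt (verit) mult_nonneg_nonpos)
      then show "ennreal (1 / t ^ 3) * indicator {0<..} t * (\<integral>\<^sup>+ z. F (\<nu> * z) * indicator {1..2} (E * t) \<partial>lborel) =
        ennreal (1 / t ^ 3) * indicator {1..2} (E * t) * (\<integral>\<^sup>+ z. F (\<nu> * z) \<partial>lborel)"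
        by (simp add: nn_integral_multc mult_ac)
    qed
    also have "\<dots> = (\<integral>\<^sup>+ t. ennreal (1 / t ^ 3) * indicator {1..2} (E * t) \<partial>lborel) * (\<integral>\<^sup>+ z. F (\<nu> * z) \<partial>lborel)"
      by (rule nn_integral_multc) simp
    also have "(\<integral>\<^sup>+ t. ennreal (1 / t ^ 3) * indicator {1..2} (E * t) \<partial>lborel) = ennreal (E\<^sup>2) * c"
    proof -
      have "ennreal (E\<^sup>2) * c = ennreal (E\<^sup>2) * (ennreal \<bar>E\<bar> * (\<integral>\<^sup>+ t. ennreal (1 / (0 + E * t) ^ 3) * indicator {1..2} (0 + E * t) \<partial>lborel))"
        unfolding c_def using E(2) by (subst nn_integral_real_affine[where c = E and t = 0]) simp_all
      also have "\<dots> = (\<integral>\<^sup>+ t. ennreal (E\<^sup>2) * ennreal \<bar>E\<bar> * (ennreal (1 / (E * t) ^ 3) * indicator {1..2} (E * t)) \<partial>lborel)"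
        by (subst nn_integral_cmult) (simp_all add: mult_ac)
      also have "\<dots> = (\<integral>\<^sup>+ t. ennreal (1 / t ^ 3) * indicator {1..2} (E * t) \<partial>lborel)"
      proof (rule nn_integral_cong)
        fix t :: real
        have "ennreal (E\<^sup>2) * ennreal \<bar>E\<bar> * ennreal (1 / (E * t) ^ 3) = ennreal (1 / t ^ 3)" if "E * t \<ge> 1"
        proof -
          have "t > 0" using that E(2) by (metis less_le_trans zero_less_mult_pos zero_less_one)
          then have "E\<^sup>2 * E * (1 / (E * t) ^ 3) = 1 / t ^ 3"
            using E(2) by (simp add: power2_eq_square power3_eq_cube field_simps)
          then show ?thesis using E(2) \<open>t > 0\<close> by (simp add: ennreal_mult[symmetric])
        qed
        then show "ennreal (E\<^sup>2) * ennreal \<bar>E\<bar> * (ennreal (1 / (E * t) ^ 3) * indicator {1..2} (E * t)) =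
          ennreal (1 / t ^ 3) * indicator {1..2} (E * t)"
          by (auto simp: indicator_def mult.assoc[symmetric])
      qed
      finally show ?thesis ..
    qed
    finally show ?thesis .
  qed
  have "(\<integral>\<^sup>+ x. F (\<nu> * fst x) * indicator {1..2} (E * snd x) \<partial>hyp_volume) =
      (\<integral>\<^sup>+ x. (\<lambda>x. F (fst x) * indicator {1..2} (snd x)) (poincare_ext (diag2 \<mu>) x) \<partial>hyp_volume)"
    using \<mu> by (simp add: poincare_ext_diag2 E)
  also have "\<dots> = (\<integral>\<^sup>+ x. F (fst x) * indicator {1..2} (snd x) \<partial>hyp_volume)"
    by (rule nn_integral_poincare_ext[OF det_diag2[OF \<mu>(2)]]) measurable
  finally have "c * (ennreal (E\<^sup>2) * (\<integral>\<^sup>+ z. F (\<nu> * z) \<partial>lborel)) = c * (\<integral>\<^sup>+ z. F z \<partial>lborel)"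
    unfolding 1 2 by (simp add: mult_ac)
  then show ?thesis using c unfolding E_def
    by (metis ennreal_mult_cancel_left infinity_ennreal_def)
qed

text \<open>For x = (z, t), its image (\<nu> z, E t) and y = (w, s), the new variables are the
  horizontal displacements of y from these two points. Since \<nu> differs from 1 they are
  independent coordinates.\<close>

lemma nn_integral_pair_change:
  fixes f :: "complex \<times> complex \<Rightarrow> ennreal"
  assumes \<nu>: "\<nu> \<noteq> 1" and [measurable]: "f \<in> borel_measurable borel"
  shows "ennreal ((cmod (\<nu> - 1))\<^sup>2) * (\<integral>\<^sup>+ z. \<integral>\<^sup>+ w. f (w - z, w - \<nu> * z) \<partial>lborel \<partial>lborel)
    = (\<integral>\<^sup>+ a. \<integral>\<^sup>+ b. f (a, b) \<partial>lborel \<partial>lborel)"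
proof -
  have m: "(\<lambda>x. f (g x, h x)) \<in> borel_measurable M"
    if "g \<in> borel_measurable M" "h \<in> borel_measurable M" for g h :: "'x \<Rightarrow> complex" and M
    by (rule measurable_compose[OF borel_measurable_Pair[OF that]]) simp
  have "(\<integral>\<^sup>+ z. \<integral>\<^sup>+ w. f (w - z, w - \<nu> * z) \<partial>lborel \<partial>lborel) = (\<integral>\<^sup>+ z. \<integral>\<^sup>+ a. f (a, a - (\<nu> - 1) * z) \<partial>lborel \<partial>lborel)"
  proof (rule nn_integral_cong)
    fix z :: complex
    have "(\<integral>\<^sup>+ w. f (w - z, w - \<nu> * z) \<partial>lborel) = (\<integral>\<^sup>+ a. f ((z + 1 *\<^sub>R a) - z, (z + 1 *\<^sub>R a) - \<nu> * z) \<partial>lborel)"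
      by (rule nn_integral_affine_reflect[symmetric]) (simp_all add: m)
    also have "\<dots> = (\<integral>\<^sup>+ a. f (a, a - (\<nu> - 1) * z) \<partial>lborel)"
      by (simp add: algebra_simps)
    finally show "(\<integral>\<^sup>+ w. f (w - z, w - \<nu> * z) \<partial>lborel) = (\<integral>\<^sup>+ a. f (a, a - (\<nu> - 1) * z) \<partial>lborel)" .
  qed
  also have "\<dots> = (\<integral>\<^sup>+ a. \<integral>\<^sup>+ z. f (a, a - (\<nu> - 1) * z) \<partial>lborel \<partial>lborel)"
    by (rule lborel_pair.Fubini') (simp add: case_prod_beta m)
  finally have "ennreal ((cmod (\<nu> - 1))\<^sup>2) * (\<integral>\<^sup>+ z. \<integral>\<^sup>+ w. f (w - z, w - \<nu> * z) \<partial>lborel \<partial>lborel)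
     = (\<integral>\<^sup>+ a. ennreal ((cmod (\<nu> - 1))\<^sup>2) * (\<integral>\<^sup>+ z. f (a, a - (\<nu> - 1) * z) \<partial>lborel) \<partial>lborel)"
    by (simp add: nn_integral_cmult[symmetric] m lborel.borel_measurable_nn_integral case_prod_beta)
  also have "\<dots> = (\<integral>\<^sup>+ a. \<integral>\<^sup>+ b. f (a, b) \<partial>lborel \<partial>lborel)"
  proof (rule nn_integral_cong)
    fix a :: complex
    have "ennreal ((cmod (\<nu> - 1))\<^sup>2) * (\<integral>\<^sup>+ z. f (a, a - (\<nu> - 1) * z) \<partial>lborel) = (\<integral>\<^sup>+ u. f (a, a - u) \<partial>lborel)"
      using \<nu> by (intro nn_integral_complex_mult) (simp_all add: m)
    also have "\<dots> = (\<integral>\<^sup>+ u. f (a, a + (-1) *\<^sub>R u) \<partial>lborel)" by simp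
    also have "\<dots> = (\<integral>\<^sup>+ b. f (a, b) \<partial>lborel)"
      by (rule nn_integral_affine_reflect) (simp_all add: m)
    finally show "ennreal ((cmod (\<nu> - 1))\<^sup>2) * (\<integral>\<^sup>+ z. f (a, a - (\<nu> - 1) * z) \<partial>lborel) = (\<integral>\<^sup>+ b. f (a, b) \<partial>lborel)" .
  qed
  finally show ?thesis .
qed

text \<open>The image of planar Lebesgue measure under the squared modulus is determined by the
  areas pi r of the discs of radius sqrt r.\<close>

lemma nn_integral_radial:
  fixes F :: "real \<Rightarrow> ennreal"
  assumes [measurable]: "F \<in> borel_measurable borel"
  shows "(\<integral>\<^sup>+ a. F ((cmod (a::complex))\<^sup>2) \<partial>lborel) = ennreal pi * (\<integral>\<^sup>+ \<alpha>. F \<alpha> * indicator {0..} \<alpha> \<partial>lborel)"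
proof -
  have [measurable]: "(\<lambda>a::complex. (cmod a)\<^sup>2) \<in> borel_measurable borel" by measurable
  have "distr lborel borel (\<lambda>a::complex. (cmod a)\<^sup>2) = density lborel (\<lambda>\<alpha>. ennreal pi * indicator {0..} \<alpha>)"
  proof (rule measure_eqI_generator_eq[where E = "range (\<lambda>r::real. {..r})" and \<Omega> = UNIV and A = "\<lambda>n. {..real n}"])
    show "Int_stable (range (\<lambda>r::real. {..r}))"
      by (rule Int_stableI) (auto simp: Int_atMost)
    have "sets borel = sigma_sets UNIV (range (\<lambda>r::real. {..r}))"
      by (subst borel_eq_atMost) simp
    then show "sets (distr lborel borel (\<lambda>a::complex. (cmod a)\<^sup>2)) = sigma_sets UNIV (range (\<lambda>r::real. {..r}))"
      "sets (density lborel (\<lambda>\<alpha>. ennreal pi * indicator {0..} \<alpha>)) = sigma_sets UNIV (range (\<lambda>r::real. {..r}))"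
      by simp_all
    have distr: "emeasure (distr lborel borel (\<lambda>a::complex. (cmod a)\<^sup>2)) {..r} = ennreal pi * ennreal r" for r
    proof (cases "r \<ge> 0")
      case True
      have "(\<lambda>a::complex. (cmod a)\<^sup>2) -` {..r} = cball 0 (sqrt r)"
      proof (rule Set.set_eqI)
        fix a :: complex
        have "(cmod a)\<^sup>2 \<le> r \<longleftrightarrow> sqrt ((cmod a)\<^sup>2) \<le> sqrt r" by (simp only: real_sqrt_le_iff)
        then show "a \<in> (\<lambda>a. (cmod a)\<^sup>2) -` {..r} \<longleftrightarrow> a \<in> cball 0 (sqrt r)" by simp
      qed
      then show ?thesis using True
        by (simp add: emeasure_distr emeasure_cball unit_ball_vol_2 ennreal_mult)
    next
      case False
      then have "(\<lambda>a::complex. (cmod a)\<^sup>2) -` {..r} = {}"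
      proof -
        have "r < (cmod a)\<^sup>2" for a :: complex
          using False zero_le_power2[of "cmod a"] by linarith
        then show ?thesis by (auto simp: not_le[symmetric])
      qed
      then show ?thesis using False by (simp add: emeasure_distr ennreal_neg)
    qed
    show "emeasure (distr lborel borel (\<lambda>a::complex. (cmod a)\<^sup>2)) X = emeasure (density lborel (\<lambda>\<alpha>. ennreal pi * indicator {0..} \<alpha>)) X"
      if "X \<in> range (\<lambda>r::real. {..r})" for X
    proof -
      obtain r where r: "X = {..r}" using \<open>X \<in> _\<close> by blast
      have "emeasure (density lborel (\<lambda>\<alpha>. ennreal pi * indicator {0..} \<alpha>)) {..r} = (\<integral>\<^sup>+ \<alpha>. ennreal pi * indicator {0..r} \<alpha> \<partial>lborel)"
        by (subst emeasure_density) (auto intro!: nn_integral_cong simp: indicator_def)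
      also have "\<dots> = ennreal pi * ennreal r"
        by (cases "r \<ge> 0") (simp_all add: nn_integral_cmult_indicator ennreal_neg)
      finally show ?thesis unfolding r distr ..
    qed
    show "(\<Union>n. {..real n}) = UNIV" using real_arch_simple by auto
    show "emeasure (distr lborel borel (\<lambda>a::complex. (cmod a)\<^sup>2)) {..real n} \<noteq> \<infinity>" for n
      unfolding distr by (simp add: ennreal_mult_eq_top_iff)
  qed auto
  then have "(\<integral>\<^sup>+ \<alpha>. F \<alpha> \<partial>distr lborel borel (\<lambda>a::complex. (cmod a)\<^sup>2)) = (\<integral>\<^sup>+ \<alpha>. F \<alpha> \<partial>density lborel (\<lambda>\<alpha>. ennreal pi * indicator {0..} \<alpha>))"
    by simp
  then show ?thesis
    by (simp add: nn_integral_distr nn_integral_density nn_integral_cmult[symmetric] mult_ac)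
qed

text \<open>The measure dx / x is invariant under x -> E / x, and so is the interval.\<close>

lemma nn_integral_inversion:
  fixes f :: "real \<Rightarrow> ennreal"
  assumes [measurable]: "f \<in> borel_measurable borel" and a: "0 < a" "a < E / a"
  shows "(\<integral>\<^sup>+ x. ennreal (1 / x) * f x * indicator {a..E / a} x \<partial>lborel) =
         (\<integral>\<^sup>+ x. ennreal (1 / x) * f (E / x) * indicator {a..E / a} x \<partial>lborel)"
proof -
  have E: "E > 0" using a by (metis less_trans zero_less_divide_iff not_less_iff_gr_or_eq)
  \<comment> \<open>Reflected to the negative axis, so that the substitution x -> - E / x is
    increasing.\<close>
  define h where "h u = ennreal (- 1 / u) * f (- u)" for u
  have [measurable]: "h \<in> borel_measurable borel" unfolding h_def by measurable
  have "(\<integral>\<^sup>+ x. ennreal (1 / x) * f x * indicator {a..E / a} x \<partial>lborel) =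
      (\<integral>\<^sup>+ u. h u * indicator {- (E / a)..- a} u \<partial>lborel)"
    by (subst nn_integral_affine_reflect[where t = 0 and c = "-1", symmetric])
      (auto intro!: nn_integral_cong simp: h_def indicator_def)
  also have "\<dots> = (\<integral>\<^sup>+ x. h (- (E / x)) * ennreal (E / x\<^sup>2) * indicator {a..E / a} x \<partial>lborel)"
  proof -
    have "(\<integral>\<^sup>+ u. h u * indicator {(\<lambda>x. - (E / x)) a..(\<lambda>x. - (E / x)) (E / a)} u \<partial>lborel) =
      (\<integral>\<^sup>+ x. h ((\<lambda>x. - (E / x)) x) * ennreal ((\<lambda>x. E / x\<^sup>2) x) * indicator {a..E / a} x \<partial>lborel)"
    proof (rule nn_integral_substitution_aux)
      show "((\<lambda>x. - (E / x)) has_real_derivative E / x\<^sup>2) (at x)" if "x \<in> {a..E / a}" for x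
        using that a by (auto intro!: derivative_eq_intros simp: power2_eq_square field_simps)
      show "continuous_on {a..E / a} (\<lambda>x. E / x\<^sup>2)"
        using a by (intro continuous_intros) auto
    qed (use a E in auto)
    then show ?thesis using a E by simp
  qed
  also have "\<dots> = (\<integral>\<^sup>+ x. ennreal (1 / x) * f (E / x) * indicator {a..E / a} x \<partial>lborel)"
  proof (rule nn_integral_cong)
    fix x :: real
    have "ennreal (x / E) * ennreal (E / x\<^sup>2) = ennreal (1 / x)" if "x \<ge> a"
      using that a E by (subst ennreal_mult[symmetric]) (auto simp: power2_eq_square)
    then have "x \<ge> a \<Longrightarrow> ennreal (x / E) * f (E / x) * ennreal (E / x\<^sup>2) = ennreal (1 / x) * f (E / x)"
      by (metis mult.assoc mult.commute)
    then show "h (- (E / x)) * ennreal (E / x\<^sup>2) * indicator {a..E / a} x = ennreal (1 / x) * f (E / x) * indicator {a..E / a} x"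
      by (auto simp: h_def indicator_def)
  qed
  finally show ?thesis .
qed

section \<open>The contribution of a loxodromic element\<close>

text \<open>The integral of C - c over c from m to C, and zero when m exceeds C.\<close>

definition mom0 :: "real \<Rightarrow> real \<Rightarrow> real" where
  "mom0 C m = (max 0 (C - m))\<^sup>2 / 2"

text \<open>The integral of c (C - c) over the same range, written as mass times centroid. The
  centroid (C + 2 m) / 3 is what the comparison of levels works with.\<close>

definition mom1 :: "real \<Rightarrow> real \<Rightarrow> real" where
  "mom1 C m = mom0 C m * ((C + 2 * m) / 3)"

lemma mom0_nonneg [simp]: "mom0 C m \<ge> 0"
  by (simp add: mom0_def)

lemma mom0_eq_0: "C \<le> m \<Longrightarrow> mom0 C m = 0"
  by (simp add: mom0_def)

lemma mom1_ge: "m * mom0 C m \<le> mom1 C m"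
proof (cases "m \<le> C")
  case True
  then have "mom0 C m * m \<le> mom0 C m * ((C + 2 * m) / 3)" by (intro mult_left_mono) auto
  then show ?thesis by (simp add: mom1_def mult.commute)
qed (simp add: mom1_def mom0_eq_0)

lemma nn_integral_moment:
  assumes k: "k > 0" and nonneg: "\<And>c. m \<le> c \<Longrightarrow> c \<le> C \<Longrightarrow> 0 \<le> u + v * c"
  shows "(\<integral>\<^sup>+ \<alpha>. ennreal (max 0 (C - (m + \<alpha> / k)) * (u + v * (m + \<alpha> / k))) * indicator {0..} \<alpha> \<partial>lborel)
    = ennreal (k * (u * mom0 C m + v * mom1 C m))"
proof (cases "m \<le> C")
  case True
  define A where "A c = C * u * c + (C * v - u) * c\<^sup>2 / 2 - v * c ^ 3 / 3" for c
  have b: "m + \<alpha> / k \<le> C \<longleftrightarrow> \<alpha> \<le> k * (C - m)" for \<alpha>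
    using k by (simp add: field_simps)
  have "(\<integral>\<^sup>+ \<alpha>. ennreal (max 0 (C - (m + \<alpha> / k)) * (u + v * (m + \<alpha> / k))) * indicator {0..} \<alpha> \<partial>lborel) =
     (\<integral>\<^sup>+ \<alpha>. ennreal ((C - (m + \<alpha> / k)) * (u + v * (m + \<alpha> / k))) * indicator {0..k * (C - m)} \<alpha> \<partial>lborel)"
    by (rule nn_integral_cong) (auto simp: indicator_def max_def b not_le)
  also have "\<dots> = ennreal (k * A (m + k * (C - m) / k) - k * A (m + 0 / k))"
  proof (rule nn_integral_FTC_Icc)
    fix \<alpha> assume \<alpha>: "\<alpha> \<in> {0..k * (C - m)}"
    have "(A has_real_derivative (C - c) * (u + v * c)) (at c)" for c
      unfolding A_def by (auto intro!: derivative_eq_intros simp: power2_eq_square field_simps)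
    then have "((\<lambda>\<alpha>. A (m + \<alpha> / k)) has_real_derivative (C - (m + \<alpha> / k)) * (u + v * (m + \<alpha> / k)) * (1 / k)) (at \<alpha>)"
      by (rule DERIV_chain2) (use k in \<open>auto intro!: derivative_eq_intros\<close>)
    from DERIV_cmult[OF this, of k]
    show "((\<lambda>\<alpha>. k * A (m + \<alpha> / k)) has_real_derivative (C - (m + \<alpha> / k)) * (u + v * (m + \<alpha> / k))) (at \<alpha>)"
      using k by simp
    have "0 \<le> C - (m + \<alpha> / k)" using \<alpha> b by simp
    moreover have "m \<le> m + \<alpha> / k" using \<alpha> k by simp
    ultimately show "0 \<le> (C - (m + \<alpha> / k)) * (u + v * (m + \<alpha> / k))"
      by (intro mult_nonneg_nonneg nonneg) auto
  qed (use True k in auto)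
  also have "k * A (m + k * (C - m) / k) - k * A (m + 0 / k) = k * (A C - A m)"
  proof -
    have "m + k * (C - m) / k = C" "m + 0 / k = m" using k by simp_all
    then show ?thesis by (simp only: right_diff_distrib)
  qed
  also have "A C - A m = u * mom0 C m + v * mom1 C m"
  proof -
    have e: "mom0 C m = (C - m)\<^sup>2 / 2" using True by (simp add: mom0_def)
    show ?thesis unfolding A_def mom1_def e by (simp add: power2_eq_square power3_eq_cube field_simps)
  qed
  finally show ?thesis .
next
  case False
  have "max 0 (C - (m + \<alpha> / k)) = 0" if "\<alpha> \<ge> 0" for \<alpha>
  proof -
    have "0 \<le> \<alpha> / k" using that k by simp
    then show ?thesis using False by simp
  qed
  then have "(\<integral>\<^sup>+ \<alpha>. ennreal (max 0 (C - (m + \<alpha> / k)) * (u + v * (m + \<alpha> / k))) * indicator {0..} \<alpha> \<partial>lborel) = (\<integral>\<^sup>+ (\<alpha>::real). 0 \<partial>lborel)"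
    by (intro nn_integral_cong) (auto simp: indicator_def)
  then show ?thesis using False by (simp add: mom1_def mom0_eq_0)
qed

text \<open>The two sign hypotheses keep the argument of \<open>ennreal\<close> nonnegative, in the
  integrand and after the inner integration, so that coefficients of either sign can be integrated
  termwise.\<close>

lemma nn_integral_moment2:
  assumes k: "k > 0" "k' > 0"
    and nonneg: "\<And>c c'. m \<le> c \<Longrightarrow> c \<le> C \<Longrightarrow> m' \<le> c' \<Longrightarrow> c' \<le> C \<Longrightarrow> 0 \<le> (u + v * c) + (u' + v' * c) * c'"
    and nonneg': "\<And>c. m \<le> c \<Longrightarrow> c \<le> C \<Longrightarrow> 0 \<le> (u + v * c) * mom0 C m' + (u' + v' * c) * mom1 C m'"
  shows "(\<integral>\<^sup>+ \<alpha>. (\<integral>\<^sup>+ \<beta>. ennreal (max 0 (C - (m + \<alpha> / k)) * max 0 (C - (m' + \<beta> / k')) *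
      ((u + v * (m + \<alpha> / k)) + (u' + v' * (m + \<alpha> / k)) * (m' + \<beta> / k'))) * indicator {0..} \<beta> \<partial>lborel) * indicator {0..} \<alpha> \<partial>lborel)
    = ennreal (k * k' * (u * mom0 C m * mom0 C m' + v * mom1 C m * mom0 C m' + u' * mom0 C m * mom1 C m' + v' * mom1 C m * mom1 C m'))"
proof -
  let ?U = "u * mom0 C m' + u' * mom1 C m'" and ?V = "v * mom0 C m' + v' * mom1 C m'"
  have "(\<integral>\<^sup>+ \<alpha>. (\<integral>\<^sup>+ \<beta>. ennreal (max 0 (C - (m + \<alpha> / k)) * max 0 (C - (m' + \<beta> / k')) *
      ((u + v * (m + \<alpha> / k)) + (u' + v' * (m + \<alpha> / k)) * (m' + \<beta> / k'))) * indicator {0..} \<beta> \<partial>lborel) * indicator {0..} \<alpha> \<partial>lborel)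
    = (\<integral>\<^sup>+ \<alpha>. ennreal (max 0 (C - (m + \<alpha> / k)) * (k' * ?U + k' * ?V * (m + \<alpha> / k))) * indicator {0..} \<alpha> \<partial>lborel)"
  proof (rule nn_integral_cong)
    fix \<alpha> :: real
    let ?c = "m + \<alpha> / k"
    show "(\<integral>\<^sup>+ \<beta>. ennreal (max 0 (C - ?c) * max 0 (C - (m' + \<beta> / k')) *
        ((u + v * ?c) + (u' + v' * ?c) * (m' + \<beta> / k'))) * indicator {0..} \<beta> \<partial>lborel) * indicator {0..} \<alpha> =
      ennreal (max 0 (C - ?c) * (k' * ?U + k' * ?V * ?c)) * indicator {0..} \<alpha>"
    proof (cases "\<alpha> \<ge> 0 \<and> ?c \<le> C")
      case True
      then have c: "m \<le> ?c" "?c \<le> C" using k by auto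
      have "(\<integral>\<^sup>+ \<beta>. ennreal (max 0 (C - ?c) * max 0 (C - (m' + \<beta> / k')) *
        ((u + v * ?c) + (u' + v' * ?c) * (m' + \<beta> / k'))) * indicator {0..} \<beta> \<partial>lborel) =
        (\<integral>\<^sup>+ \<beta>. ennreal (max 0 (C - ?c)) * (ennreal (max 0 (C - (m' + \<beta> / k')) *
        ((u + v * ?c) + (u' + v' * ?c) * (m' + \<beta> / k'))) * indicator {0..} \<beta>) \<partial>lborel)"
        by (rule nn_integral_cong) (simp add: ennreal_mult'[symmetric] mult.assoc[symmetric])
      also have "\<dots> = ennreal (max 0 (C - ?c)) * ennreal (k' * ((u + v * ?c) * mom0 C m' + (u' + v' * ?c) * mom1 C m'))"
        by (subst nn_integral_cmult, measurable, subst nn_integral_moment) (use k c nonneg in auto)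
      also have "\<dots> = ennreal (max 0 (C - ?c) * (k' * ((u + v * ?c) * mom0 C m' + (u' + v' * ?c) * mom1 C m')))"
        by (rule ennreal_mult'[symmetric]) simp
      also have "k' * ((u + v * ?c) * mom0 C m' + (u' + v' * ?c) * mom1 C m') = k' * ?U + k' * ?V * ?c"
        by (simp add: algebra_simps)
      finally show ?thesis by simp
    next
      case False
      then show ?thesis by (auto simp: indicator_def)
    qed
  qed
  also have "\<dots> = ennreal (k * (k' * ?U * mom0 C m + k' * ?V * mom1 C m))"
  proof (rule nn_integral_moment[OF k(1)])
    fix c assume c: "m \<le> c" "c \<le> C"
    have "k' * ?U + k' * ?V * c = k' * ((u + v * c) * mom0 C m' + (u' + v' * c) * mom1 C m')"
      by (simp add: algebra_simps)
    then show "0 \<le> k' * ?U + k' * ?V * c" using nonneg'[OF c] k by simp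
  qed
  also have "k * (k' * ?U * mom0 C m + k' * ?V * mom1 C m) =
      k * k' * (u * mom0 C m * mom0 C m' + v * mom1 C m * mom0 C m' + u' * mom0 C m * mom1 C m' + v' * mom1 C m * mom1 C m')"
    by (simp add: algebra_simps)
  finally show ?thesis .
qed

text \<open>The change of variables at fixed heights s of y and t of x. Afterwards the distances
  from y to x and to its image depend on the separate variables a and b.\<close>

lemma strip_integral:
  fixes g :: "real \<Rightarrow> real \<Rightarrow> complex \<Rightarrow> complex \<Rightarrow> ennreal"
  assumes \<nu>: "\<nu> \<noteq> 1" and g: "(\<lambda>(s, t, a, b). g s t a b) \<in> borel_measurable borel"
  shows "ennreal ((cmod (\<nu> - 1))\<^sup>2) *
      (\<integral>\<^sup>+ x. (\<integral>\<^sup>+ y. g (snd y) (snd x) (fst y - fst x) (fst y - \<nu> * fst x) \<partial>hyp_volume) * indicator {1..<E} (snd x) \<partial>hyp_volume)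
    = (\<integral>\<^sup>+ t. ennreal (1 / t ^ 3) * indicator {0<..} t * indicator {1..<E} t *
        (\<integral>\<^sup>+ s. ennreal (1 / s ^ 3) * indicator {0<..} s * (\<integral>\<^sup>+ a. \<integral>\<^sup>+ b. g s t a b \<partial>lborel \<partial>lborel) \<partial>lborel) \<partial>lborel)"
proof -
  have m [measurable (raw)]: "(\<lambda>x. g (p x) (q x) (h x) (k x)) \<in> borel_measurable M"
    if "p \<in> borel_measurable M" "q \<in> borel_measurable M" "h \<in> borel_measurable M" "k \<in> borel_measurable M"
    for p q h k and M :: "'x measure"
  proof -
    have "(\<lambda>x. (p x, q x, h x, k x)) \<in> borel_measurable M"
      by (intro borel_measurable_Pair that)
    from measurable_compose[OF this g] show ?thesis by simp
  qed
  have [measurable]: "(\<lambda>x::complex\<times>real. indicator {1..<E} (snd x) :: ennreal) \<in> borel_measurable borel"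
    by (rule measurable_compose[OF borel_measurable_snd_pair]) simp
  have mp: "(\<lambda>y::complex\<times>real. g (snd y) t (fst y - z) (fst y - \<nu> * z)) \<in> borel_measurable borel" for t z
    by (intro m borel_measurable_continuous_onI continuous_intros)
  let ?w = "\<lambda>s::real. ennreal (1 / s ^ 3) * indicator {0<..} s"
  let ?J = "\<lambda>t z. \<integral>\<^sup>+ s. ?w s * (\<integral>\<^sup>+ w. g s t (w - z) (w - \<nu> * z) \<partial>lborel) \<partial>lborel"
  let ?n = "ennreal ((cmod (\<nu> - 1))\<^sup>2)"
  have "(\<lambda>(z, t). ?J t z * indicator {1..<E} t)
      \<in> borel_measurable (borel \<Otimes>\<^sub>M borel)" by measurable
  then have mx: "(\<lambda>x. ?J (snd x) (fst x) * indicator {1..<E} (snd x))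
      \<in> borel_measurable borel" by (simp add: borel_prod case_prod_beta)
  have y: "(\<integral>\<^sup>+ y. g (snd y) t (fst y - z) (fst y - \<nu> * z) \<partial>hyp_volume)
      = ?J t z" for t z
    by (subst nn_integral_hyp_iterated[OF mp]) simp
  have "(\<integral>\<^sup>+ x. (\<integral>\<^sup>+ y. g (snd y) (snd x) (fst y - fst x) (fst y - \<nu> * fst x) \<partial>hyp_volume) * indicator {1..<E} (snd x) \<partial>hyp_volume)
    = (\<integral>\<^sup>+ x. ?J (snd x) (fst x) * indicator {1..<E} (snd x) \<partial>hyp_volume)"
    by (simp add: y)
  also have "\<dots> = (\<integral>\<^sup>+ t. ?w t * (\<integral>\<^sup>+ z. ?J t z * indicator {1..<E} t \<partial>lborel) \<partial>lborel)"
    by (subst nn_integral_hyp_iterated[OF mx]) simp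
  also have "\<dots> = (\<integral>\<^sup>+ t. ?w t * indicator {1..<E} t * (\<integral>\<^sup>+ z. ?J t z \<partial>lborel) \<partial>lborel)"
  proof (rule nn_integral_cong)
    fix t :: real
    have "(\<integral>\<^sup>+ z. ?J t z * indicator {1..<E} t \<partial>lborel) =
      (\<integral>\<^sup>+ z. ?J t z \<partial>lborel) * indicator {1..<E} t"
      by (rule nn_integral_multc) measurable
    then show "?w t * (\<integral>\<^sup>+ z. ?J t z * indicator {1..<E} t \<partial>lborel) =
      ?w t * indicator {1..<E} t * (\<integral>\<^sup>+ z. ?J t z \<partial>lborel)"
      by (simp only: mult_ac)
  qed
  finally have 1: "(\<integral>\<^sup>+ x. (\<integral>\<^sup>+ y. g (snd y) (snd x) (fst y - fst x) (fst y - \<nu> * fst x) \<partial>hyp_volume) * indicator {1..<E} (snd x) \<partial>hyp_volume)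
    = (\<integral>\<^sup>+ t. ?w t * indicator {1..<E} t * (\<integral>\<^sup>+ z. ?J t z \<partial>lborel) \<partial>lborel)" .
  have 2: "?n * (\<integral>\<^sup>+ z. ?J t z \<partial>lborel) =
      (\<integral>\<^sup>+ s. ?w s * (\<integral>\<^sup>+ a. \<integral>\<^sup>+ b. g s t a b \<partial>lborel \<partial>lborel) \<partial>lborel)" for t
  proof -
    have "(\<integral>\<^sup>+ z. ?J t z \<partial>lborel) =
      (\<integral>\<^sup>+ s. (\<integral>\<^sup>+ z. ?w s * (\<integral>\<^sup>+ w. g s t (w - z) (w - \<nu> * z) \<partial>lborel) \<partial>lborel) \<partial>lborel)"
      by (rule lborel_pair.Fubini') measurable
    then have "?n * (\<integral>\<^sup>+ z. ?J t z \<partial>lborel) =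
      ?n * (\<integral>\<^sup>+ s. (\<integral>\<^sup>+ z. ?w s * (\<integral>\<^sup>+ w. g s t (w - z) (w - \<nu> * z) \<partial>lborel) \<partial>lborel) \<partial>lborel)"
      by (rule arg_cong)
    also have "\<dots> = (\<integral>\<^sup>+ s. ?n * (\<integral>\<^sup>+ z. ?w s * (\<integral>\<^sup>+ w. g s t (w - z) (w - \<nu> * z) \<partial>lborel) \<partial>lborel) \<partial>lborel)"
      by (rule nn_integral_cmult[symmetric]) measurable
    also have "\<dots> = (\<integral>\<^sup>+ s. ?w s * (\<integral>\<^sup>+ a. \<integral>\<^sup>+ b. g s t a b \<partial>lborel \<partial>lborel) \<partial>lborel)"
    proof (rule nn_integral_cong)
      fix s :: real
      have "?n * (\<integral>\<^sup>+ z. \<integral>\<^sup>+ w. g s t (w - z) (w - \<nu> * z) \<partial>lborel \<partial>lborel) = (\<integral>\<^sup>+ a. \<integral>\<^sup>+ b. g s t a b \<partial>lborel \<partial>lborel)"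
      proof -
        have "(\<lambda>ab. g s t (fst ab) (snd ab)) \<in> borel_measurable borel"
          by (intro m borel_measurable_continuous_onI continuous_intros)
        from nn_integral_pair_change[OF \<nu> this] show ?thesis by simp
      qed
      moreover have "(\<integral>\<^sup>+ z. ?w s * (\<integral>\<^sup>+ w. g s t (w - z) (w - \<nu> * z) \<partial>lborel) \<partial>lborel) = ?w s * (\<integral>\<^sup>+ z. \<integral>\<^sup>+ w. g s t (w - z) (w - \<nu> * z) \<partial>lborel \<partial>lborel)"
        by (rule nn_integral_cmult) measurable
      ultimately show "?n * (\<integral>\<^sup>+ z. ?w s * (\<integral>\<^sup>+ w. g s t (w - z) (w - \<nu> * z) \<partial>lborel) \<partial>lborel) = ?w s * (\<integral>\<^sup>+ a. \<integral>\<^sup>+ b. g s t a b \<partial>lborel \<partial>lborel)"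
        by (simp only: mult.left_commute[of ?n])
    qed
    finally show ?thesis .
  qed
  have "?n * (\<integral>\<^sup>+ t. ?w t * indicator {1..<E} t * (\<integral>\<^sup>+ z. ?J t z \<partial>lborel) \<partial>lborel) =
    (\<integral>\<^sup>+ t. ?n * (?w t * indicator {1..<E} t * (\<integral>\<^sup>+ z. ?J t z \<partial>lborel)) \<partial>lborel)"
    by (rule nn_integral_cmult[symmetric]) measurable
  also have "\<dots> = (\<integral>\<^sup>+ t. ?w t * indicator {1..<E} t * (\<integral>\<^sup>+ s. ?w s * (\<integral>\<^sup>+ a. \<integral>\<^sup>+ b. g s t a b \<partial>lborel \<partial>lborel) \<partial>lborel) \<partial>lborel)"
    by (rule nn_integral_cong, subst 2[symmetric], rule mult.left_commute)
  finally show ?thesis unfolding 1 .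
qed

text \<open>Truncating each summand at 0 can only enlarge the sum. This serves for
  \<open>levelQ\<close>, whose sign is left undetermined.\<close>

lemma ennreal_add_le: "ennreal (a + b) \<le> ennreal a + ennreal b"
proof -
  have "ennreal (a + b) \<le> ennreal (max 0 a + max 0 b)" by (rule ennreal_leI) simp
  also have "\<dots> = ennreal (max 0 a) + ennreal (max 0 b)" by simp
  also have "\<dots> = ennreal a + ennreal b" by (simp add: max_def ennreal_neg)
  finally show ?thesis .
qed

text \<open>What remains of \<open>kerP\<close> at a fixed ratio \<sigma> of the heights of y and x.
  The arguments of the moments are the least values of \<open>hcosh\<close> between the height of y
  and those of x and of its image.\<close>

definition levelP :: "real \<Rightarrow> real \<Rightarrow> real \<Rightarrow> real \<Rightarrow> real" where
  "levelP \<kappa> C E \<sigma> = mom0 C ((\<sigma> + 1 / \<sigma>) / 2) * mom0 C ((\<sigma> / E + E / \<sigma>) / 2) +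
     \<kappa> * mom1 C ((\<sigma> + 1 / \<sigma>) / 2) * mom1 C ((\<sigma> / E + E / \<sigma>) / 2)"

text \<open>Averaged over the sign of a, the cosine between x and its image becomes \<sigma> c' +
  (\<sigma> / E) c - \<sigma> (\<sigma> / E), where c and c' are the cosines from y to the two
  points; here it is integrated against both weights.\<close>

definition levelQ :: "real \<Rightarrow> real \<Rightarrow> real \<Rightarrow> real \<Rightarrow> real" where
  "levelQ \<kappa> C E \<sigma> = \<kappa> * (\<sigma> / E * mom1 C ((\<sigma> + 1 / \<sigma>) / 2) * mom0 C ((\<sigma> / E + E / \<sigma>) / 2) +
     \<sigma> * mom0 C ((\<sigma> + 1 / \<sigma>) / 2) * mom1 C ((\<sigma> / E + E / \<sigma>) / 2) -
     \<sigma> * (\<sigma> / E) * mom0 C ((\<sigma> + 1 / \<sigma>) / 2) * mom0 C ((\<sigma> / E + E / \<sigma>) / 2))"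

text \<open>The symmetrised level inequality divided by the masses \<open>mom0\<close>, with S = E /
  \<sigma>. The number 18 is 2 * 3^2, the threes being the denominators of the two centroids.
  Outside the stated range a mass vanishes.\<close>

definition sign_condition :: "real \<Rightarrow> real \<Rightarrow> real \<Rightarrow> bool" where
  "sign_condition \<kappa> C E \<longleftrightarrow> (\<forall>\<sigma> S. 0 < \<sigma> \<longrightarrow> 0 < S \<longrightarrow> \<sigma> < 2 * C \<longrightarrow> S < 2 * C \<longrightarrow> \<sigma> * S = E \<longrightarrow>
     18 \<le> \<kappa> * ((2 * \<sigma> - C - 1 / \<sigma>) * (S + C - 2 / S) + (2 * S - C - 1 / S) * (\<sigma> + C - 2 / \<sigma>)))"

text \<open>The leading terms 4 E + C (\<sigma> + S) - 2 C^2 are at least 27/8 r^2 = 54/25 C^2 by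
  the inequality of the means. Required is 18 / kappa = 36/17 C^2, and r >= 32 lets the difference
  absorb the remaining loss 125/2.\<close>

lemma sign_condition:
  assumes r: "r \<ge> 32" and C: "C = 5 / 4 * r" and E: "E \<ge> r\<^sup>2"
  shows "sign_condition (17 / (2 * C\<^sup>2)) C E"
  unfolding sign_condition_def
proof (intro allI impI)
  fix \<sigma> S assume pos: "0 < \<sigma>" "0 < S" and lt: "\<sigma> < 2 * C" "S < 2 * C" and SE: "\<sigma> * S = E"
  define i j where "i = 1 / \<sigma>" "j = 1 / S"
  have Epos: "E > 0" using pos SE by auto
  \<comment> \<open>As 2 C = 5/2 r and r^2 <= x y, the first factor of E is at most 25/4 times the
    second.\<close>
  have quot: "x / y \<le> 25 / 4" if "0 < x" "0 < y" "x < 2 * C" "x * y = E" for x y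
  proof -
    have "x * x \<le> (2 * C) * (2 * C)" using that by (intro mult_mono) auto
    also have "\<dots> = 25 / 4 * r\<^sup>2" by (simp add: C power2_eq_square)
    also have "\<dots> \<le> 25 / 4 * (x * y)" using E that by simp
    finally have "x * x \<le> x * (25 / 4 * y)" by (simp add: mult_ac)
    then have "x \<le> 25 / 4 * y" using that by (simp add: mult_le_cancel_left_pos)
    then show ?thesis using that by (simp add: divide_le_eq)
  qed
  have q: "\<sigma> * j \<le> 25 / 4" "S * i \<le> 25 / 4"
    using quot[of \<sigma> S] quot[of S \<sigma>] pos lt SE by (simp_all add: i_j_def mult.commute)
  have "(2 * \<sigma> - C - i) * (S + C - 2 * j) + (2 * S - C - j) * (\<sigma> + C - 2 * i) =
    4 * (\<sigma> * S) + C * (\<sigma> + S) - 2 * C\<^sup>2 - 5 * (\<sigma> * j) - 5 * (S * i) + C * (i + j) + 4 * (i * j)"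
    by (simp add: algebra_simps power2_eq_square)
  moreover have "C * (2 * r) \<le> C * (\<sigma> + S)"
  proof (intro mult_left_mono)
    have "(2 * r)\<^sup>2 \<le> 4 * (\<sigma> * S)" using E SE by (simp add: power2_eq_square)
    also have "\<dots> \<le> (\<sigma> + S)\<^sup>2" using sum_squares_bound[of \<sigma> S] by (simp add: power2_eq_square algebra_simps)
    finally show "2 * r \<le> \<sigma> + S" by (rule power2_le_imp_le) (use pos in simp)
  qed (use C r in simp)
  moreover have "0 \<le> C * (i + j)" "0 \<le> i * j" using pos C r by (simp_all add: i_j_def)
  moreover have "4 * r\<^sup>2 \<le> 4 * (\<sigma> * S)" using E SE by simp
  ultimately have "4 * r\<^sup>2 + C * (2 * r) - 2 * C\<^sup>2 - 125 / 2 \<le>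
    (2 * \<sigma> - C - i) * (S + C - 2 * j) + (2 * S - C - j) * (\<sigma> + C - 2 * i)"
    using q by linarith
  moreover have "36 / 17 * C\<^sup>2 \<le> 4 * r\<^sup>2 + C * (2 * r) - 2 * C\<^sup>2 - 125 / 2"
  proof -
    have "32 * 32 \<le> r * r" using r by (intro mult_mono) auto
    then show ?thesis by (simp add: C power2_eq_square)
  qed
  ultimately have *: "36 / 17 * C\<^sup>2 \<le> (2 * \<sigma> - C - i) * (S + C - 2 * j) + (2 * S - C - j) * (\<sigma> + C - 2 * i)"
    by linarith
  have "C > 0" using C r by simp
  then have "18 = 17 / (2 * C\<^sup>2) * (36 / 17 * C\<^sup>2)" by simp
  also have "\<dots> \<le> 17 / (2 * C\<^sup>2) * ((2 * \<sigma> - C - i) * (S + C - 2 * j) + (2 * S - C - j) * (\<sigma> + C - 2 * i))"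
    using * by (rule mult_left_mono) simp
  finally show "18 \<le> 17 / (2 * C\<^sup>2) * ((2 * \<sigma> - C - 1 / \<sigma>) * (S + C - 2 / S) + (2 * S - C - 1 / S) * (\<sigma> + C - 2 / \<sigma>))"
    by (simp add: i_j_def)
qed

text \<open>\<open>hcosh\<close> as a function of the two heights and the squared horizontal
  displacement, in which it is affine.\<close>

definition hc :: "real \<Rightarrow> real \<Rightarrow> real \<Rightarrow> real" where
  "hc s t \<alpha> = (s / t + t / s) / 2 + \<alpha> / (2 * s * t)"

lemma hcosh_hc:
  assumes "y \<in> H3" "x \<in> H3"
  shows "hcosh y x = hc (snd y) (snd x) ((cmod (fst y - fst x))\<^sup>2)"
  using assms by (simp add: hcosh_eq hc_def H3_iff field_simps power2_eq_square)

lemma hc_measurable [measurable (raw)]: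
  assumes "f \<in> borel_measurable M" "g \<in> borel_measurable M" "h \<in> borel_measurable M"
  shows "(\<lambda>x. hc (f x) (g x) (h x)) \<in> borel_measurable M"
  unfolding hc_def using assms by measurable

lemma nn_integral_radial2:
  fixes f :: "real \<Rightarrow> real \<Rightarrow> ennreal"
  assumes f: "(\<lambda>(\<alpha>, \<beta>). f \<alpha> \<beta>) \<in> borel_measurable (borel \<Otimes>\<^sub>M borel)"
  shows "(\<integral>\<^sup>+ a. \<integral>\<^sup>+ b. f ((cmod a)\<^sup>2) ((cmod b)\<^sup>2) \<partial>lborel \<partial>lborel) =
    ennreal (pi\<^sup>2) * (\<integral>\<^sup>+ \<alpha>. (\<integral>\<^sup>+ \<beta>. f \<alpha> \<beta> * indicator {0..} \<beta> \<partial>lborel) * indicator {0..} \<alpha> \<partial>lborel)"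
proof -
  note [measurable] = f
  have "(\<integral>\<^sup>+ a. \<integral>\<^sup>+ b. f ((cmod a)\<^sup>2) ((cmod b)\<^sup>2) \<partial>lborel \<partial>lborel) =
    (\<integral>\<^sup>+ a. ennreal pi * (\<integral>\<^sup>+ \<beta>. f ((cmod a)\<^sup>2) \<beta> * indicator {0..} \<beta> \<partial>lborel) \<partial>lborel)"
    by (rule nn_integral_cong, rule nn_integral_radial) measurable
  also have "\<dots> = ennreal pi * (\<integral>\<^sup>+ \<alpha>. ennreal pi * (\<integral>\<^sup>+ \<beta>. f \<alpha> \<beta> * indicator {0..} \<beta> \<partial>lborel) * indicator {0..} \<alpha> \<partial>lborel)"
    by (rule nn_integral_radial) measurable
  also have "(\<integral>\<^sup>+ \<alpha>. ennreal pi * (\<integral>\<^sup>+ \<beta>. f \<alpha> \<beta> * indicator {0..} \<beta> \<partial>lborel) * indicator {0..} \<alpha> \<partial>lborel)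
    = ennreal pi * (\<integral>\<^sup>+ \<alpha>. (\<integral>\<^sup>+ \<beta>. f \<alpha> \<beta> * indicator {0..} \<beta> \<partial>lborel) * indicator {0..} \<alpha> \<partial>lborel)"
    unfolding mult.assoc by (rule nn_integral_cmult) measurable
  finally show ?thesis by (simp add: power2_eq_square ennreal_mult mult.assoc)
qed

section \<open>Comparison of the two kernels for one multiplier modulus E\<close>

context
  fixes \<kappa> C E :: real
  assumes \<kappa>: "\<kappa> \<ge> 0" and C: "C \<ge> 1" and E: "E > 1" and sign: "sign_condition \<kappa> C E"
begin

lemma levelP_nonneg:
  assumes "\<sigma> > 0" shows "levelP \<kappa> C E \<sigma> \<ge> 0"
proof -
  have "mom1 C m \<ge> 0" if "m \<ge> 0" for m
    using that C by (auto simp: mom1_def intro!: mult_nonneg_nonneg)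
  then show ?thesis using assms \<kappa> E unfolding levelP_def
    by (intro add_nonneg_nonneg mult_nonneg_nonneg) auto
qed

text \<open>With c and c' the centroids and common masses removed, \<open>levelQ\<close> minus
  \<open>levelP\<close> is \<open>\<kappa> * (\<sigma> - c) * (c' - 1 / S) - 1\<close> at \<sigma>,
  and the same with the roles exchanged at S. One of the two can be negative, for instance when
  \<sigma> is below C / 2; \<open>sign\<close> controls their sum.\<close>

lemma level_sym:
  assumes \<sigma>: "\<sigma> > 0"
  shows "levelP \<kappa> C E \<sigma> + levelP \<kappa> C E (E / \<sigma>) \<le> levelQ \<kappa> C E \<sigma> + levelQ \<kappa> C E (E / \<sigma>)"
proof -
  define S where "S = E / \<sigma>"
  have S: "S > 0" "\<sigma> * S = E" using \<sigma> E by (auto simp: S_def)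
  define m m' where "m = (\<sigma> + 1 / \<sigma>) / 2" "m' = (S + 1 / S) / 2"
  define M M' where "M = mom0 C m" "M' = mom0 C m'"
  define c c' where "c = (C + 2 * m) / 3" "c' = (C + 2 * m') / 3"
  have q: "\<sigma> / E = 1 / S" "E / \<sigma> = S" "S / E = 1 / \<sigma>" "E / S = \<sigma>" using S \<sigma> by (auto simp: field_simps)
  have mm: "(\<sigma> / E + E / \<sigma>) / 2 = m'" "(S / E + E / S) / 2 = m"
    unfolding q by (simp_all add: m_m'_def)
  have ex: "levelP \<kappa> C E \<sigma> = M * M' * (1 + \<kappa> * (c * c'))" "levelP \<kappa> C E S = M * M' * (1 + \<kappa> * (c * c'))"
    "levelQ \<kappa> C E \<sigma> = M * M' * (\<kappa> * (c / S + \<sigma> * c' - \<sigma> / S))"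
    "levelQ \<kappa> C E S = M * M' * (\<kappa> * (c' / \<sigma> + S * c - S / \<sigma>))"
  proof -
    have e: "mom1 C m = M * c" "mom1 C m' = M' * c'" by (simp_all add: mom1_def M_M'_def c_c'_def)
    show "levelP \<kappa> C E \<sigma> = M * M' * (1 + \<kappa> * (c * c'))" "levelP \<kappa> C E S = M * M' * (1 + \<kappa> * (c * c'))"
      "levelQ \<kappa> C E \<sigma> = M * M' * (\<kappa> * (c / S + \<sigma> * c' - \<sigma> / S))"
      "levelQ \<kappa> C E S = M * M' * (\<kappa> * (c' / \<sigma> + S * c - S / \<sigma>))"
      unfolding levelP_def levelQ_def mm unfolding q m_m'_def(1)[symmetric] m_m'_def(2)[symmetric] e M_M'_def[symmetric]
      by (simp_all add: algebra_simps)
  qed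
  show ?thesis
  proof (cases "m < C \<and> m' < C")
    case True
    have lt: "\<sigma> < 2 * C" "S < 2 * C"
    proof -
      have "x < 2 * C" if x: "0 < x" "(x + 1 / x) / 2 < C" for x
      proof -
        have "0 < 1 / x" using x by simp
        moreover have "x + 1 / x < 2 * C" using x by simp
        ultimately show ?thesis by linarith
      qed
      then show "\<sigma> < 2 * C" "S < 2 * C" using True \<sigma> S by (simp_all add: m_m'_def)
    qed
    have "18 \<le> \<kappa> * ((2 * \<sigma> - C - 1 / \<sigma>) * (S + C - 2 / S) + (2 * S - C - 1 / S) * (\<sigma> + C - 2 / \<sigma>))"
      using sign \<sigma> S lt unfolding sign_condition_def by blast
    also have "(2 * \<sigma> - C - 1 / \<sigma>) * (S + C - 2 / S) + (2 * S - C - 1 / S) * (\<sigma> + C - 2 / \<sigma>) =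
      9 * (c / S + \<sigma> * c' - \<sigma> / S + c' / \<sigma> + S * c - S / \<sigma> - 2 * (c * c'))"
    proof -
      \<comment> \<open>The factors in \<open>sign_condition\<close> are, up to sign, three times
        the deviations of \<sigma>, S and their inverses from the centroids.\<close>
      have a: "2 * \<sigma> - C - 1 / \<sigma> = 3 * (\<sigma> - c)" "2 * S - C - 1 / S = 3 * (S - c')"
        "S + C - 2 / S = - 3 * (1 / S - c')" "\<sigma> + C - 2 / \<sigma> = - 3 * (1 / \<sigma> - c)"
        using \<sigma> S(1) by (simp_all add: c_c'_def m_m'_def field_simps)
      show ?thesis unfolding a by (simp add: algebra_simps)
    qed
    finally have "2 \<le> \<kappa> * (c / S + \<sigma> * c' - \<sigma> / S + c' / \<sigma> + S * c - S / \<sigma> - 2 * (c * c'))"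
      by (simp only: mult.left_commute[of \<kappa>])
    then have "2 * (1 + \<kappa> * (c * c')) \<le> \<kappa> * (c / S + \<sigma> * c' - \<sigma> / S) + \<kappa> * (c' / \<sigma> + S * c - S / \<sigma>)"
      by (simp add: algebra_simps)
    then have "M * M' * (2 * (1 + \<kappa> * (c * c'))) \<le> M * M' * (\<kappa> * (c / S + \<sigma> * c' - \<sigma> / S) + \<kappa> * (c' / \<sigma> + S * c - S / \<sigma>))"
      by (rule mult_left_mono) (simp add: M_M'_def)
    then show ?thesis unfolding S_def[symmetric] ex by (simp add: algebra_simps)
  next
    case False
    then have z: "M * M' = 0" by (auto simp: M_M'_def mom0_eq_0 not_less)
    show ?thesis unfolding S_def[symmetric] ex z by simp
  qed
qed

text \<open>At such ratios y is out of reach of x or of its image. The complementary interval is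
  stable under \<sigma> -> E / \<sigma>, as the inversion requires.\<close>

lemma level_support:
  assumes "\<sigma> > 0" "\<sigma> \<notin> {1 / (2 * C)..E / (1 / (2 * C))}"
  shows "levelP \<kappa> C E \<sigma> = 0" "levelQ \<kappa> C E \<sigma> = 0"
proof -
  have "C \<le> (\<sigma> + 1 / \<sigma>) / 2 \<or> C \<le> (\<sigma> / E + E / \<sigma>) / 2"
  proof (cases "\<sigma> < 1 / (2 * C)")
    case True
    then have "2 * C < 1 / \<sigma>" using assms(1) C by (simp add: field_simps)
    then show ?thesis using assms(1) by auto
  next
    case False
    then have "2 * C < \<sigma> / E" using assms C E by (auto simp: field_simps)
    moreover have "E / \<sigma> \<ge> 0" using assms(1) E by simp
    ultimately show ?thesis by auto
  qed
  then show "levelP \<kappa> C E \<sigma> = 0" "levelQ \<kappa> C E \<sigma> = 0"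
    by (auto simp: levelP_def levelQ_def mom1_def mom0_eq_0)
qed

text \<open>By inversion, twice either integral is the integral of the level function symmetrised
  under \<sigma> -> E / \<sigma>, to which \<open>level_sym\<close> applies pointwise.\<close>

lemma level_integral_le:
  "(\<integral>\<^sup>+ \<sigma>. ennreal (1 / \<sigma>) * ennreal (levelP \<kappa> C E \<sigma>) * indicator {0<..} \<sigma> \<partial>lborel) \<le>
   (\<integral>\<^sup>+ \<sigma>. ennreal (1 / \<sigma>) * ennreal (levelQ \<kappa> C E \<sigma>) * indicator {0<..} \<sigma> \<partial>lborel)"
proof -
  define a where "a = 1 / (2 * C)"
  have a: "a > 0" "a < E / a"
  proof -
    have "1 \<le> C * C" using C by (simp add: mult_ge1_I)
    then have "E * 1 \<le> E * (C * C)" using E by (intro mult_left_mono) auto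
    then have "1 < E * (2 * C) * (2 * C)" using E by linarith
    then have "1 / (2 * C) < E * (2 * C)" using C by (subst divide_less_eq) simp
    then show "a > 0" "a < E / a" using C by (simp_all add: a_def)
  qed
  have P [measurable]: "levelP \<kappa> C E \<in> borel_measurable borel" and Q [measurable]: "levelQ \<kappa> C E \<in> borel_measurable borel"
    unfolding levelP_def[abs_def] levelQ_def[abs_def] mom1_def mom0_def by measurable
  define J where "J f = (\<integral>\<^sup>+ \<sigma>. ennreal (1 / \<sigma>) * ennreal (f \<sigma>) * indicator {a..E / a} \<sigma> \<partial>lborel)" for f :: "real \<Rightarrow> real"
  have supp: "(\<integral>\<^sup>+ \<sigma>. ennreal (1 / \<sigma>) * ennreal (f \<sigma>) * indicator {0<..} \<sigma> \<partial>lborel) = J f"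
    if "\<And>\<sigma>. \<sigma> > 0 \<Longrightarrow> \<sigma> \<notin> {a..E / a} \<Longrightarrow> f \<sigma> = 0" for f
    unfolding J_def using that a by (intro nn_integral_cong) (force simp: indicator_def)
  have double: "2 * J f = (\<integral>\<^sup>+ \<sigma>. ennreal (1 / \<sigma>) * (ennreal (f \<sigma>) + ennreal (f (E / \<sigma>))) * indicator {a..E / a} \<sigma> \<partial>lborel)"
    if [measurable]: "f \<in> borel_measurable borel" for f
  proof -
    have "2 * J f = J f + J f" by (simp add: mult_2)
    also have "\<dots> = (\<integral>\<^sup>+ \<sigma>. ennreal (1 / \<sigma>) * ennreal (f \<sigma>) * indicator {a..E / a} \<sigma> \<partial>lborel) +
      (\<integral>\<^sup>+ \<sigma>. ennreal (1 / \<sigma>) * ennreal (f (E / \<sigma>)) * indicator {a..E / a} \<sigma> \<partial>lborel)"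
      unfolding J_def by (subst (2) nn_integral_inversion[OF _ a]) simp_all
    also have "\<dots> = (\<integral>\<^sup>+ \<sigma>. ennreal (1 / \<sigma>) * (ennreal (f \<sigma>) + ennreal (f (E / \<sigma>))) * indicator {a..E / a} \<sigma> \<partial>lborel)"
      by (subst nn_integral_add[symmetric]) (simp_all add: distrib_left distrib_right)
    finally show ?thesis .
  qed
  have "2 * J (levelP \<kappa> C E) \<le> 2 * J (levelQ \<kappa> C E)"
    unfolding double[OF P] double[OF Q]
  proof (rule nn_integral_mono)
    fix \<sigma> :: real
    show "ennreal (1 / \<sigma>) * (ennreal (levelP \<kappa> C E \<sigma>) + ennreal (levelP \<kappa> C E (E / \<sigma>))) * indicator {a..E / a} \<sigma> \<le>
      ennreal (1 / \<sigma>) * (ennreal (levelQ \<kappa> C E \<sigma>) + ennreal (levelQ \<kappa> C E (E / \<sigma>))) * indicator {a..E / a} \<sigma>"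
    proof (cases "\<sigma> \<in> {a..E / a}")
      case True
      then have \<sigma>: "\<sigma> > 0" "E / \<sigma> > 0" using a E by auto
      have "ennreal (levelP \<kappa> C E \<sigma>) + ennreal (levelP \<kappa> C E (E / \<sigma>)) = ennreal (levelP \<kappa> C E \<sigma> + levelP \<kappa> C E (E / \<sigma>))"
        using levelP_nonneg \<sigma> by (intro ennreal_plus[symmetric]) auto
      also have "\<dots> \<le> ennreal (levelQ \<kappa> C E \<sigma> + levelQ \<kappa> C E (E / \<sigma>))"
        using level_sym[OF \<sigma>(1)] by (rule ennreal_leI)
      also have "\<dots> \<le> ennreal (levelQ \<kappa> C E \<sigma>) + ennreal (levelQ \<kappa> C E (E / \<sigma>))"
        by (rule ennreal_add_le)
      finally show ?thesis by (intro mult_right_mono mult_left_mono) auto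
    qed simp
  qed
  then have "J (levelP \<kappa> C E) \<le> J (levelQ \<kappa> C E)" by (simp add: ennreal_mult_le_mult_iff)
  then show ?thesis using level_support by (subst (1 2) supp) (auto simp: a_def)
qed

definition gP :: "real \<Rightarrow> real \<Rightarrow> complex \<Rightarrow> complex \<Rightarrow> ennreal" where
  "gP s t a b = ennreal (max 0 (C - hc s t ((cmod a)\<^sup>2)) * max 0 (C - hc s (E * t) ((cmod b)\<^sup>2)) *
    (1 + \<kappa> * (hc s t ((cmod a)\<^sup>2) * hc s (E * t) ((cmod b)\<^sup>2))))"

text \<open>Here a - b = (\<nu> - 1) z is the horizontal displacement between x and its
  image.\<close>

definition gQ :: "real \<Rightarrow> real \<Rightarrow> complex \<Rightarrow> complex \<Rightarrow> ennreal" where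
  "gQ s t a b = ennreal (max 0 (C - hc s t ((cmod a)\<^sup>2)) * max 0 (C - hc s (E * t) ((cmod b)\<^sup>2)) *
    (\<kappa> * hc t (E * t) ((cmod (a - b))\<^sup>2)))"

lemma int_gP:
  assumes s: "s > 0" and t: "t > 0"
  shows "(\<integral>\<^sup>+ a. \<integral>\<^sup>+ b. gP s t a b \<partial>lborel \<partial>lborel) =
    ennreal (pi\<^sup>2 * ((2 * s * t) * (2 * s * (E * t)) * levelP \<kappa> C E (s / t)))"
proof -
  let ?m = "(s / t + t / s) / 2" and ?m' = "(s / (E * t) + E * t / s) / 2"
  have mpos: "?m > 0" "?m' > 0" using s t E by (simp_all add: add_pos_pos)
  have "(\<integral>\<^sup>+ a. \<integral>\<^sup>+ b. gP s t a b \<partial>lborel \<partial>lborel) = ennreal (pi\<^sup>2) * (\<integral>\<^sup>+ \<alpha>. (\<integral>\<^sup>+ \<beta>.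
     ennreal (max 0 (C - hc s t \<alpha>) * max 0 (C - hc s (E * t) \<beta>) * (1 + \<kappa> * (hc s t \<alpha> * hc s (E * t) \<beta>)))
       * indicator {0..} \<beta> \<partial>lborel) * indicator {0..} \<alpha> \<partial>lborel)"
    unfolding gP_def by (rule nn_integral_radial2) measurable
  also have "(\<integral>\<^sup>+ \<alpha>. (\<integral>\<^sup>+ \<beta>.
     ennreal (max 0 (C - hc s t \<alpha>) * max 0 (C - hc s (E * t) \<beta>) * (1 + \<kappa> * (hc s t \<alpha> * hc s (E * t) \<beta>)))
       * indicator {0..} \<beta> \<partial>lborel) * indicator {0..} \<alpha> \<partial>lborel) =
    (\<integral>\<^sup>+ \<alpha>. (\<integral>\<^sup>+ \<beta>. ennreal (max 0 (C - (?m + \<alpha> / (2 * s * t))) * max 0 (C - (?m' + \<beta> / (2 * s * (E * t)))) *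
      ((1 + 0 * (?m + \<alpha> / (2 * s * t))) + (0 + \<kappa> * (?m + \<alpha> / (2 * s * t))) * (?m' + \<beta> / (2 * s * (E * t)))))
       * indicator {0..} \<beta> \<partial>lborel) * indicator {0..} \<alpha> \<partial>lborel)"
    by (simp add: hc_def mult.assoc)
  also have "\<dots> = ennreal (2 * s * t * (2 * s * (E * t)) * (1 * mom0 C ?m * mom0 C ?m' + 0 * mom1 C ?m * mom0 C ?m'
      + 0 * mom0 C ?m * mom1 C ?m' + \<kappa> * mom1 C ?m * mom1 C ?m'))"
  proof (rule nn_integral_moment2)
    have "mom1 C ?m' \<ge> 0" using mpos C by (auto simp: mom1_def intro!: mult_nonneg_nonneg)
    then show "0 \<le> (1 + 0 * c) * mom0 C ?m' + (0 + \<kappa> * c) * mom1 C ?m'" if "?m \<le> c" for c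
      using that mpos \<kappa> by (intro add_nonneg_nonneg mult_nonneg_nonneg) auto
    show "0 \<le> 1 + 0 * c + (0 + \<kappa> * c) * c'" if "?m \<le> c" "?m' \<le> c'" for c c'
      using that mpos \<kappa> by (intro add_nonneg_nonneg mult_nonneg_nonneg) auto
  qed (use s t E in auto)
  also have "1 * mom0 C ?m * mom0 C ?m' + 0 * mom1 C ?m * mom0 C ?m' + 0 * mom0 C ?m * mom1 C ?m' + \<kappa> * mom1 C ?m * mom1 C ?m'
     = levelP \<kappa> C E (s / t)"
    by (simp add: levelP_def mult_ac)
  finally show ?thesis by (simp add: ennreal_mult'[symmetric])
qed

text \<open>The term |a - b|^2 is not a function of |a|^2 and |b|^2. Averaging over a and -a removes
  the mixed product by the parallelogram law, and the outcome is affine in the cosines from y to the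
  two points, so the two moments suffice.\<close>

lemma int_gQ:
  assumes s: "s > 0" and t: "t > 0"
  shows "(\<integral>\<^sup>+ a. \<integral>\<^sup>+ b. gQ s t a b \<partial>lborel \<partial>lborel) =
    ennreal (pi\<^sup>2 * ((2 * s * t) * (2 * s * (E * t)) * levelQ \<kappa> C E (s / t)))"
proof -
  let ?m = "(s / t + t / s) / 2" and ?m' = "(s / (E * t) + E * t / s) / 2"
  let ?\<sigma> = "s / t" and ?\<sigma>' = "s / (E * t)"
  have mpos: "?m > 0" "?m' > 0" using s t E by (simp_all add: add_pos_pos)
  have pos: "?\<sigma> > 0" "?\<sigma>' > 0" using s t E by simp_all
  have mean: "?\<sigma> * ?m' + ?\<sigma>' * ?m - ?\<sigma> * ?\<sigma>' = (E + 1 / E) / 2"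
    using s t E by (simp add: field_simps)
  define h where "h \<alpha> \<beta> = max 0 (C - hc s t \<alpha>) * max 0 (C - hc s (E * t) \<beta>) *
      (\<kappa> * (?\<sigma> * hc s (E * t) \<beta> + ?\<sigma>' * hc s t \<alpha> - ?\<sigma> * ?\<sigma>'))" for \<alpha> \<beta>
  have mean_hc: "hc t (E * t) x + hc t (E * t) y = 2 * (?\<sigma> * hc s (E * t) \<beta> + ?\<sigma>' * hc s t \<alpha> - ?\<sigma> * ?\<sigma>')"
    if "x + y = 2 * \<alpha> + 2 * \<beta>" for x y \<alpha> \<beta>
  proof -
    have "hc t (E * t) x + hc t (E * t) y = (E + 1 / E) + (x + y) / (2 * t * (E * t))"
      using t E by (simp add: hc_def field_simps)
    also have "(x + y) / (2 * t * (E * t)) = 2 * (?\<sigma> * (\<beta> / (2 * s * (E * t))) + ?\<sigma>' * (\<alpha> / (2 * s * t)))"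
      unfolding that using s t E by (simp add: field_simps)
    also have "E + 1 / E = 2 * (?\<sigma> * ?m' + ?\<sigma>' * ?m - ?\<sigma> * ?\<sigma>')" unfolding mean by simp
    finally show ?thesis unfolding hc_def by (simp only: distrib_left right_diff_distrib)
  qed
  have sym: "gQ s t (- a) b + gQ s t a b = 2 * ennreal (h ((cmod a)\<^sup>2) ((cmod b)\<^sup>2))" for a b
  proof -
    have n: "hc t (E * t) x \<ge> 0" if "x \<ge> 0" for x
      using that t E by (simp add: hc_def)
    have par: "(cmod (- a - b))\<^sup>2 + (cmod (a - b))\<^sup>2 = 2 * (cmod a)\<^sup>2 + 2 * (cmod b)\<^sup>2"
      by (simp add: power2_norm_eq_inner inner_diff_left inner_diff_right inner_commute)
    have "gQ s t (- a) b + gQ s t a b =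
      ennreal (max 0 (C - hc s t ((cmod a)\<^sup>2)) * max 0 (C - hc s (E * t) ((cmod b)\<^sup>2)) *
        (\<kappa> * (hc t (E * t) ((cmod (- a - b))\<^sup>2) + hc t (E * t) ((cmod (a - b))\<^sup>2))))"
      unfolding gQ_def using n \<kappa> by (subst ennreal_plus[symmetric]) (simp_all add: distrib_left)
    also have "\<dots> = ennreal (2 * h ((cmod a)\<^sup>2) ((cmod b)\<^sup>2))"
      unfolding mean_hc[OF par] h_def by (simp only: mult_ac)
    finally show ?thesis by (simp add: ennreal_mult')
  qed
  have [measurable]: "(\<lambda>(a, b). gQ s t a b) \<in> borel_measurable (borel \<Otimes>\<^sub>M borel)" unfolding gQ_def by measurable
  have [measurable]: "(\<lambda>(a, b). gQ s t (- a) b) \<in> borel_measurable (borel \<Otimes>\<^sub>M borel)" unfolding gQ_def by measurable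
  have [measurable]: "(\<lambda>(a, b). h a b) \<in> borel_measurable (borel \<Otimes>\<^sub>M borel)" unfolding h_def by measurable
  let ?I = "\<integral>\<^sup>+ a. \<integral>\<^sup>+ b. gQ s t a b \<partial>lborel \<partial>lborel"
  have "(\<integral>\<^sup>+ a. \<integral>\<^sup>+ b. gQ s t (0 + (-1) *\<^sub>R a) b \<partial>lborel \<partial>lborel) = ?I"
    by (rule nn_integral_affine_reflect) simp_all
  then have refl: "(\<integral>\<^sup>+ a. \<integral>\<^sup>+ b. gQ s t (- a) b \<partial>lborel \<partial>lborel) = ?I" by simp
  have "2 * ?I = (\<integral>\<^sup>+ a. \<integral>\<^sup>+ b. gQ s t (- a) b \<partial>lborel \<partial>lborel) + ?I" by (simp add: refl mult_2)
  also have "\<dots> = (\<integral>\<^sup>+ a. (\<integral>\<^sup>+ b. gQ s t (- a) b \<partial>lborel) + (\<integral>\<^sup>+ b. gQ s t a b \<partial>lborel) \<partial>lborel)"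
    by (rule nn_integral_add[symmetric]) measurable
  also have "\<dots> = (\<integral>\<^sup>+ a. \<integral>\<^sup>+ b. gQ s t (- a) b + gQ s t a b \<partial>lborel \<partial>lborel)"
    by (rule nn_integral_cong, rule nn_integral_add[symmetric]) measurable
  also have "\<dots> = (\<integral>\<^sup>+ a. 2 * (\<integral>\<^sup>+ b. ennreal (h ((cmod a)\<^sup>2) ((cmod b)\<^sup>2)) \<partial>lborel) \<partial>lborel)"
    unfolding sym by (rule nn_integral_cong, rule nn_integral_cmult) measurable
  also have "\<dots> = 2 * (\<integral>\<^sup>+ a. \<integral>\<^sup>+ b. ennreal (h ((cmod a)\<^sup>2) ((cmod b)\<^sup>2)) \<partial>lborel \<partial>lborel)"
    by (rule nn_integral_cmult) measurable
  finally have "?I = (\<integral>\<^sup>+ a. \<integral>\<^sup>+ b. ennreal (h ((cmod a)\<^sup>2) ((cmod b)\<^sup>2)) \<partial>lborel \<partial>lborel)"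
    by (simp add: ennreal_mult_cancel_left)
  also have "\<dots> = ennreal (pi\<^sup>2) * (\<integral>\<^sup>+ \<alpha>. (\<integral>\<^sup>+ \<beta>. ennreal (h \<alpha> \<beta>) * indicator {0..} \<beta> \<partial>lborel) * indicator {0..} \<alpha> \<partial>lborel)"
    by (rule nn_integral_radial2) measurable
  also have "(\<integral>\<^sup>+ \<alpha>. (\<integral>\<^sup>+ \<beta>. ennreal (h \<alpha> \<beta>) * indicator {0..} \<beta> \<partial>lborel) * indicator {0..} \<alpha> \<partial>lborel) =
    (\<integral>\<^sup>+ \<alpha>. (\<integral>\<^sup>+ \<beta>. ennreal (max 0 (C - (?m + \<alpha> / (2 * s * t))) * max 0 (C - (?m' + \<beta> / (2 * s * (E * t)))) *
      ((- \<kappa> * ?\<sigma> * ?\<sigma>' + \<kappa> * ?\<sigma>' * (?m + \<alpha> / (2 * s * t))) + (\<kappa> * ?\<sigma> + 0 * (?m + \<alpha> / (2 * s * t))) * (?m' + \<beta> / (2 * s * (E * t)))))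
       * indicator {0..} \<beta> \<partial>lborel) * indicator {0..} \<alpha> \<partial>lborel)"
  proof -
    have "h \<alpha> \<beta> = max 0 (C - (?m + \<alpha> / (2 * s * t))) * max 0 (C - (?m' + \<beta> / (2 * s * (E * t)))) *
      ((- \<kappa> * ?\<sigma> * ?\<sigma>' + \<kappa> * ?\<sigma>' * (?m + \<alpha> / (2 * s * t))) + (\<kappa> * ?\<sigma> + 0 * (?m + \<alpha> / (2 * s * t))) * (?m' + \<beta> / (2 * s * (E * t))))" for \<alpha> \<beta>
    proof -
      have "\<kappa> * (?\<sigma> * c' + ?\<sigma>' * c - ?\<sigma> * ?\<sigma>') = (- \<kappa> * ?\<sigma> * ?\<sigma>' + \<kappa> * ?\<sigma>' * c) + (\<kappa> * ?\<sigma> + 0 * c) * c'" for c c'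
        by (simp only: right_diff_distrib distrib_left) simp
      then show ?thesis unfolding h_def hc_def by (simp only:)
    qed
    then show ?thesis by (simp only:)
  qed
  also have "\<dots> = ennreal (2 * s * t * (2 * s * (E * t)) * (- \<kappa> * ?\<sigma> * ?\<sigma>' * mom0 C ?m * mom0 C ?m' + \<kappa> * ?\<sigma>' * mom1 C ?m * mom0 C ?m'
      + \<kappa> * ?\<sigma> * mom0 C ?m * mom1 C ?m' + 0 * mom1 C ?m * mom1 C ?m'))"
  proof (rule nn_integral_moment2)
    \<comment> \<open>At the least cosines the expression equals (E + 1 / E) / 2, and it grows with
      c and c'.\<close>
    have base: "0 \<le> ?\<sigma> * c' + ?\<sigma>' * c - ?\<sigma> * ?\<sigma>'" if c: "?m \<le> c" "?m' \<le> c'" for c c'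
    proof -
      have "?\<sigma> * ?m' \<le> ?\<sigma> * c'" "?\<sigma>' * ?m \<le> ?\<sigma>' * c" using c pos by (simp_all only: mult_le_cancel_left_pos)
      moreover have "0 \<le> ?\<sigma> * ?m' + ?\<sigma>' * ?m - ?\<sigma> * ?\<sigma>'" unfolding mean using E by simp
      ultimately show ?thesis by linarith
    qed
    show "0 \<le> - \<kappa> * ?\<sigma> * ?\<sigma>' + \<kappa> * ?\<sigma>' * c + (\<kappa> * ?\<sigma> + 0 * c) * c'" if c: "?m \<le> c" "?m' \<le> c'" for c c'
    proof -
      have "0 \<le> \<kappa> * (?\<sigma> * c' + ?\<sigma>' * c - ?\<sigma> * ?\<sigma>')" using base[OF c] \<kappa> by (rule mult_nonneg_nonneg[rotated])
      then show ?thesis by (simp only: right_diff_distrib distrib_left) simp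
    qed
    show "0 \<le> (- \<kappa> * ?\<sigma> * ?\<sigma>' + \<kappa> * ?\<sigma>' * c) * mom0 C ?m' + (\<kappa> * ?\<sigma> + 0 * c) * mom1 C ?m'" if c: "?m \<le> c" for c
    proof -
      have "0 \<le> \<kappa> * (?\<sigma> * ?m' + ?\<sigma>' * c - ?\<sigma> * ?\<sigma>') * mom0 C ?m'"
        using base[OF c order_refl] \<kappa> by (intro mult_nonneg_nonneg) auto
      moreover have "\<kappa> * ?\<sigma> * (?m' * mom0 C ?m') \<le> \<kappa> * ?\<sigma> * mom1 C ?m'"
        using pos \<kappa> by (intro mult_left_mono mom1_ge mult_nonneg_nonneg) auto
      ultimately show ?thesis by (simp only: right_diff_distrib left_diff_distrib distrib_left distrib_right)
    qed
  qed (use s t E in auto)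
  also have "- \<kappa> * ?\<sigma> * ?\<sigma>' * mom0 C ?m * mom0 C ?m' + \<kappa> * ?\<sigma>' * mom1 C ?m * mom0 C ?m'
      + \<kappa> * ?\<sigma> * mom0 C ?m * mom1 C ?m' + 0 * mom1 C ?m * mom1 C ?m' = levelQ \<kappa> C E (s / t)"
    by (simp add: levelQ_def algebra_simps)
  finally show ?thesis by (simp add: ennreal_mult'[symmetric])
qed

text \<open>The substitution s = t \<sigma> leaves a factor that does not depend on f, so only the
  integral over the ratio of heights distinguishes the kernels.\<close>

lemma level_scale:
  assumes t: "t > 0" and [measurable]: "f \<in> borel_measurable borel"
  shows "(\<integral>\<^sup>+ s. ennreal (1 / s ^ 3) * indicator {0<..} s * ennreal (pi\<^sup>2 * ((2 * s * t) * (2 * s * (E * t)) * f (s / t))) \<partial>lborel)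
    = ennreal (4 * pi\<^sup>2 * E * t\<^sup>2) * (\<integral>\<^sup>+ \<sigma>. ennreal (1 / \<sigma>) * ennreal (f \<sigma>) * indicator {0<..} \<sigma> \<partial>lborel)"
proof -
  have "(\<integral>\<^sup>+ s. ennreal (1 / s ^ 3) * indicator {0<..} s * ennreal (pi\<^sup>2 * ((2 * s * t) * (2 * s * (E * t)) * f (s / t))) \<partial>lborel)
    = ennreal \<bar>t\<bar> * (\<integral>\<^sup>+ \<sigma>. ennreal (1 / (0 + t * \<sigma>) ^ 3) * indicator {0<..} (0 + t * \<sigma>) *
       ennreal (pi\<^sup>2 * ((2 * (0 + t * \<sigma>) * t) * (2 * (0 + t * \<sigma>) * (E * t)) * f ((0 + t * \<sigma>) / t))) \<partial>lborel)"
    by (rule nn_integral_real_affine) (measurable, use t in simp)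
  also have "\<dots> = (\<integral>\<^sup>+ \<sigma>. ennreal t * (ennreal (1 / (t * \<sigma>) ^ 3) * indicator {0<..} (t * \<sigma>) *
       ennreal (pi\<^sup>2 * ((2 * (t * \<sigma>) * t) * (2 * (t * \<sigma>) * (E * t)) * f (t * \<sigma> / t)))) \<partial>lborel)"
  proof -
    have [measurable]: "(\<lambda>\<sigma>. indicator {0<..} (t * \<sigma>) :: ennreal) \<in> borel_measurable borel"
      by (rule measurable_compose[of "\<lambda>\<sigma>. t * \<sigma>" _ borel]) simp_all
    have [measurable]: "(\<lambda>\<sigma>. f (t * \<sigma> / t)) \<in> borel_measurable borel"
      by (rule measurable_compose[OF _ assms(2)]) simp
    show ?thesis using t by (subst nn_integral_cmult) simp_all
  qed
  also have "\<dots> = (\<integral>\<^sup>+ \<sigma>. ennreal (4 * pi\<^sup>2 * E * t\<^sup>2) * (ennreal (1 / \<sigma>) * ennreal (f \<sigma>) * indicator {0<..} \<sigma>) \<partial>lborel)"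
  proof (rule nn_integral_cong)
    fix \<sigma> :: real
    show "ennreal t * (ennreal (1 / (t * \<sigma>) ^ 3) * indicator {0<..} (t * \<sigma>) *
       ennreal (pi\<^sup>2 * ((2 * (t * \<sigma>) * t) * (2 * (t * \<sigma>) * (E * t)) * f (t * \<sigma> / t)))) =
      ennreal (4 * pi\<^sup>2 * E * t\<^sup>2) * (ennreal (1 / \<sigma>) * ennreal (f \<sigma>) * indicator {0<..} \<sigma>)"
    proof (cases "\<sigma> > 0")
      case True
      have "ennreal t * (ennreal (1 / (t * \<sigma>) ^ 3) *
         ennreal (pi\<^sup>2 * ((2 * (t * \<sigma>) * t) * (2 * (t * \<sigma>) * (E * t)) * f (t * \<sigma> / t)))) =
        ennreal (t * (1 / (t * \<sigma>) ^ 3 * (pi\<^sup>2 * ((2 * (t * \<sigma>) * t) * (2 * (t * \<sigma>) * (E * t)) * f (t * \<sigma> / t)))))"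
        using t True by (simp add: ennreal_mult'[symmetric])
      also have "t * (1 / (t * \<sigma>) ^ 3 * (pi\<^sup>2 * ((2 * (t * \<sigma>) * t) * (2 * (t * \<sigma>) * (E * t)) * f (t * \<sigma> / t)))) =
        4 * pi\<^sup>2 * E * t\<^sup>2 * (1 / \<sigma> * f \<sigma>)"
        using t True by (simp add: power2_eq_square power3_eq_cube field_simps)
      also have "ennreal \<dots> = ennreal (4 * pi\<^sup>2 * E * t\<^sup>2) * (ennreal (1 / \<sigma>) * ennreal (f \<sigma>))"
      proof -
        have "0 \<le> 4 * pi\<^sup>2 * E * t\<^sup>2" "0 \<le> 1 / \<sigma>" using E True by simp_all
        then show ?thesis by (simp only: ennreal_mult')
      qed
      finally show ?thesis using True t by simp
    next
      case False
      then have "\<not> t * \<sigma> > 0" using t by (simp add: zero_less_mult_iff)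
      then show ?thesis using False by simp
    qed
  qed
  also have "\<dots> = ennreal (4 * pi\<^sup>2 * E * t\<^sup>2) * (\<integral>\<^sup>+ \<sigma>. ennreal (1 / \<sigma>) * ennreal (f \<sigma>) * indicator {0<..} \<sigma> \<partial>lborel)"
    by (rule nn_integral_cmult) measurable
  finally show ?thesis .
qed

lemma level_measurable [measurable]:
  "levelP \<kappa> C E \<in> borel_measurable borel" "levelQ \<kappa> C E \<in> borel_measurable borel"
  unfolding levelP_def[abs_def] levelQ_def[abs_def] mom1_def mom0_def by measurable

text \<open>The argument of \<nu>, that is the rotation part of the loxodromic element, enters only
  through the common Jacobian, which is cancelled at the end. At each height t the claim is then
  \<open>level_integral_le\<close>.\<close>

lemma strip_le:
  assumes \<nu>: "cmod \<nu> = E"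
  shows "(\<integral>\<^sup>+ x. (\<integral>\<^sup>+ y. kerP \<kappa> C y x (\<nu> * fst x, E * snd x) \<partial>hyp_volume) * indicator {1..<E} (snd x) \<partial>hyp_volume) \<le>
    (\<integral>\<^sup>+ x. (\<integral>\<^sup>+ y. kerQ \<kappa> C y x (\<nu> * fst x, E * snd x) \<partial>hyp_volume) * indicator {1..<E} (snd x) \<partial>hyp_volume)"
proof -
  have \<nu>1: "\<nu> \<noteq> 1" using \<nu> E by auto
  have x'H: "(\<nu> * fst x, E * snd x) \<in> H3" if "x \<in> H3" for x using that E by (simp add: H3_iff)
  have P: "(\<integral>\<^sup>+ x. (\<integral>\<^sup>+ y. kerP \<kappa> C y x (\<nu> * fst x, E * snd x) \<partial>hyp_volume) * indicator {1..<E} (snd x) \<partial>hyp_volume) =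
    (\<integral>\<^sup>+ x. (\<integral>\<^sup>+ y. gP (snd y) (snd x) (fst y - fst x) (fst y - \<nu> * fst x) \<partial>hyp_volume) * indicator {1..<E} (snd x) \<partial>hyp_volume)"
  proof (rule nn_integral_cong)
    fix x :: "complex \<times> real"
    have "(\<integral>\<^sup>+ y. kerP \<kappa> C y x (\<nu> * fst x, E * snd x) \<partial>hyp_volume) =
        (\<integral>\<^sup>+ y. gP (snd y) (snd x) (fst y - fst x) (fst y - \<nu> * fst x) \<partial>hyp_volume)" if x: "x \<in> H3"
      by (rule nn_integral_cong_AE, use AE_hyp_volume_H3 in eventually_elim)
        (simp add: kerP_def gP_def hk_def hcosh_hc x x'H)
    then show "(\<integral>\<^sup>+ y. kerP \<kappa> C y x (\<nu> * fst x, E * snd x) \<partial>hyp_volume) * indicator {1..<E} (snd x) =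
      (\<integral>\<^sup>+ y. gP (snd y) (snd x) (fst y - fst x) (fst y - \<nu> * fst x) \<partial>hyp_volume) * indicator {1..<E} (snd x)"
      by (auto simp: indicator_def H3_iff)
  qed
  have Q: "(\<integral>\<^sup>+ x. (\<integral>\<^sup>+ y. kerQ \<kappa> C y x (\<nu> * fst x, E * snd x) \<partial>hyp_volume) * indicator {1..<E} (snd x) \<partial>hyp_volume) =
    (\<integral>\<^sup>+ x. (\<integral>\<^sup>+ y. gQ (snd y) (snd x) (fst y - fst x) (fst y - \<nu> * fst x) \<partial>hyp_volume) * indicator {1..<E} (snd x) \<partial>hyp_volume)"
  proof (rule nn_integral_cong)
    fix x :: "complex \<times> real"
    have "(\<integral>\<^sup>+ y. kerQ \<kappa> C y x (\<nu> * fst x, E * snd x) \<partial>hyp_volume) =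
        (\<integral>\<^sup>+ y. gQ (snd y) (snd x) (fst y - fst x) (fst y - \<nu> * fst x) \<partial>hyp_volume)" if x: "x \<in> H3"
      by (rule nn_integral_cong_AE, use AE_hyp_volume_H3 in eventually_elim)
        (simp add: kerQ_def gQ_def hk_def hcosh_hc x x'H norm_minus_commute)
    then show "(\<integral>\<^sup>+ y. kerQ \<kappa> C y x (\<nu> * fst x, E * snd x) \<partial>hyp_volume) * indicator {1..<E} (snd x) =
      (\<integral>\<^sup>+ y. gQ (snd y) (snd x) (fst y - fst x) (fst y - \<nu> * fst x) \<partial>hyp_volume) * indicator {1..<E} (snd x)"
      by (auto simp: indicator_def H3_iff)
  qed
  have mP: "(\<lambda>(s, t, a, b). gP s t a b) \<in> borel_measurable borel"
  proof -
    have "(\<lambda>(s, t, a, b). gP s t a b) \<in> borel_measurable (borel \<Otimes>\<^sub>M borel \<Otimes>\<^sub>M borel \<Otimes>\<^sub>M borel)"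
      unfolding gP_def by measurable
    then show ?thesis by (simp add: borel_prod)
  qed
  have mQ: "(\<lambda>(s, t, a, b). gQ s t a b) \<in> borel_measurable borel"
  proof -
    have "(\<lambda>(s, t, a, b). gQ s t a b) \<in> borel_measurable (borel \<Otimes>\<^sub>M borel \<Otimes>\<^sub>M borel \<Otimes>\<^sub>M borel)"
      unfolding gQ_def by measurable
    then show ?thesis by (simp add: borel_prod)
  qed
  have inner: "(\<integral>\<^sup>+ s. ennreal (1 / s ^ 3) * indicator {0<..} s * (\<integral>\<^sup>+ a. \<integral>\<^sup>+ b. gP s t a b \<partial>lborel \<partial>lborel) \<partial>lborel) \<le>
     (\<integral>\<^sup>+ s. ennreal (1 / s ^ 3) * indicator {0<..} s * (\<integral>\<^sup>+ a. \<integral>\<^sup>+ b. gQ s t a b \<partial>lborel \<partial>lborel) \<partial>lborel)" if t: "t > 0" for t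
  proof -
    have "(\<integral>\<^sup>+ s. ennreal (1 / s ^ 3) * indicator {0<..} s * (\<integral>\<^sup>+ a. \<integral>\<^sup>+ b. gP s t a b \<partial>lborel \<partial>lborel) \<partial>lborel) =
      (\<integral>\<^sup>+ s. ennreal (1 / s ^ 3) * indicator {0<..} s * ennreal (pi\<^sup>2 * ((2 * s * t) * (2 * s * (E * t)) * levelP \<kappa> C E (s / t))) \<partial>lborel)"
      by (rule nn_integral_cong) (auto simp: indicator_def int_gP t)
    also have "\<dots> = ennreal (4 * pi\<^sup>2 * E * t\<^sup>2) * (\<integral>\<^sup>+ \<sigma>. ennreal (1 / \<sigma>) * ennreal (levelP \<kappa> C E \<sigma>) * indicator {0<..} \<sigma> \<partial>lborel)"
      by (rule level_scale[OF t]) measurable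
    also have "\<dots> \<le> ennreal (4 * pi\<^sup>2 * E * t\<^sup>2) * (\<integral>\<^sup>+ \<sigma>. ennreal (1 / \<sigma>) * ennreal (levelQ \<kappa> C E \<sigma>) * indicator {0<..} \<sigma> \<partial>lborel)"
      using level_integral_le by (rule mult_left_mono) simp
    also have "\<dots> = (\<integral>\<^sup>+ s. ennreal (1 / s ^ 3) * indicator {0<..} s * ennreal (pi\<^sup>2 * ((2 * s * t) * (2 * s * (E * t)) * levelQ \<kappa> C E (s / t))) \<partial>lborel)"
      by (rule level_scale[OF t, symmetric]) measurable
    also have "\<dots> = (\<integral>\<^sup>+ s. ennreal (1 / s ^ 3) * indicator {0<..} s * (\<integral>\<^sup>+ a. \<integral>\<^sup>+ b. gQ s t a b \<partial>lborel \<partial>lborel) \<partial>lborel)"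
      by (rule nn_integral_cong) (auto simp: indicator_def int_gQ t)
    finally show ?thesis .
  qed
  have "ennreal ((cmod (\<nu> - 1))\<^sup>2) * (\<integral>\<^sup>+ x. (\<integral>\<^sup>+ y. kerP \<kappa> C y x (\<nu> * fst x, E * snd x) \<partial>hyp_volume) * indicator {1..<E} (snd x) \<partial>hyp_volume) \<le>
    ennreal ((cmod (\<nu> - 1))\<^sup>2) * (\<integral>\<^sup>+ x. (\<integral>\<^sup>+ y. kerQ \<kappa> C y x (\<nu> * fst x, E * snd x) \<partial>hyp_volume) * indicator {1..<E} (snd x) \<partial>hyp_volume)"
    unfolding P Q strip_integral[OF \<nu>1 mP] strip_integral[OF \<nu>1 mQ]
  proof (rule nn_integral_mono)
    fix t :: real
    show "ennreal (1 / t ^ 3) * indicator {0<..} t * indicator {1..<E} t *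
        (\<integral>\<^sup>+ s. ennreal (1 / s ^ 3) * indicator {0<..} s * (\<integral>\<^sup>+ a. \<integral>\<^sup>+ b. gP s t a b \<partial>lborel \<partial>lborel) \<partial>lborel) \<le>
      ennreal (1 / t ^ 3) * indicator {0<..} t * indicator {1..<E} t *
        (\<integral>\<^sup>+ s. ennreal (1 / s ^ 3) * indicator {0<..} s * (\<integral>\<^sup>+ a. \<integral>\<^sup>+ b. gQ s t a b \<partial>lborel \<partial>lborel) \<partial>lborel)"
      using inner[of t] by (cases "t > 0") (auto intro: mult_left_mono)
  qed
  then show ?thesis using \<nu>1 by (subst (asm) ennreal_mult_le_mult_iff) auto
qed

end

section \<open>The identity contribution and the mean\<close>

lemma nn_integral_hyp_radial:
  assumes [measurable]: "f \<in> borel_measurable borel" and x: "x \<in> H3"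
  shows "(\<integral>\<^sup>+ y. f (hcosh y x) \<partial>hyp_volume) =
    (\<integral>\<^sup>+ s. ennreal (1 / s ^ 3) * indicator {0<..} s * (ennreal pi * (\<integral>\<^sup>+ \<alpha>. f (hc s (snd x) \<alpha>) * indicator {0..} \<alpha> \<partial>lborel)) \<partial>lborel)"
proof -
  have "(\<integral>\<^sup>+ y. f (hcosh y x) \<partial>hyp_volume) =
     (\<integral>\<^sup>+ s. ennreal (1 / s ^ 3) * indicator {0<..} s * (\<integral>\<^sup>+ w. f (hcosh (w, s) x) \<partial>lborel) \<partial>lborel)"
    by (rule nn_integral_hyp_iterated) measurable
  also have "\<dots> = (\<integral>\<^sup>+ s. ennreal (1 / s ^ 3) * indicator {0<..} s * (ennreal pi * (\<integral>\<^sup>+ \<alpha>. f (hc s (snd x) \<alpha>) * indicator {0..} \<alpha> \<partial>lborel)) \<partial>lborel)"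
  proof (rule nn_integral_cong)
    fix s :: real
    have "(\<integral>\<^sup>+ w. f (hcosh (w, s) x) \<partial>lborel) = ennreal pi * (\<integral>\<^sup>+ \<alpha>. f (hc s (snd x) \<alpha>) * indicator {0..} \<alpha> \<partial>lborel)" if s: "s > 0"
    proof -
      have "(\<integral>\<^sup>+ w. f (hcosh (w, s) x) \<partial>lborel) = (\<integral>\<^sup>+ w. f (hc s (snd x) ((cmod (- fst x + 1 *\<^sub>R w))\<^sup>2)) \<partial>lborel)"
        using s x by (simp add: hcosh_hc H3_iff)
      also have "\<dots> = (\<integral>\<^sup>+ w. f (hc s (snd x) ((cmod w)\<^sup>2)) \<partial>lborel)"
        by (rule nn_integral_affine_reflect) simp_all
      also have "\<dots> = ennreal pi * (\<integral>\<^sup>+ \<alpha>. f (hc s (snd x) \<alpha>) * indicator {0..} \<alpha> \<partial>lborel)"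
        by (rule nn_integral_radial) measurable
      finally show ?thesis .
    qed
    then show "ennreal (1 / s ^ 3) * indicator {0<..} s * (\<integral>\<^sup>+ w. f (hcosh (w, s) x) \<partial>lborel) =
      ennreal (1 / s ^ 3) * indicator {0<..} s * (ennreal pi * (\<integral>\<^sup>+ \<alpha>. f (hc s (snd x) \<alpha>) * indicator {0..} \<alpha> \<partial>lborel))"
      by (auto simp: indicator_def)
  qed
  finally show ?thesis .
qed

text \<open>The integral equals 4 pi times that of (C - c) sqrt (c^2 - 1) over c from 1 to C, so the
  leading term is sharp. Only heights s at most that of x are kept; there s / t <= 1 leaves an
  expression with an elementary primitive.\<close>

lemma mean_bound:
  assumes x: "x \<in> H3" and C: "C \<ge> 1"
  shows "ennreal (2 * pi / 3 * (C - 1) ^ 3) \<le> (\<integral>\<^sup>+ y. ennreal (hk C y x) \<partial>hyp_volume)"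
proof -
  define t where "t = snd x"
  have t: "t > 0" using x by (simp add: t_def H3_iff)
  \<comment> \<open>The height at which \<open>q\<close> vanishes.\<close>
  define a where "a = t / (2 * C - 1)"
  have a: "0 < a" "a \<le> t" using t C by (auto simp: a_def field_simps)
  define q where "q s = C - 1 / 2 - t / (2 * s)" for s
  have "2 * pi / 3 * (C - 1) ^ 3 = 2 * pi / 3 * q t ^ 3 - 2 * pi / 3 * q a ^ 3"
    using t C by (simp add: q_def a_def)
  also have "ennreal (2 * pi / 3 * q t ^ 3 - 2 * pi / 3 * q a ^ 3) =
    (\<integral>\<^sup>+ s. ennreal (pi * t / s\<^sup>2 * (q s)\<^sup>2) * indicator {a..t} s \<partial>lborel)"
  proof (rule nn_integral_FTC_Icc[symmetric])
    fix s assume s: "s \<in> {a..t}"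
    then have "s > 0" using a by simp
    then show "((\<lambda>s. 2 * pi / 3 * q s ^ 3) has_real_derivative pi * t / s\<^sup>2 * (q s)\<^sup>2) (at s)"
      unfolding q_def by (auto intro!: derivative_eq_intros simp: power2_eq_square field_simps)
    show "0 \<le> pi * t / s\<^sup>2 * (q s)\<^sup>2" using t by simp
  next
    show "(\<lambda>s. pi * t / s\<^sup>2 * (q s)\<^sup>2) \<in> borel_measurable borel" unfolding q_def by measurable
  qed (use a in simp)
  also have "\<dots> \<le> (\<integral>\<^sup>+ s. ennreal (1 / s ^ 3) * indicator {0<..} s * (ennreal pi * (\<integral>\<^sup>+ \<alpha>. ennreal (max 0 (C - hc s t \<alpha>)) * indicator {0..} \<alpha> \<partial>lborel)) \<partial>lborel)"
  proof (rule nn_integral_mono)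
    fix s :: real
    have "ennreal (pi * t / s\<^sup>2 * (q s)\<^sup>2) \<le> ennreal (1 / s ^ 3) * (ennreal pi * (\<integral>\<^sup>+ \<alpha>. ennreal (max 0 (C - hc s t \<alpha>)) * indicator {0..} \<alpha> \<partial>lborel))"
      if s: "s \<in> {a..t}"
    proof -
      let ?m = "(s / t + t / s) / 2"
      have sp: "s > 0" using s a by simp
      have "(\<integral>\<^sup>+ \<alpha>. ennreal (max 0 (C - hc s t \<alpha>)) * indicator {0..} \<alpha> \<partial>lborel) = ennreal (2 * s * t * mom0 C ?m)"
        using nn_integral_moment[of "2 * s * t" ?m C 1 0] sp t by (simp add: hc_def)
      moreover have "(q s)\<^sup>2 / 2 \<le> mom0 C ?m"
      proof -
        have "s / t \<le> 1" using s t by simp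
        moreover have "t / (2 * s) = t / s / 2" by simp
        moreover have "C - 1 / 2 - Z \<le> C - (X + Y) / 2" if "X \<le> 1" "Z = Y / 2" for X Y Z :: real
          using that by (simp add: field_simps)
        ultimately have "q s \<le> C - ?m" unfolding q_def by blast
        moreover have "0 \<le> q s"
        proof -
          have "t / (2 * C - 1) \<le> s" using s by (simp add: a_def)
          then have "t \<le> s * (2 * C - 1)" using C by (simp add: divide_le_eq)
          then show ?thesis using sp by (simp add: q_def field_simps)
        qed
        ultimately show ?thesis unfolding mom0_def by (simp add: power_mono)
      qed
      then have "pi * t / s\<^sup>2 * (q s)\<^sup>2 \<le> 1 / s ^ 3 * (pi * (2 * s * t * mom0 C ?m))"
      proof -
        assume le: "(q s)\<^sup>2 / 2 \<le> mom0 C ?m"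
        have "1 / s ^ 3 * (pi * (2 * s * t * mom0 C ?m)) = 2 * pi * t / s\<^sup>2 * mom0 C ?m"
          using sp by (simp add: power2_eq_square power3_eq_cube)
        moreover have "2 * pi * t / s\<^sup>2 * ((q s)\<^sup>2 / 2) \<le> 2 * pi * t / s\<^sup>2 * mom0 C ?m"
          using le t by (intro mult_left_mono) auto
        ultimately show ?thesis by simp
      qed
      ultimately show ?thesis using sp t
        by (simp add: ennreal_mult[symmetric] ennreal_leI)
    qed
    then show "ennreal (pi * t / s\<^sup>2 * (q s)\<^sup>2) * indicator {a..t} s \<le>
      ennreal (1 / s ^ 3) * indicator {0<..} s * (ennreal pi * (\<integral>\<^sup>+ \<alpha>. ennreal (max 0 (C - hc s t \<alpha>)) * indicator {0..} \<alpha> \<partial>lborel))"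
      using a by (auto simp: indicator_def)
  qed
  also have "\<dots> = (\<integral>\<^sup>+ y. ennreal (hk C y x) \<partial>hyp_volume)"
    unfolding hk_def t_def by (rule nn_integral_hyp_radial[OF _ x, symmetric]) measurable
  finally show ?thesis .
qed

text \<open>The integral equals 4 pi times that of (C - c)^2 (1 + \<kappa> c^2) sqrt (c^2 - 1) over
  c from 1 to C; the bound is the same with c in place of the root and the range starting at 0. In
  coordinates this means dropping s / t from the least cosine at height s.\<close>

lemma identity_bound:
  assumes x: "x \<in> H3" and C: "C \<ge> 1" and \<kappa>: "\<kappa> \<ge> 0"
  shows "(\<integral>\<^sup>+ y. kerP \<kappa> C y x x \<partial>hyp_volume) \<le> ennreal (4 * pi * (C ^ 4 / 12 + \<kappa> * C ^ 6 / 60))"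
proof -
  define t where "t = snd x"
  have t: "t > 0" using x by (simp add: t_def H3_iff)
  define f where "f c = (max 0 (C - c))\<^sup>2 * (1 + \<kappa> * c\<^sup>2)" for c
  have [measurable]: "f \<in> borel_measurable borel" unfolding f_def[abs_def] by measurable
  \<comment> \<open>A primitive of (C - c)^2 (1 + \<kappa> c^2); B is a primitive of A with
    \<open>B 0 = 0\<close>, which removes the boundary term at infinite height.\<close>
  define A where "A c = (C\<^sup>2 * c - C * c\<^sup>2 + c ^ 3 / 3) + \<kappa> * (C\<^sup>2 * c ^ 3 / 3 - C * c ^ 4 / 2 + c ^ 5 / 5)" for c
  define B where "B c = (C\<^sup>2 * c\<^sup>2 / 2 - C * c ^ 3 / 3 + c ^ 4 / 12) + \<kappa> * (C\<^sup>2 * c ^ 4 / 12 - C * c ^ 5 / 10 + c ^ 6 / 30)" for c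
  have dA: "(A has_real_derivative (C - c)\<^sup>2 * (1 + \<kappa> * c\<^sup>2)) (at c)" for c
    unfolding A_def by (auto intro!: derivative_eq_intros simp: power2_eq_square power3_eq_cube power4_eq_xxxx field_simps)
  have dB: "(B has_real_derivative A c) (at c)" for c
    unfolding A_def B_def by (auto intro!: derivative_eq_intros simp: power2_eq_square power3_eq_cube power4_eq_xxxx field_simps)
  have Amono: "A c \<le> A C" if "c \<le> C" for c
    using that by (rule DERIV_nonneg_imp_nondecreasing) (use dA \<kappa> in \<open>auto intro!: exI mult_nonneg_nonneg add_nonneg_nonneg\<close>)
  have inner: "(\<integral>\<^sup>+ \<alpha>. ennreal (f (hc s t \<alpha>)) * indicator {0..} \<alpha> \<partial>lborel) \<le>
      ennreal (2 * s * t * (A C - A (t / (2 * s)))) * indicator {t / (2 * C)..} s" if s: "s > 0" for s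
  proof -
    let ?m = "(s / t + t / s) / 2" and ?k = "2 * s * t"
    have k: "?k > 0" using s t by simp
    have m: "t / (2 * s) \<le> ?m" using s t by (simp add: field_simps)
    show ?thesis
    proof (cases "?m \<le> C")
      case True
      have "t / (2 * s) \<le> C" using m True by linarith
      then have "t / (2 * C) \<le> s" using s C by (simp add: field_simps)
      have b: "?m + \<alpha> / ?k \<le> C \<longleftrightarrow> \<alpha> \<le> ?k * (C - ?m)" for \<alpha>
      proof -
        have "?m + \<alpha> / ?k \<le> C \<longleftrightarrow> \<alpha> / ?k \<le> C - ?m" by linarith
        also have "\<dots> \<longleftrightarrow> \<alpha> \<le> (C - ?m) * ?k" using k by (rule pos_divide_le_eq)
        finally show ?thesis by (simp only: mult.commute)
      qed
      have "(\<integral>\<^sup>+ \<alpha>. ennreal (f (hc s t \<alpha>)) * indicator {0..} \<alpha> \<partial>lborel) =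
        (\<integral>\<^sup>+ \<alpha>. ennreal ((C - (?m + \<alpha> / ?k))\<^sup>2 * (1 + \<kappa> * (?m + \<alpha> / ?k)\<^sup>2)) * indicator {0..?k * (C - ?m)} \<alpha> \<partial>lborel)"
        by (rule nn_integral_cong) (auto simp: indicator_def f_def hc_def max_def b[symmetric])
      also have "\<dots> = ennreal (?k * A (?m + ?k * (C - ?m) / ?k) - ?k * A (?m + 0 / ?k))"
      proof (rule nn_integral_FTC_Icc)
        fix \<alpha>
        have "((\<lambda>\<alpha>. A (?m + \<alpha> / ?k)) has_real_derivative ((C - (?m + \<alpha> / ?k))\<^sup>2 * (1 + \<kappa> * (?m + \<alpha> / ?k)\<^sup>2)) * (1 / ?k)) (at \<alpha>)"
          by (rule DERIV_chain2[OF dA]) (use k in \<open>auto intro!: derivative_eq_intros\<close>)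
        from DERIV_cmult[OF this, of ?k]
        have "((\<lambda>\<alpha>. ?k * A (?m + \<alpha> / ?k)) has_real_derivative ?k * ((C - (?m + \<alpha> / ?k))\<^sup>2 * (1 + \<kappa> * (?m + \<alpha> / ?k)\<^sup>2) * (1 / ?k))) (at \<alpha>)" .
        moreover have "?k * (z * (1 / ?k)) = z" for z using s t by simp
        ultimately show "((\<lambda>\<alpha>. ?k * A (?m + \<alpha> / ?k)) has_real_derivative (C - (?m + \<alpha> / ?k))\<^sup>2 * (1 + \<kappa> * (?m + \<alpha> / ?k)\<^sup>2)) (at \<alpha>)"
          by (simp only:)
        show "0 \<le> (C - (?m + \<alpha> / ?k))\<^sup>2 * (1 + \<kappa> * (?m + \<alpha> / ?k)\<^sup>2)" using \<kappa> by simp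
      qed (use True k in auto)
      also have "?k * A (?m + ?k * (C - ?m) / ?k) - ?k * A (?m + 0 / ?k) = ?k * (A C - A ?m)"
      proof -
        have "?m + ?k * (C - ?m) / ?k = C" "?m + 0 / ?k = ?m" using s t by simp_all
        then show ?thesis by (simp only: right_diff_distrib)
      qed
      also have "ennreal (?k * (A C - A ?m)) \<le> ennreal (?k * (A C - A (t / (2 * s))))"
      proof -
        have "A (t / (2 * s)) \<le> A ?m"
          using m by (rule DERIV_nonneg_imp_nondecreasing) (use dA \<kappa> in \<open>auto intro!: exI mult_nonneg_nonneg add_nonneg_nonneg\<close>)
        then show ?thesis using k by (intro ennreal_leI mult_left_mono) auto
      qed
      finally show ?thesis using \<open>t / (2 * C) \<le> s\<close> by simp
    next
      case False
      then have "f (hc s t \<alpha>) = 0" if "\<alpha> \<ge> 0" for \<alpha>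
      proof -
        have "0 \<le> \<alpha> / ?k" using that k by (simp only: divide_nonneg_pos)
        then have "C - hc s t \<alpha> \<le> 0" using False unfolding hc_def by linarith
        then show ?thesis by (simp add: f_def)
      qed
      then have "(\<integral>\<^sup>+ \<alpha>. ennreal (f (hc s t \<alpha>)) * indicator {0..} \<alpha> \<partial>lborel) = (\<integral>\<^sup>+ (\<alpha>::real). 0 \<partial>lborel)"
        by (intro nn_integral_cong) (auto simp: indicator_def)
      then show ?thesis by simp
    qed
  qed
  have "(\<integral>\<^sup>+ y. kerP \<kappa> C y x x \<partial>hyp_volume) = (\<integral>\<^sup>+ y. ennreal (f (hcosh y x)) \<partial>hyp_volume)"
    by (simp add: kerP_def f_def hk_def power2_eq_square)
  also have "\<dots> = (\<integral>\<^sup>+ s. ennreal (1 / s ^ 3) * indicator {0<..} s * (ennreal pi * (\<integral>\<^sup>+ \<alpha>. ennreal (f (hc s t \<alpha>)) * indicator {0..} \<alpha> \<partial>lborel)) \<partial>lborel)"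
    unfolding t_def by (rule nn_integral_hyp_radial[OF _ x]) measurable
  also have "\<dots> \<le> (\<integral>\<^sup>+ s. ennreal (2 * pi * t / s\<^sup>2 * (A C - A (t / (2 * s)))) * indicator {t / (2 * C)..} s \<partial>lborel)"
  proof (rule nn_integral_mono)
    fix s :: real
    show "ennreal (1 / s ^ 3) * indicator {0<..} s * (ennreal pi * (\<integral>\<^sup>+ \<alpha>. ennreal (f (hc s t \<alpha>)) * indicator {0..} \<alpha> \<partial>lborel)) \<le>
      ennreal (2 * pi * t / s\<^sup>2 * (A C - A (t / (2 * s)))) * indicator {t / (2 * C)..} s"
    proof (cases "s > 0")
      case True
      have "ennreal (1 / s ^ 3) * (ennreal pi * (\<integral>\<^sup>+ \<alpha>. ennreal (f (hc s t \<alpha>)) * indicator {0..} \<alpha> \<partial>lborel)) \<le>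
        ennreal (1 / s ^ 3) * (ennreal pi * (ennreal (2 * s * t * (A C - A (t / (2 * s)))) * indicator {t / (2 * C)..} s))"
        using inner[OF True] by (intro mult_left_mono) auto
      also have "\<dots> = ennreal (1 / s ^ 3 * (pi * (2 * s * t * (A C - A (t / (2 * s)))))) * indicator {t / (2 * C)..} s"
        using True by (simp only: ennreal_mult' mult.assoc pi_ge_zero divide_nonneg_pos zero_le_one zero_less_power)
      also have "1 / s ^ 3 * (pi * (2 * s * t * (A C - A (t / (2 * s))))) = 2 * pi * t / s\<^sup>2 * (A C - A (t / (2 * s)))"
        using True by (simp add: power2_eq_square power3_eq_cube)
      finally show ?thesis using True by simp
    qed simp
  qed
  also have "\<dots> = ennreal (0 - (- (4 * pi * C * A C) + 4 * pi * B C))"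
  proof -
    define G where "G s = - (2 * pi * t / s * A C) + 4 * pi * B (t / (2 * s))" for s
    have "(\<integral>\<^sup>+ s. ennreal (2 * pi * t / s\<^sup>2 * (A C - A (t / (2 * s)))) * indicator {t / (2 * C)..} s \<partial>lborel) = ennreal (0 - G (t / (2 * C)))"
    proof (rule nn_integral_FTC_atLeast)
      show "(\<lambda>s. 2 * pi * t / s\<^sup>2 * (A C - A (t / (2 * s)))) \<in> borel_measurable borel"
        unfolding A_def by measurable
      fix s assume s: "t / (2 * C) \<le> s"
      have "0 < t / (2 * C)" using t C by simp
      then have sp: "s > 0" using s by linarith
      have d: "((\<lambda>s. B (t / (2 * s))) has_real_derivative A (t / (2 * s)) * (- t / (2 * s\<^sup>2))) (at s)"
        by (rule DERIV_chain2[OF dB]) (use sp in \<open>auto intro!: derivative_eq_intros simp: power2_eq_square field_simps\<close>)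
      have "((\<lambda>s. - (2 * pi * t / s * A C)) has_real_derivative 2 * pi * t / s\<^sup>2 * A C) (at s)"
        using sp by (auto intro!: derivative_eq_intros simp: power2_eq_square field_simps)
      from DERIV_add[OF this DERIV_cmult[OF d, of "4 * pi"]]
      show "(G has_real_derivative 2 * pi * t / s\<^sup>2 * (A C - A (t / (2 * s)))) (at s)"
        unfolding G_def by (simp add: algebra_simps diff_divide_distrib)
      have "t / (2 * s) \<le> C" using s sp C by (simp add: field_simps)
      from Amono[OF this] show "0 \<le> 2 * pi * t / s\<^sup>2 * (A C - A (t / (2 * s)))" using t by simp
    next
      have z: "((\<lambda>s. t / (2 * s)) \<longlongrightarrow> 0) at_top" by real_asymp
      have "isCont B 0" using dB DERIV_isCont by blast
      then have "((\<lambda>s. B (t / (2 * s))) \<longlongrightarrow> B 0) at_top" using z by (rule isCont_tendsto_compose)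
      moreover have "((\<lambda>s. 2 * pi * t / s * A C) \<longlongrightarrow> 0) at_top" by real_asymp
      ultimately have "(G \<longlongrightarrow> - 0 + 4 * pi * B 0) at_top"
        unfolding G_def by (intro tendsto_add tendsto_minus tendsto_mult_left)
      then show "(G \<longlongrightarrow> 0) at_top" by (simp add: B_def)
    qed
    moreover have "G (t / (2 * C)) = - (4 * pi * C * A C) + 4 * pi * B C"
    proof -
      have "t / (2 * (t / (2 * C))) = C" "2 * pi * t / (t / (2 * C)) = 4 * pi * C" using t C by (simp_all add: field_simps)
      then show ?thesis unfolding G_def by simp
    qed
    ultimately show ?thesis by simp
  qed
  also have "0 - (- (4 * pi * C * A C) + 4 * pi * B C) = 4 * pi * (C ^ 4 / 12 + \<kappa> * C ^ 6 / 60)"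
    unfolding A_def B_def by (simp add: field_simps power2_eq_square power3_eq_cube eval_nat_numeral)
  finally show ?thesis .
qed

section \<open>Matrices in $\mathrm{SL}_2(\mathbb C)$\<close>

abbreviation psl :: "complex^2^2 \<Rightarrow> (complex^2^2) set" where
  "psl A \<equiv> {mat 1, - mat 1} #>\<^bsub>SL2C\<^esub> A"

lemma psl_eq: "psl A = {A, - A}"
  by (auto simp: r_coset_def SL2C_def minus_mat_one_mult)

lemma carrier_PSL2C: "carrier PSL2C = psl ` {A. det A = 1}"
  by (simp add: PSL2C_def carrier_FactGroup SL2C_def)

lemma psl_mult:
  assumes "det A = 1" "det B = 1"
  shows "psl A \<otimes>\<^bsub>PSL2C\<^esub> psl B = psl (A ** B)"
  using normal.rcos_sum[OF normal_center_SL2C, of A B] assms by (simp add: PSL2C_def SL2C_def)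

lemma one_PSL2C: "\<one>\<^bsub>PSL2C\<^esub> = psl (mat 1)"
  by (simp add: PSL2C_def psl_eq)

lemma PSL2C_lift:
  assumes "g \<in> carrier PSL2C"
  obtains A where "det A = 1" "g = psl A"
  using assms by (auto simp: carrier_PSL2C)

text \<open>The adjugate, an inverse on determinant 1 whose entries visibly pass to limits.\<close>

definition adj2 :: "complex^2^2 \<Rightarrow> complex^2^2" where
  "adj2 A = (\<chi> i j. if i = j then A $ (if i = 1 then 2 else 1) $ (if i = 1 then 2 else 1) else - A $ i $ j)"

lemma adj2_entries [simp]:
  "adj2 A $ 1 $ 1 = A $ 2 $ 2" "adj2 A $ 1 $ 2 = - A $ 1 $ 2" "adj2 A $ 2 $ 1 = - A $ 2 $ 1" "adj2 A $ 2 $ 2 = A $ 1 $ 1"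
  by (simp_all add: adj2_def)

lemma mat2_eq_iff:
  fixes A B :: "complex^2^2"
  shows "A = B \<longleftrightarrow> A $ 1 $ 1 = B $ 1 $ 1 \<and> A $ 1 $ 2 = B $ 1 $ 2 \<and> A $ 2 $ 1 = B $ 2 $ 1 \<and> A $ 2 $ 2 = B $ 2 $ 2"
  by (auto simp: vec_eq_iff forall_2)

lemma mat2_mult:
  fixes A B :: "complex^2^2"
  shows "(A ** B) $ i $ j = A $ i $ 1 * B $ 1 $ j + A $ i $ 2 * B $ 2 $ j"
  by (simp add: matrix_matrix_mult_def sum_2)

lemma mat2_one [simp]:
  "(mat 1 :: complex^2^2) $ 1 $ 1 = 1" "(mat 1 :: complex^2^2) $ 1 $ 2 = 0"
  "(mat 1 :: complex^2^2) $ 2 $ 1 = 0" "(mat 1 :: complex^2^2) $ 2 $ 2 = 1"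
  by (simp_all add: mat_def)

lemma adj2_inverse:
  assumes "det A = 1"
  shows "A ** adj2 A = mat 1" "adj2 A ** A = mat 1" "det (adj2 A) = 1"
  using assms by (simp_all add: mat2_eq_iff mat2_mult det_2 algebra_simps)

lemma norm_mat2: "(norm A)\<^sup>2 = (cmod (A$1$1))\<^sup>2 + (cmod (A$1$2))\<^sup>2 + (cmod (A$2$1))\<^sup>2 + (cmod (A$2$2))\<^sup>2"
  for A :: "complex^2^2"
  by (simp add: norm_vec_def L2_set_def sum_2)

text \<open>It turns a bound on the displacement of \<open>jpt\<close> into a bound on the matrix;
  this is how discreteness of the group becomes local finiteness.\<close>

lemma hcosh_jpt_act:
  assumes "det A = 1"
  shows "2 * hcosh jpt (poincare_ext A jpt) = (norm A)\<^sup>2"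
proof -
  interpret sl2 A by unfold_locales fact
  have j: "herm_a jpt = 1" "herm_b jpt = 0" "herm_d jpt = 1" by (simp_all add: herm_a_def herm_b_def herm_d_def jpt_def)
  have "complex_of_real (2 * hcosh jpt (poincare_ext A jpt)) = complex_of_real ((norm A)\<^sup>2)"
    unfolding hcosh_herm[OF jpt_H3 poincare_ext_H3[OF jpt_H3]] herm_a_act[OF jpt_H3] herm_d_act[OF jpt_H3] j norm_mat2
    by (simp add: complex_norm_square[symmetric] del: of_real_power)
  then show ?thesis by (simp only: of_real_eq_iff)
qed

text \<open>The conclusion is A B = B U with U upper triangular and diagonal \<nu>, 1 / \<nu>. As
  the eigenvalues have product 1, one of them has modulus at least 1, and its eigenvector is the
  first column of B. Diagonalisable and parabolic matrices are treated alike.\<close>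

lemma triangularize:
  fixes A :: "complex^2^2"
  assumes det: "det A = 1"
  obtains B \<nu> \<tau> where "det B = 1" "\<nu> \<noteq> 0" "cmod \<nu> \<ge> 1"
    "(A ** B) $ 1 $ 1 = \<nu> * B $ 1 $ 1" "(A ** B) $ 2 $ 1 = \<nu> * B $ 2 $ 1"
    "(A ** B) $ 1 $ 2 = \<tau> * B $ 1 $ 1 + B $ 1 $ 2 / \<nu>" "(A ** B) $ 2 $ 2 = \<tau> * B $ 2 $ 1 + B $ 2 $ 2 / \<nu>"
proof -
  define T where "T = A $ 1 $ 1 + A $ 2 $ 2"
  have d: "A $ 1 $ 1 * A $ 2 $ 2 - A $ 1 $ 2 * A $ 2 $ 1 = 1" using det by (simp add: det_2)
  define u where "u = csqrt (T\<^sup>2 - 4)"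
  have u: "u * u = T * T - 4" unfolding u_def by (simp flip: power2_eq_square)
  define x where "x = (T + u) / 2"
  have x: "x * x - T * x + 1 = 0"
  proof -
    have "4 * (x * x - T * x + 1) = u * u - (T * T - 4)" by (simp add: x_def field_simps)
    also have "\<dots> = 0" unfolding u by simp
    finally show ?thesis by (metis mult_eq_0_iff zero_neq_numeral)
  qed
  have "x \<noteq> 0" using x by auto
  obtain \<nu> where \<nu>: "\<nu> \<noteq> 0" "cmod \<nu> \<ge> 1" "\<nu> * \<nu> - T * \<nu> + 1 = 0"
  proof (cases "cmod x \<ge> 1")
    case True
    then show ?thesis using that \<open>x \<noteq> 0\<close> x by blast
  next
    case False
    have "1 / x * (1 / x) - T * (1 / x) + 1 = (x * x - T * x + 1) / (x * x)" using \<open>x \<noteq> 0\<close> by (simp add: field_simps)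
    then have "1 / x * (1 / x) - T * (1 / x) + 1 = 0" using x by simp
    moreover have "cmod (1 / x) \<ge> 1" using False \<open>x \<noteq> 0\<close> by (simp add: norm_divide)
    ultimately show ?thesis using that[of "1 / x"] \<open>x \<noteq> 0\<close> by simp
  qed
  have ch: "(A $ 1 $ 1 - \<nu>) * (A $ 2 $ 2 - \<nu>) = A $ 1 $ 2 * A $ 2 $ 1"
  proof -
    have "(A $ 1 $ 1 - \<nu>) * (A $ 2 $ 2 - \<nu>) = \<nu> * \<nu> - T * \<nu> + A $ 1 $ 1 * A $ 2 $ 2" by (simp add: T_def algebra_simps)
    also have "\<dots> = A $ 1 $ 1 * A $ 2 $ 2 - 1" using \<nu>(3) by (simp add: algebra_simps)
    also have "\<dots> = A $ 1 $ 2 * A $ 2 $ 1" using d by (simp add: algebra_simps)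
    finally show ?thesis .
  qed
  \<comment> \<open>An eigenvector is read off a nonzero row of A - \<nu>; if both rows vanish, any
    nonzero vector serves.\<close>
  obtain p q where pq: "p \<noteq> 0 \<or> q \<noteq> 0" and "(A $ 1 $ 1 - \<nu>) * p + A $ 1 $ 2 * q = 0" "A $ 2 $ 1 * p + (A $ 2 $ 2 - \<nu>) * q = 0"
  proof (cases "A $ 1 $ 2 = 0 \<and> A $ 1 $ 1 = \<nu>")
    case False
    then show ?thesis using that[of "A $ 1 $ 2" "\<nu> - A $ 1 $ 1"] ch by (auto simp: algebra_simps)
  next
    case True
    show ?thesis
    proof (cases "A $ 2 $ 1 = 0 \<and> A $ 2 $ 2 = \<nu>")
      case False
      then show ?thesis using True that[of "\<nu> - A $ 2 $ 2" "A $ 2 $ 1"] by (auto simp: algebra_simps)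
    next
      case True2: True
      then show ?thesis using True that[of 1 0] by simp
    qed
  qed
  then have ev: "A $ 1 $ 1 * p + A $ 1 $ 2 * q = \<nu> * p" "A $ 2 $ 1 * p + A $ 2 $ 2 * q = \<nu> * q"
    by (simp_all add: algebra_simps)
  define n where "n = p * cnj p + q * cnj q"
  have "n = of_real ((cmod p)\<^sup>2 + (cmod q)\<^sup>2)"
    unfolding n_def of_real_add complex_norm_square ..
  moreover have "(cmod p)\<^sup>2 + (cmod q)\<^sup>2 \<noteq> 0" using pq by (simp add: sum_power2_eq_zero_iff)
  ultimately have n: "n \<noteq> 0" by (metis of_real_eq_0_iff)
  \<comment> \<open>The vector orthogonal to the eigenvector, scaled so that the two columns have
    determinant 1.\<close>
  define r s where "r = - cnj q / n" and "s = cnj p / n"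
  have "p * s - r * q = (p * cnj p + q * cnj q) / n" by (simp add: r_def s_def add_divide_distrib mult.commute)
  then have prs: "p * s - r * q = 1" using n by (simp add: n_def[symmetric])
  define B :: "complex^2^2" where "B = vector [vector [p, r], vector [q, s]]"
  have B: "B $ 1 $ 1 = p" "B $ 1 $ 2 = r" "B $ 2 $ 1 = q" "B $ 2 $ 2 = s" by (simp_all add: B_def)
  define y z where "y = A $ 1 $ 1 * r + A $ 1 $ 2 * s" and "z = A $ 2 $ 1 * r + A $ 2 $ 2 * s"
  define \<tau> where "\<tau> = y * s - z * r"
  have yz: "p * z - q * y = 1 / \<nu>"
  proof -
    have "\<nu> * (p * z - q * y) = (A $ 1 $ 1 * p + A $ 1 $ 2 * q) * z - (A $ 2 $ 1 * p + A $ 2 $ 2 * q) * y"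
      unfolding ev by (simp add: algebra_simps)
    also have "\<dots> = (A $ 1 $ 1 * A $ 2 $ 2 - A $ 1 $ 2 * A $ 2 $ 1) * (p * s - r * q)"
      by (simp add: y_def z_def algebra_simps)
    also have "\<dots> = 1" using d prs by simp
    finally show ?thesis using \<nu>(1) by (simp add: field_simps)
  qed
  have "\<tau> * p + r * (p * z - q * y) = y * (p * s - r * q)" "\<tau> * q + s * (p * z - q * y) = z * (p * s - r * q)"
    by (simp_all add: \<tau>_def algebra_simps)
  then have "\<tau> * p + r / \<nu> = y" "\<tau> * q + s / \<nu> = z" unfolding yz prs by simp_all
  then show ?thesis
    using that[of B \<nu> \<tau>] prs ev \<nu> by (simp add: B det_2 mat2_mult y_def z_def)
qed

section \<open>The lattice of a closed hyperbolic 3-manifold\<close>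

lemma PSL2C_act_psl [simp]: "PSL2C_act (psl A) p = poincare_ext A p"
  by (rule PSL2C_act_coset)

lemma inv_psl:
  assumes "det A = 1"
  shows "inv\<^bsub>PSL2C\<^esub> (psl A) = psl (adj2 A)"
proof -
  interpret group PSL2C by (rule group_PSL2C)
  show ?thesis
    using assms adj2_inverse[OF assms]
    by (intro inv_equality) (auto simp: psl_mult one_PSL2C carrier_PSL2C)
qed

locale hyp_manifold =
  fixes \<Gamma> :: "(complex^2^2) set set"
  assumes closed: "closed_hyperbolic_3_manifold \<Gamma>"
begin

sublocale PSL: group PSL2C by (rule group_PSL2C)

lemma subgroup: "subgroup \<Gamma> PSL2C"
  using closed by (simp add: closed_hyperbolic_3_manifold_def)

lemma lift:
  assumes "g \<in> \<Gamma>"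
  obtains A where "det A = 1" "g = psl A"
  using PSL2C_lift subgroup.mem_carrier[OF subgroup assms] by blast

lemma psl_divide:
  assumes "det A = 1" "det B = 1" "psl A \<in> \<Gamma>" "psl B \<in> \<Gamma>"
  shows "psl (A ** adj2 B) \<in> \<Gamma>"
proof -
  have "psl A \<otimes>\<^bsub>PSL2C\<^esub> inv\<^bsub>PSL2C\<^esub> (psl B) \<in> \<Gamma>"
    using assms by (intro subgroup.m_closed[OF subgroup] subgroup.m_inv_closed[OF subgroup])
  then show ?thesis using assms adj2_inverse(3)[OF assms(2)] by (simp add: inv_psl psl_mult)
qed

text \<open>The open set that isolates the identity in the group is pulled back to matrices. The
  distance to \<open>- mat 1\<close> enters the radius because that matrix represents the identity
  too.\<close>

lemma isolated_one:
  obtains \<epsilon> where "\<epsilon> > 0" "\<And>A. det A = 1 \<Longrightarrow> psl A \<in> \<Gamma> \<Longrightarrow> dist A (mat 1) < \<epsilon> \<Longrightarrow> A = mat 1"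
proof -
  have one: "psl (mat 1) \<in> \<Gamma>" using subgroup.one_closed[OF subgroup] by (simp add: one_PSL2C)
  have "openin (subtopology PSL2C_topology \<Gamma>) {psl (mat 1)}"
    using closed one by (simp add: closed_hyperbolic_3_manifold_def)
  then obtain U where U: "openin PSL2C_topology U" "{psl (mat 1)} = U \<inter> \<Gamma>"
    unfolding openin_subtopology by blast
  have "openin (top_of_set (carrier SL2C)) {A \<in> carrier SL2C. psl A \<in> U}"
    using U(1) by (simp add: PSL2C_topology_def openin_quotient_topology)
  then obtain T where T: "open T" "{A \<in> carrier SL2C. psl A \<in> U} = T \<inter> carrier SL2C"
    unfolding openin_open by blast
  have "psl (mat 1) \<in> U \<inter> \<Gamma>" unfolding U(2)[symmetric] by simp
  then have "mat 1 \<in> {A \<in> carrier SL2C. psl A \<in> U}" by (simp add: SL2C_def)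
  then have "mat 1 \<in> T" unfolding T(2) by simp
  then obtain e where e: "e > 0" "ball (mat 1) e \<subseteq> T" using T(1) by (meson open_contains_ball)
  have ne: "(mat 1 :: complex^2^2) \<noteq> - mat 1" by (simp add: mat2_eq_iff)
  show ?thesis
  proof (rule that[of "min e (dist (mat 1 :: complex^2^2) (- mat 1))"])
    show "min e (dist (mat 1 :: complex^2^2) (- mat 1)) > 0" using e ne by simp
    fix A :: "complex^2^2"
    assume A: "det A = 1" "psl A \<in> \<Gamma>" "dist A (mat 1) < min e (dist (mat 1 :: complex^2^2) (- mat 1))"
    then have "A \<in> T" using e by (auto simp: dist_commute subset_iff)
    then have "A \<in> T \<inter> carrier SL2C" using A(1) by (simp add: SL2C_def)
    then have "psl A \<in> U" unfolding T(2)[symmetric] by simp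
    then have "psl A \<in> {psl (mat 1)}" unfolding U(2) using A(2) by simp
    then have "{A, - A} = {mat 1, - mat 1}" by (simp add: psl_eq)
    then have "A = mat 1 \<or> A = - mat 1" by blast
    then show "A = mat 1" using A(3) by (auto simp: dist_commute)
  qed
qed

text \<open>An infinite set would accumulate at a matrix l of determinant 1. Along a sequence of
  members other than l that tends to l, quotients of consecutive terms tend to the identity, hence
  eventually equal it. The sequence would then be eventually constant, with value l.\<close>

lemma finite_bounded: "finite {A. det A = 1 \<and> psl A \<in> \<Gamma> \<and> norm A \<le> r}"
proof (rule ccontr)
  assume inf: "infinite {A. det A = 1 \<and> psl A \<in> \<Gamma> \<and> norm A \<le> r}" (is "infinite ?S")
  have "compact (cball (0::complex^2^2) r)" by simp
  moreover have "?S \<subseteq> cball 0 r" by auto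
  ultimately obtain l where "l islimpt ?S"
    using inf unfolding compact_eq_Bolzano_Weierstrass by blast
  then obtain f where f: "\<And>n. f n \<in> ?S - {l}" and lim: "f \<longlonglongrightarrow> l"
    unfolding islimpt_sequential by blast
  have c: "(\<lambda>n. f n $ i $ j) \<longlonglongrightarrow> l $ i $ j" for i j
    by (intro tendsto_vec_nth lim)
  have c': "(\<lambda>n. f (Suc n) $ i $ j) \<longlonglongrightarrow> l $ i $ j" for i j
    using LIMSEQ_Suc[OF c] .
  have "(\<lambda>n. det (f n)) \<longlonglongrightarrow> det l" unfolding det_2 by (intro tendsto_intros c)
  moreover have "(\<lambda>n. det (f n)) = (\<lambda>n. 1)" using f by auto
  ultimately have l: "det l = 1" by (simp add: LIMSEQ_const_iff)
  have "(\<lambda>n. f n ** adj2 (f (Suc n))) \<longlonglongrightarrow> l ** adj2 l"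
  proof (intro vec_tendstoI)
    fix i j :: 2
    have "(\<lambda>n. (adj2 (f (Suc n))) $ k $ m) \<longlonglongrightarrow> adj2 l $ k $ m" for k m :: 2
      using exhaust_2[of k] exhaust_2[of m] by (auto intro!: tendsto_minus c')
    then show "(\<lambda>n. (f n ** adj2 (f (Suc n))) $ i $ j) \<longlonglongrightarrow> (l ** adj2 l) $ i $ j"
      unfolding mat2_mult by (intro tendsto_add tendsto_mult c)
  qed
  then have lim1: "(\<lambda>n. f n ** adj2 (f (Suc n))) \<longlonglongrightarrow> mat 1" using adj2_inverse[OF l] by simp
  obtain \<epsilon> where \<epsilon>: "\<epsilon> > 0" "\<And>A. det A = 1 \<Longrightarrow> psl A \<in> \<Gamma> \<Longrightarrow> dist A (mat 1) < \<epsilon> \<Longrightarrow> A = mat 1"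
    by (rule isolated_one) blast
  obtain N where N: "\<And>n. n \<ge> N \<Longrightarrow> dist (f n ** adj2 (f (Suc n))) (mat 1) < \<epsilon>"
    using lim1 \<epsilon>(1) unfolding lim_sequentially by blast
  have step: "f (Suc n) = f n" if "n \<ge> N" for n
  proof -
    have d: "det (f n) = 1" "det (f (Suc n)) = 1" "psl (f n) \<in> \<Gamma>" "psl (f (Suc n)) \<in> \<Gamma>" using f by auto
    have "f n ** adj2 (f (Suc n)) = mat 1"
      using d N[OF that] psl_divide[OF d] adj2_inverse(3)[OF d(2)] by (intro \<epsilon>(2)) (simp_all add: det_mul)
    then have "(f n ** adj2 (f (Suc n))) ** f (Suc n) = f (Suc n)" by simp
    then show ?thesis using adj2_inverse[OF d(2)] by (simp add: matrix_mul_assoc[symmetric])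
  qed
  have "f (N + n) = f N" for n by (induction n) (use step in auto)
  then have "(\<lambda>n. f (n + N)) = (\<lambda>n. f N)" by (simp add: add.commute)
  then have "f N = l" using LIMSEQ_ignore_initial_segment[OF lim, of N] by (simp add: LIMSEQ_const_iff)
  then show False using f[of N] by auto
qed

lemma act_mult':
  assumes "g \<in> \<Gamma>" "h \<in> \<Gamma>" "x \<in> H3"
  shows "PSL2C_act (g \<otimes>\<^bsub>PSL2C\<^esub> h) x = PSL2C_act g (PSL2C_act h x)"
proof -
  obtain A B where "det A = 1" "g = psl A" "det B = 1" "h = psl B" using assms lift by metis
  then show ?thesis using assms by (simp only: psl_mult PSL2C_act_psl poincare_ext_mult)
qed

lemma act_one': "PSL2C_act \<one>\<^bsub>PSL2C\<^esub> x = x"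
  unfolding one_PSL2C by (simp add: poincare_ext_one)

lemma isometry:
  assumes "g \<in> \<Gamma>"
  shows "hyp_isometry (PSL2C_act g) (PSL2C_act (inv\<^bsub>PSL2C\<^esub> g))"
proof -
  obtain A where A: "det A = 1" "g = psl A" using assms lift by metis
  have "PSL2C_act (psl A) = poincare_ext A" for A by (simp add: fun_eq_iff)
  then show ?thesis
    unfolding A(2) inv_psl[OF A(1)] using hyp_isometry_poincare_ext adj2_inverse[OF A(1)] A(1) by simp
qed

lemma finite_orbit:
  assumes p: "p \<in> H3" and q: "q \<in> H3"
  shows "finite {g \<in> \<Gamma>. hcosh p (PSL2C_act g q) \<le> r}"
proof -
  \<comment> \<open>One factor 2 comes from \<open>hcosh_jpt_act\<close>, the other two from
    interposing p and the image of q between \<open>jpt\<close> and its image.\<close>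
  define b where "b = 8 * hcosh jpt p * \<bar>r\<bar> * hcosh q jpt"
  have "{g \<in> \<Gamma>. hcosh p (PSL2C_act g q) \<le> r} \<subseteq> psl ` {A. det A = 1 \<and> psl A \<in> \<Gamma> \<and> norm A \<le> sqrt b}"
  proof
    fix g assume g: "g \<in> {g \<in> \<Gamma>. hcosh p (PSL2C_act g q) \<le> r}"
    then obtain A where A: "det A = 1" "g = psl A" using lift by blast
    interpret A: sl2 A by unfold_locales fact
    have le: "hcosh p (poincare_ext A q) \<le> \<bar>r\<bar>" using g abs_ge_self[of r] by (simp add: A(2))
    have pos: "hcosh jpt p \<ge> 1" "hcosh q jpt \<ge> 1" by (auto intro!: hcosh_ge_1 p q jpt_H3)
    note H = p q jpt_H3 A.poincare_ext_H3[OF q] A.poincare_ext_H3[OF jpt_H3]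
    have "(norm A)\<^sup>2 = 2 * hcosh jpt (poincare_ext A jpt)" using hcosh_jpt_act[OF A(1)] by simp
    also have "\<dots> \<le> 2 * (2 * hcosh jpt p * hcosh p (poincare_ext A jpt))"
      by (intro mult_left_mono hcosh_le_mult H) auto
    also have "\<dots> \<le> 2 * (2 * hcosh jpt p * (2 * hcosh p (poincare_ext A q) * hcosh (poincare_ext A q) (poincare_ext A jpt)))"
      using pos by (intro mult_left_mono hcosh_le_mult H) auto
    also have "\<dots> = (8 * hcosh jpt p * hcosh q jpt) * hcosh p (poincare_ext A q)"
      using A.hcosh_poincare_ext[OF q jpt_H3] by simp
    also have "\<dots> \<le> (8 * hcosh jpt p * hcosh q jpt) * \<bar>r\<bar>"
      using pos le by (intro mult_left_mono) auto
    finally have "(norm A)\<^sup>2 \<le> b" by (simp add: b_def mult_ac)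
    then have "norm A \<le> sqrt b" by (rule real_le_rsqrt)
    then show "g \<in> psl ` {A. det A = 1 \<and> psl A \<in> \<Gamma> \<and> norm A \<le> sqrt b}" using A g by auto
  qed
  then show ?thesis using finite_bounded finite_surj by blast
qed

text \<open>All powers of g fix p, so by local finiteness two of them coincide, and absence of
  torsion makes g trivial.\<close>

lemma free':
  assumes g: "g \<in> \<Gamma>" and p: "p \<in> H3" and stab: "PSL2C_act g p = p"
  shows "g = \<one>\<^bsub>PSL2C\<^esub>"
proof -
  have gc: "g \<in> carrier PSL2C" using subgroup.mem_carrier[OF subgroup g] .
  have pow: "g [^]\<^bsub>PSL2C\<^esub> n \<in> \<Gamma> \<and> PSL2C_act (g [^]\<^bsub>PSL2C\<^esub> n) p = p" for n :: nat
  proof (induction n)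
    case 0
    then show ?case using subgroup.one_closed[OF subgroup] by (simp add: act_one')
  next
    case (Suc n)
    then show ?case using g p stab subgroup.m_closed[OF subgroup] by (simp add: act_mult')
  qed
  have "range (\<lambda>n::nat. g [^]\<^bsub>PSL2C\<^esub> n) \<subseteq> {h \<in> \<Gamma>. hcosh p (PSL2C_act h p) \<le> 1}"
    using pow by auto
  then have "finite (range (\<lambda>n::nat. g [^]\<^bsub>PSL2C\<^esub> n))" using finite_orbit[OF p p] finite_subset by blast
  then have "\<not> inj (\<lambda>n::nat. g [^]\<^bsub>PSL2C\<^esub> n)" using finite_imageD by blast
  then obtain m n :: nat where mn: "g [^]\<^bsub>PSL2C\<^esub> m = g [^]\<^bsub>PSL2C\<^esub> n" "m < n"
    unfolding inj_def by (metis linorder_neqE_nat)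
  have "g [^]\<^bsub>PSL2C\<^esub> m \<otimes>\<^bsub>PSL2C\<^esub> g [^]\<^bsub>PSL2C\<^esub> (n - m) = g [^]\<^bsub>PSL2C\<^esub> m"
    using PSL.nat_pow_mult[OF gc, of m "n - m"] mn by simp
  then have "g [^]\<^bsub>PSL2C\<^esub> (n - m) = \<one>\<^bsub>PSL2C\<^esub>" using gc by simp
  then show ?thesis using closed g mn(2) unfolding closed_hyperbolic_3_manifold_def by (metis zero_less_diff)
qed

lemma orbit_proj_eq: "orbit_proj \<Gamma> x = (\<lambda>g. PSL2C_act g x) ` \<Gamma>"
  by (auto simp: orbit_proj_def orbit_def)

lemma topspace_quotient_space: "topspace (quotient_space \<Gamma>) = orbit_proj \<Gamma> ` H3"
  by (simp add: quotient_space_def topspace_quotient_topology)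

lemma orbit_proj_eq_iff:
  assumes x: "x \<in> H3" and y: "y \<in> H3"
  shows "orbit_proj \<Gamma> x = orbit_proj \<Gamma> y \<longleftrightarrow> (\<exists>g\<in>\<Gamma>. PSL2C_act g x = y)"
proof
  assume eq: "orbit_proj \<Gamma> x = orbit_proj \<Gamma> y"
  have "y \<in> orbit_proj \<Gamma> y"
    unfolding orbit_proj_eq using act_one'[of y] subgroup.one_closed[OF subgroup] by (metis imageI)
  then have "y \<in> orbit_proj \<Gamma> x" by (simp add: eq)
  then show "\<exists>g\<in>\<Gamma>. PSL2C_act g x = y" unfolding orbit_proj_eq by auto
next
  assume "\<exists>g\<in>\<Gamma>. PSL2C_act g x = y"
  then obtain g where g: "g \<in> \<Gamma>" "PSL2C_act g x = y" by blast
  have gi: "inv\<^bsub>PSL2C\<^esub> g \<in> \<Gamma>" using subgroup.m_inv_closed[OF subgroup g(1)] .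
  have gc: "g \<in> carrier PSL2C" using subgroup.mem_carrier[OF subgroup g(1)] .
  have ix: "PSL2C_act (inv\<^bsub>PSL2C\<^esub> g) y = x"
    using act_mult'[OF gi g(1) x] gc g by (simp add: act_one')
  have sub: "orbit_proj \<Gamma> (PSL2C_act h z) \<subseteq> orbit_proj \<Gamma> z" if "h \<in> \<Gamma>" "z \<in> H3" for h z
    unfolding orbit_proj_eq using that subgroup.m_closed[OF subgroup] by (force simp flip: act_mult')
  show "orbit_proj \<Gamma> x = orbit_proj \<Gamma> y"
    using sub[OF g(1) x] sub[OF gi y] by (simp add: g ix)
qed

text \<open>Images of balls around \<open>jpt\<close> are open in the quotient because their
  preimages are unions of translated balls; compactness selects finitely many radii.\<close>

lemma cocompact': "\<exists>r. \<forall>p\<in>H3. \<exists>g\<in>\<Gamma>. hcosh jpt (PSL2C_act g p) \<le> r"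
proof -
  define U where "U n = orbit_proj \<Gamma> ` hball jpt (real n)" for n :: nat
  have op: "openin (quotient_space \<Gamma>) (U n)" for n
  proof -
    have "{x \<in> H3. orbit_proj \<Gamma> x \<in> U n} = (\<Union>g\<in>\<Gamma>. PSL2C_act g -` hball jpt (real n) \<inter> H3)"
    proof (intro Set.set_eqI iffI)
      fix x assume "x \<in> {x \<in> H3. orbit_proj \<Gamma> x \<in> U n}"
      then obtain y where "x \<in> H3" "y \<in> hball jpt (real n)" "orbit_proj \<Gamma> x = orbit_proj \<Gamma> y" by (auto simp: U_def)
      then show "x \<in> (\<Union>g\<in>\<Gamma>. PSL2C_act g -` hball jpt (real n) \<inter> H3)"
        using orbit_proj_eq_iff[of x y] by (auto simp: hball_def)
    next
      fix x assume "x \<in> (\<Union>g\<in>\<Gamma>. PSL2C_act g -` hball jpt (real n) \<inter> H3)"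
      then obtain g where g: "g \<in> \<Gamma>" "x \<in> H3" "PSL2C_act g x \<in> hball jpt (real n)" by blast
      then have "orbit_proj \<Gamma> x = orbit_proj \<Gamma> (PSL2C_act g x)"
        using orbit_proj_eq_iff[of x "PSL2C_act g x"] by (auto simp: hball_def)
      then show "x \<in> {x \<in> H3. orbit_proj \<Gamma> x \<in> U n}" using g unfolding U_def by blast
    qed
    moreover have "open (PSL2C_act g -` hball jpt (real n) \<inter> H3)" if "g \<in> \<Gamma>" for g
      using hyp_isometry.open_vimage_Int[OF isometry[OF that] open_hball[OF jpt_H3]] by (auto simp: hball_def)
    ultimately have "open {x \<in> H3. orbit_proj \<Gamma> x \<in> U n}" by (simp only:) (rule open_UN, blast)
    moreover have "U n \<subseteq> orbit_proj \<Gamma> ` H3" by (auto simp: U_def hball_def)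
    ultimately show ?thesis unfolding quotient_space_def openin_quotient_topology
      by (auto simp: open_subset)
  qed
  have cov: "topspace (quotient_space \<Gamma>) \<subseteq> \<Union> (range U)"
  proof
    fix y assume "y \<in> topspace (quotient_space \<Gamma>)"
    then obtain x where x: "x \<in> H3" "y = orbit_proj \<Gamma> x" by (auto simp: topspace_quotient_space)
    obtain n :: nat where "hcosh jpt x < real n" using reals_Archimedean2 by blast
    then show "y \<in> \<Union> (range U)" using x by (auto simp: U_def hball_def)
  qed
  have "compact_space (quotient_space \<Gamma>)" using closed by (simp add: closed_hyperbolic_3_manifold_def)
  moreover have "\<forall>V\<in>range U. openin (quotient_space \<Gamma>) V" using op by blast
  ultimately obtain \<F> where F: "finite \<F>" "\<F> \<subseteq> range U" "topspace (quotient_space \<Gamma>) \<subseteq> \<Union>\<F>"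
    unfolding compact_space_alt using cov by (auto elim!: allE[of _ "range U"])
  then obtain N where N: "finite N" "\<F> = U ` N" using finite_subset_image by metis
  show ?thesis
  proof (intro exI[of _ "real (Max (insert 0 N))"] ballI)
    fix p assume p: "p \<in> H3"
    then have "orbit_proj \<Gamma> p \<in> \<Union> (U ` N)" using F(3) N by (auto simp: topspace_quotient_space)
    then obtain n x where n: "n \<in> N" and x: "x \<in> hball jpt (real n)" "orbit_proj \<Gamma> p = orbit_proj \<Gamma> x"
      by (auto simp: U_def)
    then obtain g where g: "g \<in> \<Gamma>" "PSL2C_act g p = x" using orbit_proj_eq_iff[OF p, of x] by (auto simp: hball_def)
    have "n \<le> Max (insert 0 N)" using n N(1) by (intro Max_ge) auto
    then have "hcosh jpt x \<le> real (Max (insert 0 N))" using x by (simp add: hball_def)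
    then show "\<exists>g\<in>\<Gamma>. hcosh jpt (PSL2C_act g p) \<le> real (Max (insert 0 N))" using g by blast
  qed
qed

sublocale hyp_lattice "PSL2C\<lparr>carrier := \<Gamma>\<rparr>" PSL2C_act
proof -
  interpret G: group "PSL2C\<lparr>carrier := \<Gamma>\<rparr>" by (rule subgroup.subgroup_is_group[OF subgroup group_PSL2C])
  have carrier: "carrier (PSL2C\<lparr>carrier := \<Gamma>\<rparr>) = \<Gamma>" by simp
  show "hyp_lattice (PSL2C\<lparr>carrier := \<Gamma>\<rparr>) PSL2C_act"
  proof (rule hyp_lattice.intro[OF G.group_axioms], rule hyp_lattice_axioms.intro, unfold carrier, goal_cases)
    case (1 g h x)
    then show ?case using act_mult' by simp
  next
    case (2 x)
    then show ?case using act_one' by simp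
  next
    case (3 g x)
    then show ?case using hyp_isometry.g_H3[OF isometry] by blast
  next
    case (4 g)
    then show ?case using hyp_isometry.g_meas[OF isometry] by blast
  next
    case (5 g x y)
    then show ?case using hyp_isometry.g_iso[OF isometry] by blast
  next
    case (6 g f)
    show ?case by (rule hyp_isometry.nn_integral_isometry[OF isometry[OF 6(1)] 6(2)])
  next
    case (7 p q r)
    then show ?case by (rule finite_orbit)
  next
    case (8 g p)
    then have "g = \<one>\<^bsub>PSL2C\<^esub>" by (rule free')
    then show ?case by simp
  next
    case 9
    show ?case by (rule cocompact')
  qed
qed

end

context hyp_lattice
begin

lemma hyp_isometry_act:
  assumes "g \<in> carrier G"
  shows "hyp_isometry (act g) (act (inv g))"
  using assms by unfold_locales (auto simp: act_meas act_H3 act_hcosh act_inv act_inv')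

section \<open>A fundamental set and the displacement of points\<close>

text \<open>The lexicographically smallest value of \<open>(hcosh jpt x, x)\<close> singles out one point in every orbit.\<close>

definition lex_less :: "complex \<times> real \<Rightarrow> complex \<times> real \<Rightarrow> bool" where
  "lex_less p q \<longleftrightarrow> hcosh jpt p < hcosh jpt q \<or> hcosh jpt p = hcosh jpt q \<and>
     (Re (fst p) < Re (fst q) \<or> Re (fst p) = Re (fst q) \<and>
     (Im (fst p) < Im (fst q) \<or> Im (fst p) = Im (fst q) \<and> snd p < snd q))"

lemma lex_less_trans: "lex_less p q \<Longrightarrow> lex_less q r \<Longrightarrow> lex_less p r"
  unfolding lex_less_def by (elim disjE conjE) auto

lemma lex_less_asym: "lex_less p q \<Longrightarrow> \<not> lex_less q p"
  unfolding lex_less_def by auto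

lemma lex_less_total: "p \<noteq> q \<Longrightarrow> lex_less p q \<or> lex_less q p"
  unfolding lex_less_def by (auto simp: prod_eq_iff complex_eq_iff)

lemma ex_is_fund: "\<exists>F. is_fund F"
proof -
  define F where "F = H3 \<inter> (\<Inter>g\<in>carrier G. {x. \<not> lex_less (act g x) x})"
  have "{x. \<not> lex_less (act g x) x} \<in> sets borel" if "g \<in> carrier G" for g
  proof -
    note act_meas[OF that, measurable]
    show ?thesis unfolding lex_less_def by measurable
  qed
  then have "F \<in> sets borel"
    unfolding F_def using countable_carrier by (intro sets.Int H3_borel sets.countable_INT'') auto
  moreover have "\<exists>!g. g \<in> carrier G \<and> act g x \<in> F" if x: "x \<in> H3" for x
  proof -
    \<comment> \<open>Only finitely many orbit points are as close to \<open>jpt\<close> as x, and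
      any point lexicographically below one of them is among them, so a minimum of the whole orbit
      exists.\<close>
    define S where "S = (\<lambda>g. act g x) ` {g \<in> carrier G. hcosh jpt (act g x) \<le> hcosh jpt x}"
    have "finite S" unfolding S_def using locally_finite[OF jpt_H3 x] by blast
    moreover have "x \<in> S" unfolding S_def using x act_one by (intro image_eqI[of _ _ \<one>]) auto
    moreover have "asymp_on S lex_less" by (intro asymp_onI lex_less_asym)
    moreover have "transp_on S lex_less" by (intro transp_onI) (rule lex_less_trans)
    ultimately obtain m where m: "m \<in> S" "\<forall>y\<in>S. y \<noteq> m \<longrightarrow> \<not> lex_less y m"
      using Finite_Set.bex_min_element[of S lex_less] by blast
    then obtain g where g: "g \<in> carrier G" "m = act g x" "hcosh jpt m \<le> hcosh jpt x" by (auto simp: S_def)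
    have "\<not> lex_less (act h m) m" if h: "h \<in> carrier G" for h
    proof
      assume l: "lex_less (act h m) m"
      then have "hcosh jpt (act h m) \<le> hcosh jpt x" using g(3) by (auto simp: lex_less_def)
      moreover have "act h m = act (h \<otimes> g) x" using g h x by (simp add: act_mult)
      ultimately have "act h m \<in> S" unfolding S_def using g h by (intro image_eqI[of _ _ "h \<otimes> g"]) auto
      then show False using m(2) l lex_less_asym[OF l] by auto
    qed
    then have mF: "act g x \<in> F" using g x act_H3 by (auto simp: F_def)
    have minF: "\<not> lex_less (act k y) y" if "y \<in> F" "k \<in> carrier G" for k y
      using that by (simp add: F_def)
    have uniq: "h = g" if h: "h \<in> carrier G" "act h x \<in> F" for h
    proof -
      have gh: "act (h \<otimes> inv g) (act g x) = act h x" "act (g \<otimes> inv h) (act h x) = act g x"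
        using g(1) h(1) x by (simp_all add: act_mult act_H3 act_inv)
      have "\<not> lex_less (act h x) (act g x)" "\<not> lex_less (act g x) (act h x)"
        using minF[OF mF, of "h \<otimes> inv g"] minF[OF h(2), of "g \<otimes> inv h"] g(1) h(1) by (simp_all add: gh)
      then have "act h x = act g x" using lex_less_total by blast
      then have "act (inv g \<otimes> h) x = x" using g(1) h(1) x by (simp add: act_mult act_H3 act_inv)
      then have "inv g \<otimes> h = \<one>" using g(1) h(1) by (intro free[OF _ x]) simp_all
      moreover have "g \<otimes> (inv g \<otimes> h) = h" using g(1) h(1) by (metis inv_closed l_one m_assoc r_inv)
      ultimately show ?thesis using g(1) by simp
    qed
    show ?thesis
    proof (rule ex1I[of _ g])
      show "g \<in> carrier G \<and> act g x \<in> F" using g(1) mF ..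
      show "h = g" if "h \<in> carrier G \<and> act h x \<in> F" for h using that uniq by blast
    qed
  qed
  moreover have "F \<subseteq> H3" by (simp add: F_def)
  ultimately have "is_fund F" unfolding is_fund_def by blast
  then show ?thesis by blast
qed

text \<open>Cleared of denominators, the inequality is closed in the whole space and itself forces
  positive height, so the set stays away from the boundary plane.\<close>

lemma compact_hcosh_le: "compact {p \<in> H3. hcosh jpt p \<le> r}"
proof (cases "r \<ge> 1")
  case False
  then have eq: "{p \<in> H3. hcosh jpt p \<le> r} = {}" using hcosh_ge_1[OF jpt_H3] by force
  show ?thesis unfolding eq by simp
next
  case True
  have eq: "{p \<in> H3. hcosh jpt p \<le> r} = {p. (cmod (fst p))\<^sup>2 + 1 + (snd p)\<^sup>2 \<le> 2 * r * snd p}"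
  proof (intro Set.set_eqI iffI)
    fix p assume "p \<in> {p \<in> H3. hcosh jpt p \<le> r}"
    then have p: "p \<in> H3" "hcosh jpt p \<le> r" by auto
    have "2 * snd p * hcosh jpt p \<le> 2 * snd p * r" using p by (intro mult_left_mono) (auto simp: H3_iff)
    then show "p \<in> {p. (cmod (fst p))\<^sup>2 + 1 + (snd p)\<^sup>2 \<le> 2 * r * snd p}"
      using hcosh_mult[OF jpt_H3 p(1)] by (simp add: jpt_def mult_ac)
  next
    fix p :: "complex \<times> real" assume "p \<in> {p. (cmod (fst p))\<^sup>2 + 1 + (snd p)\<^sup>2 \<le> 2 * r * snd p}"
    then have p: "(cmod (fst p))\<^sup>2 + 1 + (snd p)\<^sup>2 \<le> 2 * r * snd p" by simp
    moreover have "(cmod (fst p))\<^sup>2 \<ge> 0" "(snd p)\<^sup>2 \<ge> 0" by simp_all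
    ultimately have "2 * r * snd p > 0" by linarith
    then have pH: "p \<in> H3" using True by (simp add: H3_iff zero_less_mult_iff)
    have "2 * snd p * hcosh jpt p \<le> 2 * snd p * r"
      using hcosh_mult[OF jpt_H3 pH] p by (simp add: jpt_def mult_ac)
    then show "p \<in> {p \<in> H3. hcosh jpt p \<le> r}" using pH by (simp add: H3_iff)
  qed
  have "closed {p::complex \<times> real. (cmod (fst p))\<^sup>2 + 1 + (snd p)\<^sup>2 \<le> 2 * r * snd p}"
    by (intro closed_Collect_le continuous_intros)
  moreover have "{p::complex \<times> real. (cmod (fst p))\<^sup>2 + 1 + (snd p)\<^sup>2 \<le> 2 * r * snd p} \<subseteq> cball 0 (2 * r) \<times> {0..2 * r}"
  proof
    fix p :: "complex \<times> real" assume "p \<in> {p. (cmod (fst p))\<^sup>2 + 1 + (snd p)\<^sup>2 \<le> 2 * r * snd p}"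
    then have p: "(cmod (fst p))\<^sup>2 + 1 + (snd p)\<^sup>2 \<le> 2 * r * snd p" by simp
    have sq: "(cmod (fst p))\<^sup>2 \<ge> 0" "(snd p)\<^sup>2 \<ge> 0" by simp_all
    then have "2 * r * snd p > 0" using p by linarith
    then have t: "snd p > 0" using True by (simp add: zero_less_mult_iff)
    have "snd p * snd p \<le> (2 * r) * snd p" using p sq(1) unfolding power2_eq_square by linarith
    then have t2: "snd p \<le> 2 * r" using t by simp
    have "(cmod (fst p))\<^sup>2 \<le> 2 * r * snd p" using p sq by linarith
    also have "\<dots> \<le> 2 * r * (2 * r)" using t2 True by (intro mult_left_mono) auto
    finally have "(cmod (fst p))\<^sup>2 \<le> (2 * r)\<^sup>2" by (simp add: power2_eq_square)
    then have "cmod (fst p) \<le> 2 * r" by (rule power2_le_imp_le) (use True in simp)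
    then show "p \<in> cball 0 (2 * r) \<times> {0..2 * r}" using t t2 by (simp add: mem_Times_iff)
  qed
  then have "bounded {p::complex \<times> real. (cmod (fst p))\<^sup>2 + 1 + (snd p)\<^sup>2 \<le> 2 * r * snd p}"
    by (rule bounded_subset[rotated]) (intro bounded_Times bounded_cball bounded_closed_interval)
  ultimately show ?thesis unfolding eq compact_eq_bounded_closed by blast
qed

lemma continuous_on_act:
  assumes "g \<in> carrier G"
  shows "continuous_on H3 (act g)"
proof -
  have "open (act g -` U \<inter> H3)" if "open U" for U
  proof -
    have "act g -` U \<inter> H3 = act g -` (U \<inter> H3) \<inter> H3" using act_H3[OF assms] by auto
    then show ?thesis
      using hyp_isometry.open_vimage_Int[OF hyp_isometry_act[OF assms], of "U \<inter> H3"] that open_H3 by auto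
  qed
  then show ?thesis by (simp add: continuous_on_open_vimage[OF open_H3])
qed

text \<open>By conjugation x may be taken in a compact set K that meets every orbit. Only finitely
  many elements move a point of K with cosine below 2, and each attains on K a least cosine, which
  exceeds 1 by freeness.\<close>

lemma displacement: "\<exists>\<delta>>1. \<forall>g\<in>carrier G - {\<one>}. \<forall>x\<in>H3. \<delta> \<le> hcosh x (act g x)"
proof -
  obtain r where r: "\<And>p. p \<in> H3 \<Longrightarrow> \<exists>g\<in>carrier G. hcosh jpt (act g p) \<le> r" using cocompact by blast
  define K where "K = {p \<in> H3. hcosh jpt p \<le> r}"
  obtain g where "g \<in> carrier G" "hcosh jpt (act g jpt) \<le> r" using r[OF jpt_H3] by blast
  then have "r \<ge> 1" using hcosh_ge_1[OF jpt_H3 act_H3[OF _ jpt_H3], of g] by simp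
  then have jK: "jpt \<in> K" by (simp add: K_def jpt_H3)
  \<comment> \<open>Two uses of \<open>hcosh_le_mult\<close> give 4 r^2, and the last factor 2 is
    the cap imposed on \<open>m\<close>.\<close>
  define S where "S = {g \<in> carrier G. hcosh jpt (act g jpt) \<le> 8 * r * r} - {\<one>}"
  have fS: "finite S" unfolding S_def using locally_finite[OF jpt_H3 jpt_H3] by blast
  have "\<exists>\<delta>>1. \<forall>p\<in>K. \<delta> \<le> hcosh p (act g p)" if g: "g \<in> S" for g
  proof -
    have gG: "g \<in> carrier G" "g \<noteq> \<one>" using g by (auto simp: S_def)
    have "continuous_on K (\<lambda>p. (\<lambda>(p, q). hcosh p q) (p, act g p))"
      by (rule continuous_on_compose2[OF continuous_on_hcosh])
        (auto simp: K_def act_H3[OF gG(1)] intro!: continuous_intros continuous_on_subset[OF continuous_on_act[OF gG(1)]])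
    then have "continuous_on K (\<lambda>p. hcosh p (act g p))" by simp
    moreover have "compact K" unfolding K_def by (rule compact_hcosh_le)
    ultimately obtain p where p: "p \<in> K" "\<forall>q\<in>K. hcosh p (act g p) \<le> hcosh q (act g q)"
      using continuous_attains_inf[of K] jK by blast
    have pH: "p \<in> H3" using p by (simp add: K_def)
    have "p \<noteq> act g p" using free[OF gG(1) pH] gG(2) by auto
    then have "hcosh p (act g p) \<noteq> 1" using hcosh_eq_1_iff[OF pH act_H3[OF gG(1) pH]] by simp
    then have "hcosh p (act g p) > 1" using hcosh_ge_1[OF pH act_H3[OF gG(1) pH]] by simp
    then show ?thesis using p(2) by blast
  qed
  then have "\<exists>\<delta>. \<forall>g\<in>S. \<delta> g > 1 \<and> (\<forall>p\<in>K. \<delta> g \<le> hcosh p (act g p))" by (intro bchoice) blast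
  then obtain \<delta> where \<delta>: "\<And>g. g \<in> S \<Longrightarrow> \<delta> g > 1" "\<And>g p. g \<in> S \<Longrightarrow> p \<in> K \<Longrightarrow> \<delta> g \<le> hcosh p (act g p)" by blast
  define m where "m = Min (insert 2 (\<delta> ` S))"
  have m: "m > 1" "m \<le> 2" "\<And>g. g \<in> S \<Longrightarrow> m \<le> \<delta> g" unfolding m_def using fS \<delta>(1) by auto
  have "m \<le> hcosh x (act g x)" if g: "g \<in> carrier G" "g \<noteq> \<one>" and x: "x \<in> H3" for g x
  proof (rule ccontr)
    assume "\<not> m \<le> hcosh x (act g x)"
    then have lt: "hcosh x (act g x) < m" by simp
    obtain h where h: "h \<in> carrier G" "hcosh jpt (act h x) \<le> r" using r[OF x] by blast
    define y where "y = act h x"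
    have y: "y \<in> K" "y \<in> H3" using h x act_H3 by (auto simp: K_def y_def)
    define f where "f = h \<otimes> g \<otimes> inv h"
    have f: "f \<in> carrier G" using g h by (simp add: f_def)
    have "act f y = act h (act g x)" using g h x by (simp add: f_def y_def act_mult act_H3 act_inv)
    then have eq: "hcosh y (act f y) = hcosh x (act g x)" using g h x by (simp add: y_def act_hcosh act_H3)
    have "f \<noteq> \<one>"
    proof
      assume "f = \<one>"
      moreover have "f \<otimes> h = h \<otimes> g" using g h by (simp add: f_def m_assoc)
      ultimately have "h \<otimes> g = h" using h by simp
      then show False using g h by simp
    qed
    note H = jpt_H3 y(2) act_H3[OF f y(2)] act_H3[OF f jpt_H3]
    have jy: "1 \<le> hcosh jpt y" "hcosh jpt y \<le> r" using y hcosh_ge_1[OF jpt_H3] by (auto simp: K_def)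
    have "hcosh jpt (act f jpt) \<le> 2 * hcosh jpt y * hcosh y (act f jpt)" by (intro hcosh_le_mult H)
    also have "\<dots> \<le> 2 * hcosh jpt y * (2 * hcosh y (act f y) * hcosh (act f y) (act f jpt))"
      using jy by (intro mult_left_mono hcosh_le_mult H) auto
    also have "\<dots> = 4 * (hcosh jpt y * hcosh jpt y) * hcosh y (act f y)"
      using act_hcosh[OF f y(2) jpt_H3] hcosh_commute[of y jpt] by simp
    also have "\<dots> \<le> 4 * (r * r) * 2"
      using jy lt m(2) hcosh_ge_1[OF y(2) act_H3[OF f y(2)]] eq by (intro mult_mono) auto
    finally have fS: "f \<in> S" using f \<open>f \<noteq> \<one>\<close> by (simp add: S_def)
    show False using m(3)[OF fS] \<delta>(2)[OF fS y(1)] lt eq by linarith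
  qed
  then show ?thesis using m(1) by blast
qed

end

section \<open>Loxodromic elements\<close>

text \<open>P carries the vertical line over 0 to the axis of d, and \<nu> is the multiplier: d
  translates along the axis by ln |\<nu>| and rotates about it by the argument of \<nu>.\<close>

locale loxodromic = hyp_lattice G act + hyp_isometry P P'
  for G :: "('g, 'm) monoid_scheme" (structure) and act and P P' +
  fixes d :: 'g and \<nu> :: complex
  assumes d: "d \<in> carrier G" and \<nu>: "cmod \<nu> > 1"
    and conj: "\<And>x. x \<in> H3 \<Longrightarrow> act d (P x) = P (\<nu> * fst x, cmod \<nu> * snd x)"
begin

definition strip :: "(complex \<times> real) set" where
  "strip = {x \<in> H3. 1 \<le> snd (P' x) \<and> snd (P' x) < cmod \<nu>}"

lemma \<nu>_nonzero: "\<nu> \<noteq> 0"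
  using \<nu> by auto

lemma dilation_H3: "x \<in> H3 \<Longrightarrow> (\<nu> * fst x, cmod \<nu> * snd x) \<in> H3"
  by (simp add: H3_iff \<nu>_nonzero)

lemma height_act:
  assumes x: "x \<in> H3"
  shows "snd (P' (act d x)) = cmod \<nu> * snd (P' x)"
proof -
  have "act d x = P (\<nu> * fst (P' x), cmod \<nu> * snd (P' x))" using conj[of "P' x"] x by (simp add: g'_H3 g_g')
  then show ?thesis using dilation_H3[OF g'_H3[OF x]] by (simp add: g'_g)
qed

lemma height_nat_pow:
  assumes x: "x \<in> H3"
  shows "snd (P' (act (d [^] (n::nat)) x)) = cmod \<nu> powr real n * snd (P' x)"
proof (induction n)
  case 0
  then show ?case using \<nu>_nonzero act_one[OF x] by simp
next
  case (Suc n)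
  have "act (d [^] Suc n) x = act d (act (d [^] n) x)"
    using act_mult[OF d nat_pow_closed[OF d, of n] x] nat_pow_Suc2[OF d, of n] by simp
  then have "snd (P' (act (d [^] Suc n) x)) = cmod \<nu> * (cmod \<nu> powr real n * snd (P' x))"
    using height_act[OF act_H3[OF nat_pow_closed[OF d, of n] x]] Suc by simp
  then show ?case using \<nu> by (simp add: powr_add)
qed

lemma height_int_pow:
  assumes x: "x \<in> H3"
  shows "snd (P' (act (d [^] (k::int)) x)) = cmod \<nu> powr real_of_int k * snd (P' x)"
proof (cases k rule: int_cases2)
  case (nonneg n)
  then show ?thesis using height_nat_pow[OF x, of n] d by (simp add: int_pow_int)
next
  case (nonpos n)
  have dn: "d [^] n \<in> carrier G" using d by simp
  define y where "y = act (inv (d [^] n)) x"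
  have y: "y \<in> H3" using act_H3[OF inv_closed[OF dn] x] by (simp add: y_def)
  have "act (d [^] n) y = x" using act_inv'[OF dn x] by (simp add: y_def)
  then have "snd (P' x) = cmod \<nu> powr real n * snd (P' y)" using height_nat_pow[OF y, of n] by simp
  then have "snd (P' y) = cmod \<nu> powr (- real n) * snd (P' x)" using \<nu>_nonzero by (simp add: powr_minus)
  then show ?thesis using nonpos d by (simp add: y_def int_pow_neg_int)
qed

text \<open>In normal form d multiplies the height by \<open>cmod \<nu>\<close>, so the floor of the
  logarithm of the height determines the power.\<close>

lemma strip_unique:
  assumes x: "x \<in> H3"
  shows "\<exists>!k::int. act (d [^] k) x \<in> strip"
proof -
  define s where "s = snd (P' x)"
  have s: "s > 0" using g'_H3[OF x] by (simp add: s_def H3_iff)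
  define L where "L = log (cmod \<nu>) s"
  have "act (d [^] k) x \<in> strip \<longleftrightarrow> k = - \<lfloor>L\<rfloor>" for k :: int
  proof -
    have "cmod \<nu> powr real_of_int k * s = cmod \<nu> powr (real_of_int k + L)"
      using \<nu> s \<nu>_nonzero by (simp add: L_def powr_add)
    then have eq: "snd (P' (act (d [^] k) x)) = cmod \<nu> powr (real_of_int k + L)"
      using height_int_pow[OF x] by (simp add: s_def)
    have "act (d [^] k) x \<in> H3" using d x by (intro act_H3) auto
    then have "act (d [^] k) x \<in> strip \<longleftrightarrow>
        cmod \<nu> powr 0 \<le> cmod \<nu> powr (real_of_int k + L) \<and> cmod \<nu> powr (real_of_int k + L) < cmod \<nu> powr 1"
      using \<nu> by (simp add: strip_def eq)
    also have "\<dots> \<longleftrightarrow> 0 \<le> real_of_int k + L \<and> real_of_int k + L < 1"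
      using \<nu> by (simp only: powr_le_cancel_iff powr_less_cancel_iff)
    also have "\<dots> \<longleftrightarrow> \<lfloor>L\<rfloor> = - k" by (auto simp: floor_eq_iff)
    finally show ?thesis by auto
  qed
  then show ?thesis by simp
qed

text \<open>On the strip the heights in normal form are bounded, and the displacement grows with |1
  - \<nu>| |z|. A bound on it therefore bounds z.\<close>

lemma strip_proper: "\<exists>r. \<forall>x\<in>strip. hcosh x (act d x) \<le> \<rho> \<longrightarrow> hcosh jpt x \<le> r"
proof -
  define E where "E = cmod \<nu>"
  have E: "E > 1" using \<nu> by (simp add: E_def)
  have ne: "cmod (1 - \<nu>) > 0" using \<nu> by auto
  define b where "b = 2 * E * \<bar>\<rho>\<bar> * E\<^sup>2 / (cmod (1 - \<nu>))\<^sup>2"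
  have "hcosh jpt x \<le> 2 * hcosh jpt (P jpt) * ((b + 1 + E\<^sup>2) / 2)" if x: "x \<in> strip" "hcosh x (act d x) \<le> \<rho>" for x
  proof -
    define y where "y = P' x"
    have xH: "x \<in> H3" using x by (simp add: strip_def)
    have yH: "y \<in> H3" "P y = x" using xH by (simp_all add: y_def g'_H3 g_g')
    have y: "1 \<le> snd y" "snd y < E" using x by (simp_all add: strip_def y_def E_def)
    have "hcosh x (act d x) = hcosh y (\<nu> * fst y, E * snd y)"
      using conj[OF yH(1)] g_iso[OF yH(1) dilation_H3[OF yH(1)]] by (simp add: yH E_def)
    then have le: "hcosh y (\<nu> * fst y, E * snd y) \<le> \<bar>\<rho>\<bar>" using x by simp
    have eqn: "2 * snd y * (E * snd y) * hcosh y (\<nu> * fst y, E * snd y) =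
        (cmod (fst y - \<nu> * fst y))\<^sup>2 + (snd y)\<^sup>2 + (E * snd y)\<^sup>2"
      using hcosh_mult[OF yH(1) dilation_H3[OF yH(1)]] by (simp add: E_def)
    have "fst y - \<nu> * fst y = (1 - \<nu>) * fst y" by (simp add: algebra_simps)
    then have "(cmod (1 - \<nu>))\<^sup>2 * (cmod (fst y))\<^sup>2 = (cmod (fst y - \<nu> * fst y))\<^sup>2"
      by (simp add: norm_mult power_mult_distrib)
    also have "\<dots> \<le> 2 * snd y * (E * snd y) * hcosh y (\<nu> * fst y, E * snd y)" unfolding eqn by simp
    also have "\<dots> \<le> 2 * snd y * (E * snd y) * \<bar>\<rho>\<bar>" using le y E by (intro mult_left_mono) auto
    also have "\<dots> = (2 * E * \<bar>\<rho>\<bar>) * (snd y)\<^sup>2" by (simp add: power2_eq_square)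
    also have "\<dots> \<le> (2 * E * \<bar>\<rho>\<bar>) * E\<^sup>2" using y E by (intro mult_left_mono power_mono) auto
    finally have z: "(cmod (fst y))\<^sup>2 \<le> b" using ne by (simp add: b_def field_simps)
    have t2: "(snd y)\<^sup>2 \<le> E\<^sup>2" using y by (intro power_mono) auto
    have "hcosh jpt y = ((cmod (fst y))\<^sup>2 + 1 + (snd y)\<^sup>2) / (2 * snd y)"
      using hcosh_eq[OF jpt_H3 yH(1)] by (simp add: jpt_def)
    also have "\<dots> \<le> (b + 1 + E\<^sup>2) / 2" using z t2 y zero_le_power2[of "cmod (fst y)"] zero_le_power2[of E] by (intro frac_le) linarith+
    finally have jy: "hcosh jpt y \<le> (b + 1 + E\<^sup>2) / 2" .
    have "hcosh jpt x \<le> 2 * hcosh jpt (P jpt) * hcosh (P jpt) x" by (intro hcosh_le_mult jpt_H3 xH g_H3)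
    also have "hcosh (P jpt) x = hcosh jpt y" using g_iso[OF jpt_H3 yH(1)] yH(2) by simp
    also have "2 * hcosh jpt (P jpt) * hcosh jpt y \<le> 2 * hcosh jpt (P jpt) * ((b + 1 + E\<^sup>2) / 2)"
      using jy hcosh_ge_1[OF jpt_H3 g_H3[OF jpt_H3]] by (intro mult_left_mono) auto
    finally show ?thesis .
  qed
  then show ?thesis by blast
qed

lemma strip_borel [measurable]: "strip \<in> sets borel"
proof -
  have "{x. 1 \<le> snd (P' x) \<and> snd (P' x) < cmod \<nu>} \<in> sets borel" by measurable
  then have "H3 \<inter> {x. 1 \<le> snd (P' x) \<and> snd (P' x) < cmod \<nu>} \<in> sets borel" by (intro sets.Int H3_borel)
  moreover have "strip = H3 \<inter> {x. 1 \<le> snd (P' x) \<and> snd (P' x) < cmod \<nu>}" by (auto simp: strip_def)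
  ultimately show ?thesis by simp
qed

lemma slab_strip: "slab d strip"
  unfolding slab_def
proof (intro conjI allI ballI)
  show "strip \<subseteq> H3" by (auto simp: strip_def)
qed (fact strip_borel strip_unique strip_proper)+

lemma orb_strip:
  assumes K: "inv_kernel K"
    and inv: "\<And>y p q. y \<in> H3 \<Longrightarrow> p \<in> H3 \<Longrightarrow> q \<in> H3 \<Longrightarrow> K (P y) (P p) (P q) = K y p q"
  shows "(\<integral>\<^sup>+ x. orb K d x * indicator strip x \<partial>hyp_volume) =
    (\<integral>\<^sup>+ x. (\<integral>\<^sup>+ y. K y x (\<nu> * fst x, cmod \<nu> * snd x) \<partial>hyp_volume) * indicator {1..<cmod \<nu>} (snd x) \<partial>hyp_volume)"
proof -
  have [measurable]: "orb K d \<in> borel_measurable borel" by (rule orb_measurable[OF K d])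
  have "(\<integral>\<^sup>+ x. orb K d x * indicator strip x \<partial>hyp_volume) = (\<integral>\<^sup>+ x. orb K d (P x) * indicator strip (P x) \<partial>hyp_volume)"
    by (rule nn_integral_isometry[symmetric]) measurable
  also have "\<dots> = (\<integral>\<^sup>+ x. (\<integral>\<^sup>+ y. K y x (\<nu> * fst x, cmod \<nu> * snd x) \<partial>hyp_volume) * indicator {1..<cmod \<nu>} (snd x) \<partial>hyp_volume)"
  proof (rule nn_integral_cong_AE, use AE_hyp_volume_H3 in eventually_elim)
    fix x assume x: "x \<in> H3"
    have m: "(\<lambda>y. K y (P x) (act d (P x))) \<in> borel_measurable borel" using K unfolding inv_kernel_def by blast
    have "orb K d (P x) = (\<integral>\<^sup>+ y. K (P y) (P x) (act d (P x)) \<partial>hyp_volume)"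
      unfolding orb_def by (rule nn_integral_isometry[symmetric, OF m])
    also have "\<dots> = (\<integral>\<^sup>+ y. K y x (\<nu> * fst x, cmod \<nu> * snd x) \<partial>hyp_volume)"
      by (rule nn_integral_cong_AE, use AE_hyp_volume_H3 in eventually_elim)
        (simp only: conj[OF x] inv[OF _ x dilation_H3[OF x]])
    finally have "orb K d (P x) = (\<integral>\<^sup>+ y. K y x (\<nu> * fst x, cmod \<nu> * snd x) \<partial>hyp_volume)" .
    moreover have "indicator strip (P x) = (indicator {1..<cmod \<nu>} (snd x) :: ennreal)"
      using x by (auto simp: strip_def g_H3 g'_g indicator_def)
    ultimately show "orb K d (P x) * indicator strip (P x) =
        (\<integral>\<^sup>+ y. K y x (\<nu> * fst x, cmod \<nu> * snd x) \<partial>hyp_volume) * indicator {1..<cmod \<nu>} (snd x)" by simp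
  qed
  finally show ?thesis .
qed

lemma slab_inequality:
  assumes "\<kappa> \<ge> 0" "C \<ge> 1" "sign_condition \<kappa> C (cmod \<nu>)"
  shows "\<exists>X. slab d X \<and>
    (\<integral>\<^sup>+ x. orb (kerP \<kappa> C) d x * indicator X x \<partial>hyp_volume) \<le> (\<integral>\<^sup>+ x. orb (kerQ \<kappa> C) d x * indicator X x \<partial>hyp_volume)"
proof (rule exI, rule conjI[OF slab_strip])
  have "(\<integral>\<^sup>+ x. orb (kerP \<kappa> C) d x * indicator strip x \<partial>hyp_volume) =
      (\<integral>\<^sup>+ x. (\<integral>\<^sup>+ y. kerP \<kappa> C y x (\<nu> * fst x, cmod \<nu> * snd x) \<partial>hyp_volume) * indicator {1..<cmod \<nu>} (snd x) \<partial>hyp_volume)"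
    by (rule orb_strip[OF inv_kernel_kerP]) (simp add: kerP_def hk_def g_iso)
  also have "\<dots> \<le> (\<integral>\<^sup>+ x. (\<integral>\<^sup>+ y. kerQ \<kappa> C y x (\<nu> * fst x, cmod \<nu> * snd x) \<partial>hyp_volume) * indicator {1..<cmod \<nu>} (snd x) \<partial>hyp_volume)"
    by (rule strip_le) (use assms \<nu> in auto)
  also have "\<dots> = (\<integral>\<^sup>+ x. orb (kerQ \<kappa> C) d x * indicator strip x \<partial>hyp_volume)"
    by (rule orb_strip[OF inv_kernel_kerQ, symmetric]) (simp add: kerQ_def hk_def g_iso)
  finally show "(\<integral>\<^sup>+ x. orb (kerP \<kappa> C) d x * indicator strip x \<partial>hyp_volume) \<le> (\<integral>\<^sup>+ x. orb (kerQ \<kappa> C) d x * indicator strip x \<partial>hyp_volume)" .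
qed

end

section \<open>Volume, multipliers and closed geodesics of the manifold\<close>

context hyp_manifold
begin

text \<open>Freeness of the action matches injectivity of the projection on F with uniqueness of the
  group element.\<close>

lemma fundamental_set_iff: "fundamental_set \<Gamma> F \<longleftrightarrow> is_fund F"
proof -
  have one: "\<one>\<^bsub>PSL2C\<^esub> \<in> \<Gamma>" using subgroup.one_closed[OF subgroup] .
  have "bij_betw (orbit_proj \<Gamma>) F (orbit_proj \<Gamma> ` H3) \<longleftrightarrow> (\<forall>x\<in>H3. \<exists>!g. g \<in> \<Gamma> \<and> PSL2C_act g x \<in> F)"
    if FH: "F \<subseteq> H3"
  proof
    assume bij: "bij_betw (orbit_proj \<Gamma>) F (orbit_proj \<Gamma> ` H3)"
    show "\<forall>x\<in>H3. \<exists>!g. g \<in> \<Gamma> \<and> PSL2C_act g x \<in> F"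
    proof
      fix x assume x: "x \<in> H3"
      then have "orbit_proj \<Gamma> x \<in> orbit_proj \<Gamma> ` F" using bij by (auto simp: bij_betw_def)
      then obtain y where y: "y \<in> F" "orbit_proj \<Gamma> x = orbit_proj \<Gamma> y" by blast
      then have yH: "y \<in> H3" using FH by blast
      obtain g where g: "g \<in> \<Gamma>" "PSL2C_act g x = y" using orbit_proj_eq_iff[OF x yH] y by blast
      show "\<exists>!g. g \<in> \<Gamma> \<and> PSL2C_act g x \<in> F"
      proof (rule ex1I[of _ g])
        show "g \<in> \<Gamma> \<and> PSL2C_act g x \<in> F" using g y by simp
        fix h assume h: "h \<in> \<Gamma> \<and> PSL2C_act h x \<in> F"
        then have "orbit_proj \<Gamma> x = orbit_proj \<Gamma> (PSL2C_act h x)" using orbit_proj_eq_iff[OF x] FH by blast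
        then have "PSL2C_act h x = y" using y h bij unfolding bij_betw_def inj_on_def by metis
        then have eq: "PSL2C_act h x = PSL2C_act g x" using g by simp
        have hg: "h \<in> carrier (PSL2C\<lparr>carrier := \<Gamma>\<rparr>)" "g \<in> carrier (PSL2C\<lparr>carrier := \<Gamma>\<rparr>)" using h g by auto
        let ?G = "PSL2C\<lparr>carrier := \<Gamma>\<rparr>"
        have "PSL2C_act (inv\<^bsub>?G\<^esub> g \<otimes>\<^bsub>?G\<^esub> h) x = x"
          using act_mult[OF inv_closed[OF hg(2)] hg(1) x] act_inv[OF hg(2) x] eq by simp
        then have "inv\<^bsub>?G\<^esub> g \<otimes>\<^bsub>?G\<^esub> h = \<one>\<^bsub>?G\<^esub>" 
          by (rule free[OF m_closed[OF inv_closed[OF hg(2)] hg(1)] x])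
        then have "inv\<^bsub>?G\<^esub> (inv\<^bsub>?G\<^esub> g) = h" using hg by (intro inv_equality inv_closed) (metis inv_comm inv_closed)
        then show "h = g" using hg by simp
      qed
    qed
  next
    assume ex: "\<forall>x\<in>H3. \<exists>!g. g \<in> \<Gamma> \<and> PSL2C_act g x \<in> F"
    have "inj_on (orbit_proj \<Gamma>) F"
    proof (rule inj_onI)
      fix x y assume xy: "x \<in> F" "y \<in> F" "orbit_proj \<Gamma> x = orbit_proj \<Gamma> y"
      then have H: "x \<in> H3" "y \<in> H3" using FH by auto
      obtain g where g: "g \<in> \<Gamma>" "PSL2C_act g x = y" using orbit_proj_eq_iff[OF H] xy by blast
      have "g = \<one>\<^bsub>PSL2C\<^esub>" using ex[rule_format, OF H(1)] g xy one act_one' by metis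
      then show "x = y" using g act_one' by metis
    qed
    moreover have "orbit_proj \<Gamma> ` F = orbit_proj \<Gamma> ` H3"
    proof
      show "orbit_proj \<Gamma> ` F \<subseteq> orbit_proj \<Gamma> ` H3" using FH by blast
      show "orbit_proj \<Gamma> ` H3 \<subseteq> orbit_proj \<Gamma> ` F"
      proof
        fix u assume "u \<in> orbit_proj \<Gamma> ` H3"
        then obtain x where x: "x \<in> H3" "u = orbit_proj \<Gamma> x" by blast
        then obtain g where g: "g \<in> \<Gamma>" "PSL2C_act g x \<in> F" using ex by blast
        then have "orbit_proj \<Gamma> x = orbit_proj \<Gamma> (PSL2C_act g x)" using orbit_proj_eq_iff[OF x(1)] FH by blast
        then show "u \<in> orbit_proj \<Gamma> ` F" using g x by blast
      qed
    qed
    ultimately show "bij_betw (orbit_proj \<Gamma>) F (orbit_proj \<Gamma> ` H3)" by (simp add: bij_betw_def)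
  qed
  then have "F \<subseteq> H3 \<Longrightarrow> bij_betw (orbit_proj \<Gamma>) F (orbit_proj \<Gamma> ` H3) \<longleftrightarrow>
      (\<forall>x\<in>H3. \<exists>!g. g \<in> carrier (PSL2C\<lparr>carrier := \<Gamma>\<rparr>) \<and> PSL2C_act g x \<in> F)" by simp
  then show ?thesis unfolding fundamental_set_def is_fund_def topspace_quotient_space by (intro conj_cong refl)
qed

lemma is_fund_some: "is_fund (SOME F. fundamental_set \<Gamma> F)"
  using ex_is_fund someI_ex[of "fundamental_set \<Gamma>"] by (simp add: fundamental_set_iff)

text \<open>A positive lower bound for the displacement excludes elliptic elements, which have a fixed
  point, and parabolic ones, which move high points of a horoball arbitrarily little.\<close>

lemma ex_loxodromic:
  assumes g: "g \<in> \<Gamma>" "g \<noteq> \<one>\<^bsub>PSL2C\<^esub>"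
  obtains B \<nu> where "loxodromic (PSL2C\<lparr>carrier := \<Gamma>\<rparr>) PSL2C_act (poincare_ext B) (poincare_ext (adj2 B)) g \<nu>"
proof -
  obtain A where A: "det A = 1" "g = psl A" using lift[OF g(1)] by blast
  obtain B \<nu> \<tau> where B: "det B = 1" and \<nu>: "\<nu> \<noteq> 0" "cmod \<nu> \<ge> 1"
    and AB: "(A ** B) $ 1 $ 1 = \<nu> * B $ 1 $ 1" "(A ** B) $ 2 $ 1 = \<nu> * B $ 2 $ 1"
    "(A ** B) $ 1 $ 2 = \<tau> * B $ 1 $ 1 + B $ 1 $ 2 / \<nu>" "(A ** B) $ 2 $ 2 = \<tau> * B $ 2 $ 1 + B $ 2 $ 2 / \<nu>"
    using triangularize[OF A(1)] by blast
  define U :: "complex^2^2" where "U = vector [vector [\<nu>, \<tau>], vector [0, 1 / \<nu>]]"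
  have U: "U $ 1 $ 1 = \<nu>" "U $ 1 $ 2 = \<tau>" "U $ 2 $ 1 = 0" "U $ 2 $ 2 = 1 / \<nu>" by (simp_all add: U_def)
  have detU: "det U = 1" using \<nu> by (simp add: det_2 U)
  have ABU: "A ** B = B ** U" unfolding mat2_eq_iff AB by (simp add: mat2_mult U)
  have PU: "poincare_ext U (z, t) = (\<nu>\<^sup>2 * z + \<tau> * \<nu>, (cmod \<nu>)\<^sup>2 * t)" for z t
  proof -
    have "cnj (1 / \<nu>) / of_real ((cmod (1 / \<nu>))\<^sup>2) = \<nu>"
    proof -
      have "complex_of_real ((cmod (1 / \<nu>))\<^sup>2) = (1 / \<nu>) * cnj (1 / \<nu>)" by (rule complex_norm_square)
      then show ?thesis using \<nu>(1) by simp
    qed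
    then have "(\<nu> * z + \<tau>) * cnj (1 / \<nu>) / of_real ((cmod (1 / \<nu>))\<^sup>2) = (\<nu> * z + \<tau>) * \<nu>"
      by (metis times_divide_eq_right)
    then show ?thesis
      using \<nu>(1) by (simp add: poincare_ext_def Let_def U algebra_simps power2_eq_square norm_divide)
  qed
  have conj: "PSL2C_act g (poincare_ext B x) = poincare_ext B (poincare_ext U x)" if "x \<in> H3" for x
    using that A B detU by (simp flip: poincare_ext_mult add: ABU)
  interpret P: hyp_isometry "poincare_ext B" "poincare_ext (adj2 B)"
    by (rule hyp_isometry_poincare_ext) (use B adj2_inverse[OF B] in auto)
  obtain \<delta> where \<delta>: "\<delta> > 1" "\<And>x. x \<in> H3 \<Longrightarrow> \<delta> \<le> hcosh x (PSL2C_act g x)"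
    using displacement g by auto
  have displ: "\<delta> \<le> hcosh x (poincare_ext U x)" if x: "x \<in> H3" for x
  proof -
    interpret U: sl2 U by unfold_locales (rule detU)
    show ?thesis using \<delta>(2)[OF P.g_H3[OF x]] unfolding conj[OF x] P.g_iso[OF x U.poincare_ext_H3[OF x]] .
  qed
  \<comment> \<open>Otherwise U is a unipotent matrix up to sign and moves (0, q) horizontally by
    the modulus of \<tau>; at large height q the cosine of this displacement is arbitrarily close to
    1.\<close>
  have \<nu>2: "\<nu>\<^sup>2 \<noteq> 1"
  proof
    assume eq: "\<nu>\<^sup>2 = 1"
    then have c: "cmod \<nu> = 1" by (auto simp: power2_eq_1_iff)
    define q where "q = max 1 ((cmod \<tau>)\<^sup>2 / (\<delta> - 1))"
    have q: "q \<ge> 1" "(cmod \<tau>)\<^sup>2 / (\<delta> - 1) \<le> q" by (simp_all add: q_def)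
    have H: "(0, q) \<in> H3" using q by (simp add: H3_iff)
    have "hcosh (0, q) (poincare_ext U (0, q)) = 1 + (cmod \<tau>)\<^sup>2 / (2 * q * q)"
      using q by (simp add: PU hcosh_def c norm_mult)
    moreover have "(cmod \<tau>)\<^sup>2 / (2 * q * q) < \<delta> - 1"
    proof -
      have "(cmod \<tau>)\<^sup>2 \<le> q * (\<delta> - 1)" using q(2) \<delta>(1) by (simp add: field_simps)
      also have "\<dots> < (2 * q * q) * (\<delta> - 1)" using q(1) \<delta>(1) by (intro mult_strict_right_mono) auto
      finally show ?thesis using q(1) by (simp add: field_simps)
    qed
    ultimately show False using displ[OF H] by simp
  qed
  \<comment> \<open>The fixed point of z -> \<nu>^2 z + \<tau> \<nu>. Translating it to 0
    diagonalises U; if \<nu> had modulus 1, the point above it would be fixed too.\<close>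
  define w where "w = \<tau> * \<nu> / (1 - \<nu>\<^sup>2)"
  have w: "\<nu>\<^sup>2 * w + \<tau> * \<nu> = w" using \<nu>2 by (simp add: w_def field_simps)
  have c1: "cmod \<nu> > 1"
  proof (rule ccontr)
    assume "\<not> cmod \<nu> > 1"
    then have "cmod \<nu> = 1" using \<nu> by simp
    then have "poincare_ext U (w, 1) = (w, 1)" by (simp add: PU w)
    then show False using displ[of "(w, 1)"] \<delta>(1) by (simp add: H3_iff)
  qed
  define W :: "complex^2^2" where "W = vector [vector [1, w], vector [0, 1]]"
  have W: "W $ 1 $ 1 = 1" "W $ 1 $ 2 = w" "W $ 2 $ 1 = 0" "W $ 2 $ 2 = 1" by (simp_all add: W_def)
  have detW: "det W = 1" by (simp add: det_2 W)
  have PW: "poincare_ext W (z, t) = (z + w, t)" for z t by (simp add: poincare_ext_def Let_def W)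
  have detBW: "det (B ** W) = 1" by (simp add: det_mul B detW)
  \<comment> \<open>The multiplier is the square of the eigenvalue.\<close>
  have "loxodromic (PSL2C\<lparr>carrier := \<Gamma>\<rparr>) PSL2C_act (poincare_ext (B ** W)) (poincare_ext (adj2 (B ** W))) g (\<nu>\<^sup>2)"
  proof (intro loxodromic.intro loxodromic_axioms.intro hyp_lattice_axioms)
    show "hyp_isometry (poincare_ext (B ** W)) (poincare_ext (adj2 (B ** W)))"
      by (rule hyp_isometry_poincare_ext) (use detBW adj2_inverse[OF detBW] in auto)
    show "g \<in> carrier (PSL2C\<lparr>carrier := \<Gamma>\<rparr>)" using g by simp
    show "cmod (\<nu>\<^sup>2) > 1" using c1 by (simp add: norm_power one_less_power)
    fix x :: "complex \<times> real" assume x: "x \<in> H3"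
    obtain z t where zt: "x = (z, t)" by fastforce
    have H: "(z + w, t) \<in> H3" "(\<nu>\<^sup>2 * z, (cmod \<nu>)\<^sup>2 * t) \<in> H3" using x \<nu>(1) by (simp_all add: zt H3_iff)
    have "poincare_ext U (z + w, t) = (\<nu>\<^sup>2 * z + w, (cmod \<nu>)\<^sup>2 * t)" using w by (simp add: PU algebra_simps)
    then have "PSL2C_act g (poincare_ext B (poincare_ext W x)) = poincare_ext B (poincare_ext W (\<nu>\<^sup>2 * z, (cmod \<nu>)\<^sup>2 * t))"
      using conj[OF H(1)] by (simp add: zt PW)
    then show "PSL2C_act g (poincare_ext (B ** W) x) = poincare_ext (B ** W) (\<nu>\<^sup>2 * fst x, cmod (\<nu>\<^sup>2) * snd x)"
      using H x by (simp add: poincare_ext_mult B detW zt norm_power)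
  qed
  then show ?thesis by (rule that)
qed

text \<open>The vertical line over 0, carried by P to the axis of g and parametrised by arc length,
  projects to a curve that closes up after ln |\<nu>|, so this number is one of the lengths in the
  infimum.\<close>

lemma systole_le:
  assumes "loxodromic (PSL2C\<lparr>carrier := \<Gamma>\<rparr>) PSL2C_act P P' g \<nu>"
  shows "systole \<Gamma> \<le> ln (cmod \<nu>)"
  unfolding systole_def
proof (rule cInf_lower)
  interpret L: loxodromic "PSL2C\<lparr>carrier := \<Gamma>\<rparr>" PSL2C_act P P' g \<nu> by fact
  define c where "c t = P (0, exp t)" for t
  have eH: "(0, exp t) \<in> H3" for t :: real by (simp add: H3_iff)
  have "geodesic_line c"
    unfolding geodesic_line_def
  proof (intro conjI allI)
    show "c t \<in> H3" for t by (simp add: c_def L.g_H3 eH)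
    fix s t :: real
    have "2 * exp s * exp t * hcosh (0, exp s) (0, exp t) = (exp s)\<^sup>2 + (exp t)\<^sup>2"
      using hcosh_mult[OF eH eH] by simp
    also have "\<dots> = 2 * exp s * exp t * cosh (s - t)"
      by (simp add: cosh_field_def exp_diff exp_minus field_simps power2_eq_square)
    finally have "hcosh (0, exp s) (0, exp t) = cosh \<bar>s - t\<bar>" by simp
    then show "hyp_dist (c s) (c t) = \<bar>s - t\<bar>"
      unfolding hyp_dist_eq c_def L.g_iso[OF eH eH] by (simp only: arcosh_cosh_real abs_ge_zero)
  qed
  moreover have "orbit_proj \<Gamma> (c (t + ln (cmod \<nu>))) = orbit_proj \<Gamma> (c t)" for t
  proof -
    have "c (t + ln (cmod \<nu>)) = PSL2C_act g (c t)"
      using L.conj[OF eH, of t] L.\<nu> L.\<nu>_nonzero by (simp add: c_def exp_add mult.commute)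
    moreover have "c t \<in> H3" by (simp add: c_def L.g_H3 eH)
    ultimately show ?thesis
      using orbit_proj_eq_iff[of "c t" "PSL2C_act g (c t)"] act_H3[OF L.d, of "c t"] L.d by auto
  qed
  ultimately show "ln (cmod \<nu>) \<in> {l. \<exists>\<sigma>. closed_geodesic_of_length \<Gamma> \<sigma> l}"
    using ln_gt_zero[OF L.\<nu>] unfolding closed_geodesic_of_length_def mem_Collect_eq
    by (intro exI[of _ "orbit_proj \<Gamma> \<circ> c"] conjI exI[of _ c]) auto
  show "bdd_below {l. \<exists>\<sigma>. closed_geodesic_of_length \<Gamma> \<sigma> l}"
    by (rule bdd_belowI[of _ 0]) (auto simp: closed_geodesic_of_length_def)
qed

text \<open>Since 1/12 + 17/120 = 9/40, the trace inequality reads 4/9 pi^2 (C - 1)^6 <= 9/10 pi V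
  C^4. The systole enters through \<open>systole_le\<close>: every multiplier has modulus at least
  r^2.\<close>

lemma volume_bound:
  assumes V: "manifold_volume \<Gamma> > 0" and r: "r \<ge> 32" and sys: "ln (r\<^sup>2) \<le> systole \<Gamma>" and C: "C = 5 / 4 * r"
  shows "40 * pi * (C - 1) ^ 6 \<le> 81 * manifold_volume \<Gamma> * C ^ 4"
proof -
  define \<kappa> where "\<kappa> = 17 / (2 * C\<^sup>2)"
  have C1: "C \<ge> 1" and \<kappa>: "\<kappa> \<ge> 0" using r C by (simp_all add: \<kappa>_def)
  define F where "F = (SOME F. fundamental_set \<Gamma> F)"
  have F: "is_fund F" unfolding F_def by (rule is_fund_some)
  have vol: "manifold_volume \<Gamma> = measure hyp_volume F" by (simp add: manifold_volume_def F_def)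
  \<comment> \<open>\<open>measure\<close> is 0 on sets of infinite measure, so a positive value
    certifies that the volume is finite.\<close>
  then have eV: "emeasure hyp_volume F = ennreal (manifold_volume \<Gamma>)"
    using V by (metis emeasure_eq_ennreal_measure measure_zero_top less_irrefl)
  have "(2 * pi / 3 * (C - 1) ^ 3)\<^sup>2 \<le> manifold_volume \<Gamma> * (4 * pi * (C ^ 4 / 12 + \<kappa> * C ^ 6 / 60))"
  proof (rule trace_inequality[OF F eV V \<kappa>])
    fix d assume d: "d \<in> carrier (PSL2C\<lparr>carrier := \<Gamma>\<rparr>)" "d \<noteq> \<one>\<^bsub>PSL2C\<lparr>carrier := \<Gamma>\<rparr>\<^esub>"
    then obtain B \<nu> where L: "loxodromic (PSL2C\<lparr>carrier := \<Gamma>\<rparr>) PSL2C_act (poincare_ext B) (poincare_ext (adj2 B)) d \<nu>"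
      using ex_loxodromic[of d] by auto
    interpret L: loxodromic "PSL2C\<lparr>carrier := \<Gamma>\<rparr>" PSL2C_act "poincare_ext B" "poincare_ext (adj2 B)" d \<nu> by (rule L)
    have "ln (r\<^sup>2) \<le> ln (cmod \<nu>)" using sys systole_le[OF L] by simp
    then have "cmod \<nu> \<ge> r\<^sup>2" using r L.\<nu> by (subst (asm) ln_le_cancel_iff) (auto simp: L.\<nu>_nonzero)
    then have "sign_condition \<kappa> C (cmod \<nu>)" unfolding \<kappa>_def by (rule sign_condition[OF r C])
    then show "\<exists>X. slab d X \<and> (\<integral>\<^sup>+ x. orb (kerP \<kappa> C) d x * indicator X x \<partial>hyp_volume) \<le>
        (\<integral>\<^sup>+ x. orb (kerQ \<kappa> C) d x * indicator X x \<partial>hyp_volume)"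
      by (rule L.slab_inequality[OF \<kappa> C1])
  next
    show "(\<integral>\<^sup>+ y. kerP \<kappa> C y x x \<partial>hyp_volume) \<le> ennreal (4 * pi * (C ^ 4 / 12 + \<kappa> * C ^ 6 / 60))" if "x \<in> H3" for x
      by (rule identity_bound[OF that C1 \<kappa>])
    show "ennreal (2 * pi / 3 * (C - 1) ^ 3) \<le> (\<integral>\<^sup>+ y. ennreal (hk C y x) \<partial>hyp_volume)" if "x \<in> H3" for x
      by (rule mean_bound[OF that C1])
  qed (use C1 \<kappa> in auto)
  moreover have "\<kappa> * C ^ 6 / 60 = 17 / 120 * C ^ 4" using C1 by (simp add: \<kappa>_def field_simps power2_eq_square eval_nat_numeral)
  ultimately have "4 / 9 * pi * (pi * (C - 1) ^ 6) \<le> 4 / 9 * pi * (81 / 40 * manifold_volume \<Gamma> * C ^ 4)"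
    by (simp add: power_mult_distrib power_divide power2_eq_square algebra_simps flip: power_mult)
  then have "pi * (C - 1) ^ 6 \<le> 81 / 40 * manifold_volume \<Gamma> * C ^ 4" by simp
  then show ?thesis by simp
qed

end

section \<open>Numerical conclusion\<close>

text \<open>The remainder after six Taylor terms carries an even power and is nonnegative.\<close>

lemma exp_bound: "exp (- 0.8482) \<ge> (0.4274::real)"
proof -
  obtain t where "exp (- 0.8482) = (\<Sum>m<6. (- 0.8482) ^ m / fact m) + (exp t / fact 6) * (- 0.8482::real) ^ 6"
    using Maclaurin_exp_le[of "- 0.8482" 6] by blast
  moreover have "(exp t / fact 6) * (- 0.8482::real) ^ 6 \<ge> 0" by simp
  moreover have "(\<Sum>m<6. (- 0.8482) ^ m / fact m) \<ge> (0.4274::real)"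
    by (simp add: eval_nat_numeral)
  ultimately show ?thesis by linarith
qed

theorem theorem1p4:
  shows "\<exists>V\<^sub>0::real. V\<^sub>0 > 0 \<and>
    (\<forall>\<Gamma>. closed_hyperbolic_3_manifold \<Gamma> \<and> manifold_volume \<Gamma> > V\<^sub>0 \<longrightarrow>
          systole \<Gamma> < ln (manifold_volume \<Gamma>) - 0.8482)"
\<comment> \<open>Ample for \<open>r \<ge> 200\<close> and \<open>C \<ge> 250\<close> below.\<close>
proof (intro exI[of _ "10 ^ 6"] conjI allI impI)
  fix \<Gamma> assume "closed_hyperbolic_3_manifold \<Gamma> \<and> manifold_volume \<Gamma> > 10 ^ 6"
  then have closed: "closed_hyperbolic_3_manifold \<Gamma>" and V: "manifold_volume \<Gamma> > 10 ^ 6" by auto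
  interpret hyp_manifold \<Gamma> by unfold_locales fact
  define V where "V = manifold_volume \<Gamma>"
  have Vp: "V > 10 ^ 6" using V by (simp add: V_def)
  \<comment> \<open>With this r the negated claim is that the systole is at least
    \<open>ln (r\<^sup>2)\<close>.\<close>
  define r where "r = sqrt (V * exp (- 0.8482))"
  have r2: "r\<^sup>2 = V * exp (- 0.8482)" using Vp by (simp add: r_def)
  have rV: "0.4274 * V \<le> r\<^sup>2" using mult_left_mono[OF exp_bound, of V] Vp by (simp add: r2 mult.commute)
  then have "200\<^sup>2 \<le> r\<^sup>2" using Vp by simp
  then have r200: "r \<ge> 200" by (rule power2_le_imp_le) (use Vp in \<open>simp add: r_def\<close>)
  show "systole \<Gamma> < ln (manifold_volume \<Gamma>) - 0.8482"
  proof (rule ccontr)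
    assume "\<not> systole \<Gamma> < ln (manifold_volume \<Gamma>) - 0.8482"
    moreover have "ln (r\<^sup>2) = ln V - 0.8482" unfolding r2 using Vp by (simp add: ln_mult)
    ultimately have sys: "ln (r\<^sup>2) \<le> systole \<Gamma>" by (simp add: V_def)
    define C where "C = 5 / 4 * r"
    have C: "C \<ge> 250" using r200 by (simp add: C_def)
    have "40 * pi * (C - 1) ^ 6 \<le> 81 * V * C ^ 4"
      unfolding V_def using V r200 sys C_def by (intro volume_bound) auto
    also have "\<dots> \<le> 81 * (r\<^sup>2 / 0.4274) * C ^ 4"
      using rV C by (intro mult_right_mono mult_left_mono) (auto simp: field_simps)
    also have "\<dots> = 81 * (16 / 25) / 0.4274 * C ^ 6" by (simp add: C_def field_simps eval_nat_numeral)
    finally have le: "40 * pi * (C - 1) ^ 6 \<le> 81 * (16 / 25) / 0.4274 * C ^ 6" .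
    \<comment> \<open>Bernoulli's inequality limits the loss from replacing C by C - 1 to the factor
      1 - 6/250 = 0.976.\<close>
    have "1 + real 6 * (- 1 / C) \<le> (1 + (- 1 / C)) ^ 6" using C by (intro Bernoulli_inequality) (simp add: field_simps)
    moreover have "1 / C \<le> 1 / 250" using C by (simp add: field_simps)
    ultimately have "0.976 \<le> (1 - 1 / C) ^ 6" by simp
    then have "C ^ 6 * 0.976 \<le> C ^ 6 * (1 - 1 / C) ^ 6" using C by (intro mult_left_mono) auto
    also have "\<dots> = (C - 1) ^ 6" using C by (simp flip: power_mult_distrib add: right_diff_distrib)
    finally have "40 * 3.14 * (C ^ 6 * 0.976) \<le> 40 * pi * (C - 1) ^ 6"
      using pi_approx C by (intro mult_mono) auto
    then have "40 * 3.14 * (C ^ 6 * 0.976) \<le> 81 * (16 / 25) / 0.4274 * C ^ 6" using le by (rule order_trans)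
    \<comment> \<open>The constant on the left exceeds 122.5, the one on the right is below
      121.4.\<close>
    then show False using C by simp
  qed
qed simp

end
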